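(* Let $A$ be a separative, unital (complex) C*-algebra with real rank zero, let $p,q\in A$ be projections, and let $B=I+\mathbb{C}\cdot 1$, where $I=\overline{ApA}$ is the closed two-sided ideal of $A$ generated by $p$. Then $p$ and $q$ are homotopic in $A$ if and only if $q\in B$ and $p,q$ are unitarily equivalent in $B$.
   Context: $A$ has real rank zero if the self-adjoint elements with finite spectrum are dense in the self-adjoint elements of $A$. $A$ is separative if for all projections $p',q'$ in $M_\infty(A)$, $p'\oplus p'\sim p'\oplus q'\sim q'\oplus q'$ implies $p'\sim q'$ ($\sim$ = Murray–von Neumann equivalence). Projections $p,q$ are unitarily equivalent in a unital C*-algebra $B$ if $upu^*=q$ for some unitary $u\in B$; they are homotopic in $A$ if there is a norm-continuous path $f:[0,1]\to\{\text{projections in }A\}$ with $f(0)=p$, $f(1)=q$. *)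

theory Defs
  imports "HOL-Analysis.Analysis"
begin

text \<open>A unital complex C*-algebra: a unital real Banach algebra carrying a compatible
complex scalar multiplication and an involution satisfying the C*-identity.
(The class real_normed_algebra_1 requires 0 \<noteq> 1, i.e. the zero algebra is excluded.)\<close>

class cstar_algebra = real_normed_algebra_1 + banach +
  fixes scaleC :: "complex \<Rightarrow> 'a \<Rightarrow> 'a"
    and cstar :: "'a \<Rightarrow> 'a"
  assumes scaleC_add_right: "scaleC c (x + y) = scaleC c x + scaleC c y"
    and scaleC_add_left: "scaleC (c + d) x = scaleC c x + scaleC d x"
    and scaleC_scaleC: "scaleC c (scaleC d x) = scaleC (c * d) x"
    and scaleC_one: "scaleC 1 x = x"
    and scaleR_scaleC: "scaleR r x = scaleC (complex_of_real r) x"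
    and norm_scaleC: "norm (scaleC c x) = cmod c * norm x"
    and mult_scaleC_left: "scaleC c x * y = scaleC c (x * y)"
    and mult_scaleC_right: "x * scaleC c y = scaleC c (x * y)"
    and cstar_add: "cstar (x + y) = cstar x + cstar y"
    and cstar_scaleC: "cstar (scaleC c x) = scaleC (cnj c) (cstar x)"
    and cstar_mult: "cstar (x * y) = cstar y * cstar x"
    and cstar_cstar: "cstar (cstar x) = x"
    and cstar_identity: "norm (cstar x * x) = norm x ^ 2"

definition is_proj :: "'a::cstar_algebra \<Rightarrow> bool" where
  "is_proj p \<longleftrightarrow> cstar p = p \<and> p * p = p"

definition self_adjoint :: "'a::cstar_algebra \<Rightarrow> bool" where
  "self_adjoint a \<longleftrightarrow> cstar a = a"

definition spectrum :: "'a::cstar_algebra \<Rightarrow> complex set" where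
  "spectrum a = {z. \<not> (\<exists>b. (a - scaleC z 1) * b = 1 \<and> b * (a - scaleC z 1) = 1)}"

definition real_rank_zero :: "'a::cstar_algebra itself \<Rightarrow> bool" where
  "real_rank_zero _ \<longleftrightarrow>
     (\<forall>a::'a. self_adjoint a \<longrightarrow>
        (\<forall>e>0. \<exists>b. self_adjoint b \<and> finite (spectrum b) \<and> dist a b < e))"

section \<open>Matrices over A: M_\<infinity>(A) as finitely supported infinite matrices\<close>

definition in_Mn :: "nat \<Rightarrow> (nat \<Rightarrow> nat \<Rightarrow> 'a::cstar_algebra) \<Rightarrow> bool" where
  "in_Mn n P \<longleftrightarrow> (\<forall>i j. (n \<le> i \<or> n \<le> j) \<longrightarrow> P i j = 0)"

definition mmult :: "nat \<Rightarrow> (nat \<Rightarrow> nat \<Rightarrow> 'a::cstar_algebra) \<Rightarrow> (nat \<Rightarrow> nat \<Rightarrow> 'a)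
    \<Rightarrow> (nat \<Rightarrow> nat \<Rightarrow> 'a)" where
  "mmult n P Q = (\<lambda>i j. \<Sum>k<n. P i k * Q k j)"

definition madj :: "(nat \<Rightarrow> nat \<Rightarrow> 'a::cstar_algebra) \<Rightarrow> (nat \<Rightarrow> nat \<Rightarrow> 'a)" where
  "madj P = (\<lambda>i j. cstar (P j i))"

definition is_proj_Minf :: "(nat \<Rightarrow> nat \<Rightarrow> 'a::cstar_algebra) \<Rightarrow> bool" where
  "is_proj_Minf P \<longleftrightarrow> (\<exists>n. in_Mn n P \<and> madj P = P \<and> mmult n P P = P)"

definition mvn_equiv :: "(nat \<Rightarrow> nat \<Rightarrow> 'a::cstar_algebra) \<Rightarrow> (nat \<Rightarrow> nat \<Rightarrow> 'a) \<Rightarrow> bool" where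
  "mvn_equiv P Q \<longleftrightarrow>
     (\<exists>N V. in_Mn N V \<and> mmult N (madj V) V = P \<and> mmult N V (madj V) = Q)"

definition dsum :: "nat \<Rightarrow> (nat \<Rightarrow> nat \<Rightarrow> 'a::cstar_algebra) \<Rightarrow> (nat \<Rightarrow> nat \<Rightarrow> 'a)
    \<Rightarrow> (nat \<Rightarrow> nat \<Rightarrow> 'a)" where
  "dsum n P Q = (\<lambda>i j. if i < n \<and> j < n then P i j
                        else if n \<le> i \<and> n \<le> j then Q (i - n) (j - n) else 0)"

definition separative :: "'a::cstar_algebra itself \<Rightarrow> bool" where
  "separative _ \<longleftrightarrow>
     (\<forall>n (P::nat \<Rightarrow> nat \<Rightarrow> 'a) Q.
        in_Mn n P \<and> in_Mn n Q \<and> is_proj_Minf P \<and> is_proj_Minf Q \<and>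
        mvn_equiv (dsum n P P) (dsum n P Q) \<and> mvn_equiv (dsum n P Q) (dsum n Q Q)
        \<longrightarrow> mvn_equiv P Q)"

definition gen_ideal :: "'a::cstar_algebra \<Rightarrow> 'a set" where
  "gen_ideal p = closure {\<Sum>i<m. x i * p * y i | (m::nat) x y. True}"

definition unitize :: "'a::cstar_algebra set \<Rightarrow> 'a set" where
  "unitize I = {a + scaleC c 1 | a c. a \<in> I}"

definition unitarily_equiv_in :: "'a::cstar_algebra set \<Rightarrow> 'a \<Rightarrow> 'a \<Rightarrow> bool" where
  "unitarily_equiv_in B p q \<longleftrightarrow>
     (\<exists>u\<in>B. cstar u * u = 1 \<and> u * cstar u = 1 \<and> u * p * cstar u = q)"

definition proj_homotopic :: "'a::cstar_algebra \<Rightarrow> 'a \<Rightarrow> bool" where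
  "proj_homotopic p q \<longleftrightarrow>
     (\<exists>f :: real \<Rightarrow> 'a. continuous_on {0..1} f \<and> (\<forall>t\<in>{0..1}. is_proj (f t))
        \<and> f 0 = p \<and> f 1 = q)"

end

theory Submission
  imports Defs "HOL-Computational_Algebra.Fundamental_Theorem_Algebra"
begin

text \<open>Up to homotopy an idempotent depends only on its range, and also only on its kernel, so the
hard direction becomes a statement about chains of perspective idempotents in an exchange ring, and
no K-theory is needed. Let $q = u p u^*$. Cutting $u$ down by a projection $e \ge p$ in the ideal
moves $q$ into $eAe$, with $e - p \sim e - q$ and $e$ in the algebraic ideal generated by $p$.
The exchange property gives $e = X + Y + Z + W$ (orthogonally) with $q = X + Y$, with $p$
perspective in several steps to $Y + W$, and with $X + Z \sim W + Z$. As $p$ is full in $eAe$,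
the idempotent $Z$ splits into pieces that are subequivalent to both $X$ and $W$ or to $Y$.
Separativity cancels the former and merges the latter into one $z$, subequivalent to $Y$ and
orthogonal to $X, Y, W$, with $X + z \sim W + z$. If $y \le Y$ is a copy of $z$, then rotating
$y + X$ onto $z + W$, and afterwards $z$ back onto $y$, connects $Y + X$ with $Y + W$.\<close>

section \<open>Idempotents in exchange rings with separative cancellation\<close>

text \<open>The obstacle is that a unitary in 1 + I need not be connected to 1 there, so the
  conjugation by u cannot simply be deformed away. Only its algebraic trace is used: two
  equivalences, of p with q and of their complements in one corner. Cancelling Z from X + Z ~ W + Z
  would suffice, but separativity removes only what both sides dominate. Hence fullness of p must be
  an honest finite sum, which makes Z decompose, and pieces dominated only by Y are collected rather
  than cancelled. Idempotents are more flexible than projections: perspective ones are joined by a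
  straight segment, and taking range projections is a continuous retraction that turns the resulting
  path into one of projections. The analysis starts from the C*-identity alone. Real rank zero
  supplies finite spectral sums, square roots come from a contraction, and positivity of
  \<open>cstar x * x\<close> is derived from these. In the easy direction a path is cut into short
  steps, each realised by a unitary in 1 + I close to 1.\<close>

definition idem :: "'a::ring_1 \<Rightarrow> bool" where
  "idem a \<longleftrightarrow> a * a = a"

definition orth :: "'a::ring_1 \<Rightarrow> 'a \<Rightarrow> bool" where
  "orth a b \<longleftrightarrow> a * b = 0 \<and> b * a = 0"

text \<open>Murray-von Neumann equivalence without involution. The factors need not lie in the
  corners of \<open>a\<close> and \<open>b\<close>; \<open>alg_equivE\<close> cuts them
  down.\<close>

definition alg_equiv :: "'a::ring_1 \<Rightarrow> 'a \<Rightarrow> bool" where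
  "alg_equiv a b \<longleftrightarrow> (\<exists>x y. x * y = a \<and> y * x = b)"

text \<open>Between idempotents this is subequivalence, see \<open>lsub_sub_idem\<close>. Stated for
  arbitrary elements it is a factorization through \<open>b\<close>, which makes transitivity
  immediate.\<close>

definition lsub :: "'a::ring_1 \<Rightarrow> 'a \<Rightarrow> bool" where
  "lsub a b \<longleftrightarrow> (\<exists>x y. a = x * b * y)"

text \<open>The two alternatives say that $a$ and $b$ have equal kernels, respectively equal ranges.\<close>

definition persp :: "'a::ring_1 \<Rightarrow> 'a \<Rightarrow> bool" where
  "persp a b \<longleftrightarrow> idem a \<and> idem b \<and>
     (a * b = a \<and> b * a = b \<or> a * b = b \<and> b * a = a)"

text \<open>The elementwise characterization of exchange rings due to Nicholson and
  Goodearl.\<close>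

definition exchange_ring :: "'a::ring_1 itself \<Rightarrow> bool" where
  "exchange_ring _ \<longleftrightarrow>
     (\<forall>a::'a. \<exists>h s t. idem h \<and> h = a * s \<and> 1 - h = (1 - a) * t)"

text \<open>The cancellation form of separativity. All sums are orthogonal sums inside the ring, so
  that the algebraic part needs no matrices.\<close>

definition separative_cancel :: "'a::ring_1 itself \<Rightarrow> bool" where
  "separative_cancel _ \<longleftrightarrow>
     (\<forall>a b c::'a. idem a \<and> idem b \<and> idem c \<and> orth c a \<and> orth c b \<and> lsub c a \<and> lsub c b
        \<and> alg_equiv (a + c) (b + c) \<longrightarrow> alg_equiv a b)"

text \<open>Finite orthogonal decompositions as an inductive predicate, so that
  \<open>merge_pieces\<close> can treat one piece at a time.\<close>

inductive decomp :: "('a::ring_1 \<Rightarrow> bool) \<Rightarrow> 'a \<Rightarrow> bool" for Q where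
  decomp_0: "decomp Q 0"
| decomp_add1: "\<lbrakk>decomp Q z; idem a; Q a; orth z a\<rbrakk> \<Longrightarrow> decomp Q (z + a)"

lemma mult_eq_assoc: "a * b = c \<Longrightarrow> a * (b * z) = c * (z::'a::semigroup_mult)"
  by (metis mult.assoc)

lemma orth_sym: "orth a b \<Longrightarrow> orth b a"
  by (simp add: orth_def)

lemma orth_add: "orth a b \<Longrightarrow> orth a c \<Longrightarrow> orth a (b + c)"
  by (simp add: orth_def algebra_simps)

lemma orth_add_left: "orth a c \<Longrightarrow> orth b c \<Longrightarrow> orth (a + b) c"
  by (simp add: orth_def algebra_simps)

lemma orth_addD:
  assumes "orth x (z + a)" "orth z a" "idem a" "idem z"
  shows "orth x z" "orth x a"
proof -
  have "x * (z + a) * a = 0" "a * ((z + a) * x) = 0" "x * (z + a) * z = 0" "z * ((z + a) * x) = 0"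
    using assms(1) by (simp_all add: orth_def)
  moreover have "(z + a) * a = a" "a * (z + a) = a" "(z + a) * z = z" "z * (z + a) = z"
    using assms by (simp_all add: orth_def idem_def algebra_simps)
  ultimately show "orth x z" "orth x a"
    by (metis mult.assoc orth_def)+
qed

lemma idem_add: "idem a \<Longrightarrow> idem b \<Longrightarrow> orth a b \<Longrightarrow> idem (a + b)"
  by (simp add: idem_def orth_def algebra_simps)

lemma idem_diff: "idem e \<Longrightarrow> idem a \<Longrightarrow> e * a = a \<Longrightarrow> a * e = a \<Longrightarrow> idem (e - a)"
  by (simp add: idem_def algebra_simps)

lemma orth_diff: "idem a \<Longrightarrow> e * a = a \<Longrightarrow> a * e = a \<Longrightarrow> orth (e - a) a"
  by (simp add: idem_def orth_def algebra_simps)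

lemma alg_equivE:
  assumes "alg_equiv a b" "idem a" "idem b"
  obtains x y where "x * y = a" "y * x = b" "a * x = x" "x * b = x" "b * y = y" "y * a = y"
proof -
  obtain x y where xy: "x * y = a" "y * x = b"
    using assms(1) by (auto simp: alg_equiv_def)
  have a: "a * a = a" and b: "b * b = b" using assms by (auto simp: idem_def)
  have xb: "x * b = a * x" and by': "b * y = y * a" using xy by (metis mult.assoc)+
  have 1: "(a * x * b) * (b * y * a) = a"
    by (metis a b by' mult.assoc xb xy(1))
  have 2: "(b * y * a) * (a * x * b) = b"
    by (metis a b by' mult.assoc xb xy(2))
  show ?thesis
    by (rule that[OF 1 2]) (simp_all add: mult.assoc a b mult_eq_assoc[OF a] mult_eq_assoc[OF b])
qed

lemma alg_equiv_refl: "idem a \<Longrightarrow> alg_equiv a a"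
  by (auto simp: alg_equiv_def idem_def)

lemma alg_equiv_sym: "alg_equiv a b \<Longrightarrow> alg_equiv b a"
  by (auto simp: alg_equiv_def)

lemma alg_equiv_trans:
  assumes "alg_equiv a b" "alg_equiv b c" "idem a" "idem b" "idem c"
  shows "alg_equiv a c"
proof -
  obtain x y where 1: "x * y = a" "y * x = b" "a * x = x" "x * b = x" "b * y = y" "y * a = y"
    using assms by (blast elim: alg_equivE)
  obtain x' y' where 2: "x' * y' = b" "y' * x' = c" "b * x' = x'" "x' * c = x'" "c * y' = y'" "y' * b = y'"
    using assms by (blast elim: alg_equivE)
  have "(x * x') * (y' * y) = a" by (metis 1(1,4) 2(1) mult.assoc)
  moreover have "(y' * y) * (x * x') = c" by (metis 1(2) 2(2,3) mult.assoc)
  ultimately show ?thesis by (auto simp: alg_equiv_def)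
qed

lemma alg_equiv_add:
  assumes "alg_equiv a b" "alg_equiv c d" "idem a" "idem b" "idem c" "idem d" "orth a c" "orth b d"
  shows "alg_equiv (a + c) (b + d)"
proof -
  obtain x y where 1: "x * y = a" "y * x = b" "a * x = x" "x * b = x" "b * y = y" "y * a = y"
    using assms by (blast elim: alg_equivE)
  obtain x' y' where 2: "x' * y' = c" "y' * x' = d" "c * x' = x'" "x' * d = x'" "d * y' = y'" "y' * c = y'"
    using assms by (blast elim: alg_equivE)
  have o: "a * c = 0" "c * a = 0" "b * d = 0" "d * b = 0" using assms by (auto simp: orth_def)
  have "x * y' = 0" by (metis 1(4) 2(5) mult.assoc mult_zero_left mult_zero_right o(3))
  moreover have "x' * y = 0" by (metis 1(5) 2(4) mult.assoc mult_zero_left mult_zero_right o(4))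
  moreover have "y * x' = 0" by (metis 1(6) 2(3) mult.assoc mult_zero_left mult_zero_right o(1))
  moreover have "y' * x = 0" by (metis 1(3) 2(6) mult.assoc mult_zero_left mult_zero_right o(2))
  ultimately have "(x + x') * (y + y') = a + c" "(y + y') * (x + x') = b + d"
    using 1 2 by (simp_all add: algebra_simps)
  then show ?thesis by (auto simp: alg_equiv_def)
qed

lemma lsub_trans: "lsub a b \<Longrightarrow> lsub b c \<Longrightarrow> lsub a c"
  unfolding lsub_def by (metis mult.assoc)

lemma alg_equiv_imp_lsub:
  assumes "alg_equiv a b" "idem a"
  shows "lsub a b"
proof -
  obtain x y where "x * y = a" "y * x = b" using assms by (auto simp: alg_equiv_def)
  then have "a = x * b * y" using assms(2) unfolding idem_def by (metis mult.assoc)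
  then show ?thesis by (auto simp: lsub_def)
qed

lemma lsub_summand: "idem a \<Longrightarrow> a * b = a \<Longrightarrow> lsub a b"
  unfolding lsub_def by (rule exI[of _ a], rule exI[of _ a]) (simp add: idem_def)

text \<open>Cutting the factors down to \<open>u = a * x * b\<close> and
  \<open>v = b * y * a\<close> gives \<open>u * v = a\<close>; the reversed product
  \<open>v * u\<close> is then the required copy of \<open>a\<close> below \<open>b\<close>.\<close>

lemma lsub_sub_idem:
  assumes "lsub a b" "idem a" "idem b"
  obtains b' where "idem b'" "b * b' = b'" "b' * b = b'" "alg_equiv a b'"
proof -
  obtain x y where a: "a = x * b * y" using assms(1) by (auto simp: lsub_def)
  have aa: "a * a = a" and bb: "b * b = b" using assms by (auto simp: idem_def)
  define u v where "u = a * x * b" and "v = b * y * a"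
  have uv: "u * v = a" unfolding u_def v_def by (metis a aa bb mult.assoc)
  have *: "a * u = u" "v * a = v" "b * v = v" "u * b = u"
    unfolding u_def v_def by (simp_all add: mult.assoc aa bb aa[THEN mult_eq_assoc] bb[THEN mult_eq_assoc])
  show ?thesis
  proof (rule that[of "v * u"])
    show "idem (v * u)" unfolding idem_def
      by (simp add: mult.assoc mult_eq_assoc[OF uv] *)
    show "b * (v * u) = v * u" "v * u * b = v * u"
      by (simp_all add: mult.assoc * *[THEN mult_eq_assoc])
    show "alg_equiv a (v * u)" using uv by (auto simp: alg_equiv_def)
  qed
qed

text \<open>The copies of \<open>a\<close> and \<open>c\<close> are placed in the complementary
  parts \<open>y1\<close> and \<open>y - y1\<close>, so they remain orthogonal.\<close>

lemma lsub_add: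
  assumes "lsub a y1" "lsub c (y - y1)" "idem a" "idem c" "orth a c" "idem y1" "idem y"
    "y * y1 = y1" "y1 * y = y1"
  shows "lsub (a + c) y"
proof -
  have i: "idem (y - y1)" and o: "orth y1 (y - y1)"
    using assms idem_diff orth_diff orth_sym by blast+
  obtain a' where a': "idem a'" "y1 * a' = a'" "a' * y1 = a'" "alg_equiv a a'"
    using lsub_sub_idem assms by blast
  obtain c' where c': "idem c'" "(y - y1) * c' = c'" "c' * (y - y1) = c'" "alg_equiv c c'"
    using lsub_sub_idem assms i by blast
  have "orth a' c'"
    using a' c' o unfolding orth_def by (metis mult.assoc mult_zero_left mult_zero_right)
  moreover have "(a' + c') * y = a' + c'"
  proof -
    have "a' * y = a'" using a' assms(9) by (metis mult.assoc)
    moreover have "(y - y1) * y = y - y1" using assms(7,9) by (simp add: idem_def algebra_simps)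
    then have "c' * y = c'" using c' by (metis mult.assoc)
    ultimately show ?thesis by (simp add: algebra_simps)
  qed
  ultimately have "lsub (a' + c') y"
    using a' c' idem_add lsub_summand by blast
  moreover have "alg_equiv (a + c) (a' + c')"
    using alg_equiv_add a' c' assms \<open>orth a' c'\<close> by blast
  ultimately show ?thesis
    using alg_equiv_imp_lsub lsub_trans idem_add assms by blast
qed

lemma corner_exchange:
  assumes ex: "exchange_ring TYPE('a::ring_1)"
    and e: "idem (e::'a)" and x: "e * x = x" "x * e = x"
  obtains h s t where "idem h" "e * h = h" "h * e = h" "h = x * s" "e - h = (e - x) * t"
    "e * s = s" "s * e = s" "e * t = t" "t * e = t"
proof -
  \<comment> \<open>Padding \<open>x\<close> by \<open>1 - e\<close> makes the complement equal to
    \<open>e - x\<close>, so \<open>1 - h0\<close> already lies in \<open>e\<close> times the ring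
    and only its right side has to be cut down.\<close>
  obtain h0 s t where h0: "idem h0" "h0 = (x + (1 - e)) * s" "1 - h0 = (1 - (x + (1 - e))) * t"
    using ex unfolding exchange_ring_def by blast
  have ee: "e * e = e" using e by (simp add: idem_def)
  define g where "g = 1 - h0"
  have g: "g = (e - x) * t" using h0 by (simp add: g_def)
  have gg: "g * g = g" using h0(1) by (simp add: g_def idem_def algebra_simps)
  have eg: "e * g = g" unfolding g by (simp add: algebra_simps ee x ee[THEN mult_eq_assoc] x[THEN mult_eq_assoc])
  have ge: "idem (g * e)" using gg eg unfolding idem_def by (metis mult.assoc)
  have ex': "(e - x) * e = e - x" using ee x by (simp add: algebra_simps)
  have 1: "g * e = (e - x) * (e * t * e)" unfolding g using ex' by (metis mult.assoc)
  have "e * h0 = e + h0 - 1" using eg unfolding g_def by (simp add: algebra_simps)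
  then have "e * h0 * e = (e + h0 - 1) * e" by simp
  then have "e - g * e = e * h0 * e" using ee unfolding g_def by (simp add: algebra_simps)
  also have "\<dots> = x * s * e"
    unfolding h0(2) by (simp add: algebra_simps ee x ee[THEN mult_eq_assoc] x[THEN mult_eq_assoc])
  also have "\<dots> = x * (e * s * e)" using x by (metis mult.assoc)
  finally have 2: "e - g * e = x * (e * s * e)" .
  show ?thesis
  proof (rule that[of "e - g * e" "e * s * e" "e * t * e"])
    show "idem (e - g * e)"
      using idem_diff[OF e ge] eg ee by (metis mult.assoc)
  qed (use 1 2 in \<open>simp_all add: algebra_simps ee eg ee[THEN mult_eq_assoc] eg[THEN mult_eq_assoc]\<close>)
qed

text \<open>Exchange in the corner of \<open>z\<close>, applied to the compression of
  \<open>u * a * v\<close>: one part factors through \<open>a\<close>, the other is a multiple of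
  what remains.\<close>

lemma exchange_split:
  assumes ex: "exchange_ring TYPE('a::ring_1)"
    and z: "idem (z::'a)" and "z = u * a * v + w"
  obtains h t where "idem h" "z * h = h" "h * z = h" "lsub h a" "z - h = (z * w * z) * t"
    "idem (z - h)" "orth (z - h) h"
proof -
  have zz: "z * z = z" using z by (simp add: idem_def)
  define x where "x = z * (u * a * v) * z"
  have x: "z * x = x" "x * z = x" unfolding x_def using zz by (metis mult.assoc)+
  have "z - x = z * w * z"
  proof -
    have "z * (z * z) = z" using zz by simp
    then have "z = z * (u * a * v + w) * z" using assms(3) by (metis mult.assoc)
    then show ?thesis unfolding x_def by (simp add: algebra_simps)
  qed
  then obtain h s t where h: "idem h" "z * h = h" "h * z = h" "h = x * s" "z - h = (z * w * z) * t"
    using corner_exchange[OF ex z x] by metis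
  have "h = (z * u) * a * (v * z * s)" using h(4) unfolding x_def by (metis mult.assoc)
  then have "lsub h a" by (auto simp: lsub_def)
  moreover have "idem (z - h)" "orth (z - h) h" using idem_diff orth_diff h z by blast+
  ultimately show ?thesis using that h by blast
qed

text \<open>A Riesz refinement. Since \<open>a\<close> and \<open>b\<close> need be neither
  idempotent nor orthogonal, it applies to any upper bound written as a sum.\<close>

lemma exchange_split2:
  assumes ex: "exchange_ring TYPE('a::ring_1)"
    and z: "idem (z::'a)" and "lsub z (a + b)"
  obtains h k where "z = h + k" "idem h" "idem k" "orth h k" "lsub h a" "lsub k b" "lsub h z" "lsub k z"
    "z * h = h" "h * z = h"
proof -
  obtain u v where "z = u * (a + b) * v" using assms(3) by (auto simp: lsub_def)
  then have "z = u * a * v + u * b * v" by (simp add: algebra_simps)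
  then obtain h t where h: "idem h" "z * h = h" "h * z = h" "lsub h a"
    "z - h = (z * (u * b * v) * z) * t" "idem (z - h)" "orth (z - h) h"
    using exchange_split[OF ex z] by blast
  have "z - h = (z * u) * b * (v * z * t)" using h(5) by (metis mult.assoc)
  then have "lsub (z - h) b" by (auto simp: lsub_def)
  moreover have "lsub h z" "lsub (z - h) z"
    using h z by (auto intro!: lsub_summand simp: algebra_simps idem_def)
  ultimately show ?thesis
    using h(1-4,6) orth_sym[OF h(7)] by (intro that[of h "z - h"]) auto
qed

lemma decomp_idem: "decomp Q z \<Longrightarrow> idem z"
  by (induction rule: decomp.induct) (auto simp: idem_def orth_def algebra_simps)

lemma decomp_add: "decomp Q w \<Longrightarrow> decomp Q z \<Longrightarrow> orth z w \<Longrightarrow> decomp Q (z + w)"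
proof (induction rule: decomp.induct)
  case (decomp_add1 w a)
  have o: "orth z w" "orth z a"
    using orth_addD[of z w a] decomp_add1 decomp_idem by blast+
  have "decomp Q (z + w + a)"
    by (rule decomp.decomp_add1) (use decomp_add1 o in \<open>auto intro: orth_add_left\<close>)
  then show ?case by (simp add: add.assoc)
qed simp

lemma decomp_single: "idem a \<Longrightarrow> Q a \<Longrightarrow> decomp Q a"
  using decomp_add1[OF decomp_0, of a Q] by (simp add: orth_def)

lemma decomp_refine:
  assumes "decomp Q z" "\<And>a. idem a \<Longrightarrow> Q a \<Longrightarrow> decomp Q' a"
  shows "decomp Q' z"
  using assms by (induction rule: decomp.induct) (auto intro: decomp_0 decomp_add)

text \<open>Induction on the number of summands: exchange splits off a piece below \<open>p\<close>,
  and what is left is a shorter sum.\<close>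

lemma decomp_ideal:
  assumes ex: "exchange_ring TYPE('a::ring_1)"
  shows "idem (z::'a) \<Longrightarrow> z = (\<Sum>i<(n::nat). x i * p * y i) \<Longrightarrow> decomp (\<lambda>a. lsub a p) z"
proof (induction n arbitrary: x y z)
  case 0
  then show ?case by (simp add: decomp_0)
next
  case (Suc n)
  have "z = x n * p * y n + (\<Sum>i<n. x i * p * y i)"
    using Suc.prems by (simp add: add.commute)
  then obtain h t where h: "idem h" "z * h = h" "h * z = h" "lsub h p"
    "z - h = (z * (\<Sum>i<n. x i * p * y i) * z) * t" "idem (z - h)" "orth (z - h) h"
    using exchange_split[OF ex Suc.prems(1)] by blast
  have "z - h = (\<Sum>i<n. (z * x i) * p * (y i * z * t))"
    unfolding h(5) by (simp add: sum_distrib_left sum_distrib_right mult.assoc)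
  then have "decomp (\<lambda>a. lsub a p) (z - h)" by (rule Suc.IH[OF h(6)])
  from decomp_add1[OF this h(1,4,7)] show ?case by simp
qed

text \<open>Induction on the pieces of \<open>Z\<close>. The accumulator \<open>S\<close> holds what
  has been kept: it is below \<open>Y\<close> and sits on both sides of the equivalence. A piece
  below both \<open>X\<close> and \<open>W\<close> is cancelled; a piece below \<open>Y\<close> is
  partly cancelled against \<open>S\<close> and partly added to it.\<close>

lemma merge_pieces:
  assumes ex: "exchange_ring TYPE('a::ring_1)" and sc: "separative_cancel TYPE('a)"
    and X: "idem (X::'a)" and W: "idem W" and Y: "idem Y"
    and "decomp (\<lambda>a. lsub a X \<and> lsub a W \<or> lsub a Y) Z"
    and "idem S" "lsub S Y" "orth S X" "orth S W" "orth S Y" "orth S Z"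
    and "orth X Z" "orth W Z" "orth Y Z" "alg_equiv (X + S + Z) (W + S + Z)"
  shows "\<exists>z. idem z \<and> orth z X \<and> orth z W \<and> orth z Y \<and> lsub z Y \<and> alg_equiv (X + z) (W + z)"
  using assms(6-)
proof (induction arbitrary: S rule: decomp.induct)
  case decomp_0
  then show ?case by auto
next
  case (decomp_add1 Z a)
  note iZ = decomp_idem[OF decomp_add1.hyps(1)]
  have oZ: "orth S Z" "orth X Z" "orth W Z" "orth Y Z"
    and oa: "orth S a" "orth X a" "orth W a" "orth Y a"
    using orth_addD[of _ Z a] decomp_add1.hyps decomp_add1.prems iZ by blast+
  show ?case
  proof (cases "lsub a Y")
    case False
    then have a: "lsub a X" "lsub a W" using decomp_add1.hyps by auto
    have *: "lsub X (X + S + Z)" "lsub W (W + S + Z)"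
      using X W decomp_add1.prems oZ
      by (auto intro!: lsub_summand simp: orth_def algebra_simps idem_def)
    have "alg_equiv (X + S + Z) (W + S + Z)"
    proof (rule sc[unfolded separative_cancel_def, rule_format], intro conjI)
      show "idem (X + S + Z)" "idem (W + S + Z)"
        using X W iZ decomp_add1.prems oZ by (auto intro!: idem_add orth_add_left intro: orth_sym)
      show "orth a (X + S + Z)" "orth a (W + S + Z)"
        using oa decomp_add1.hyps by (auto intro!: orth_add intro: orth_sym)
      show "lsub a (X + S + Z)" "lsub a (W + S + Z)" using a * lsub_trans by blast+
      show "alg_equiv (X + S + Z + a) (W + S + Z + a)"
        using decomp_add1.prems by (simp add: add.assoc)
    qed (rule decomp_add1)
    then show ?thesis using decomp_add1.IH[of S] decomp_add1.prems oZ by blast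
  next
    case True
    \<comment> \<open>\<open>y1\<close> is the room in \<open>Y\<close> already taken by
      \<open>S\<close>. The part \<open>b\<close> of \<open>a\<close> below \<open>y1\<close> is
      dominated by \<open>S\<close> and can be cancelled; the part \<open>c\<close> fits into the
      free room \<open>Y - y1\<close>, so \<open>S + c\<close> is still below
      \<open>Y\<close>.\<close>
    obtain y1 where y1: "idem y1" "Y * y1 = y1" "y1 * Y = y1" "alg_equiv S y1"
      using lsub_sub_idem[of S Y] decomp_add1.prems Y by blast
    have "lsub a (y1 + (Y - y1))" using True by simp
    then obtain b c where bc: "a = b + c" "idem b" "idem c" "orth b c" "lsub b y1" "lsub c (Y - y1)"
      using exchange_split2[OF ex decomp_add1.hyps(2)] by metis
    have ob: "orth S b" "orth X b" "orth W b" "orth Y b" "orth Z b"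
      and oc: "orth S c" "orth X c" "orth W c" "orth Y c" "orth Z c"
      using orth_addD[of _ b c] oa decomp_add1.hyps bc by blast+
    have bS: "lsub b S"
      using bc(5) y1 alg_equiv_imp_lsub alg_equiv_sym lsub_trans by blast
    have Sc: "lsub (S + c) Y"
      using lsub_add[of S y1 c Y] bc y1 oc Y decomp_add1.prems alg_equiv_imp_lsub by blast
    have *: "lsub S (X + (S + c) + Z)" "lsub S (W + (S + c) + Z)"
      using decomp_add1.prems oZ oc
      by (auto intro!: lsub_summand simp: orth_def algebra_simps idem_def)
    have iSc: "idem (S + c)" using idem_add bc oc decomp_add1.prems by blast
    have oSc: "orth (S + c) X" "orth (S + c) W" "orth (S + c) Y" "orth (S + c) Z"
      using oc oZ decomp_add1.prems by (auto intro!: orth_add_left intro: orth_sym)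
    have "alg_equiv (X + (S + c) + Z) (W + (S + c) + Z)"
    proof (rule sc[unfolded separative_cancel_def, rule_format], intro conjI)
      show "idem (X + (S + c) + Z)" "idem (W + (S + c) + Z)"
        using X W iZ iSc oZ oSc by (auto intro!: idem_add orth_add_left intro: orth_sym)
      show "orth b (X + (S + c) + Z)" "orth b (W + (S + c) + Z)"
        using ob bc by (auto intro!: orth_add intro: orth_sym)
      show "lsub b (X + (S + c) + Z)" "lsub b (W + (S + c) + Z)" using bS * lsub_trans by blast+
      show "alg_equiv (X + (S + c) + Z + b) (W + (S + c) + Z + b)"
        using decomp_add1.prems(10) unfolding bc(1) by (simp add: ac_simps)
    qed (rule bc)
    then show ?thesis
      using decomp_add1.IH[of "S + c"] iSc Sc oSc oZ by blast
  qed
qed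

lemma persp_add:
  assumes "persp a b" "idem c" "orth a c" "orth b c"
  shows "persp (a + c) (b + c)"
  using assms unfolding persp_def by (auto simp: idem_def orth_def algebra_simps)

lemma persp_compl:
  assumes "persp a b" "idem e" "e * a = a" "a * e = a" "e * b = b" "b * e = b"
  shows "persp (e - a) (e - b)"
  using assms unfolding persp_def by (auto simp: idem_def algebra_simps)

lemma persp_imp_alg_equiv: "persp a b \<Longrightarrow> alg_equiv a b"
  unfolding persp_def alg_equiv_def by metis

lemma persp_idem: "persp a b \<Longrightarrow> idem a" "persp a b \<Longrightarrow> idem b"
  unfolding persp_def by auto

text \<open>The two middle idempotents have the graph of an isomorphism between the summands as range.\<close>

lemma orth_equiv_persp:
  assumes "alg_equiv a b" "idem a" "idem b" "orth a b" "idem c" "orth a c" "orth b c"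
  shows "persp\<^sup>*\<^sup>* (a + c) (b + c)"
proof -
  obtain x y where xy: "x * y = a" "y * x = b" "a * x = x" "x * b = x" "b * y = y" "y * a = y"
    using assms by (blast elim: alg_equivE)
  have aa: "a * a = a" "b * b = b" and ab: "a * b = 0" "b * a = 0"
    and ac: "a * c = 0" "c * a = 0" "b * c = 0" "c * b = 0"
    using assms by (auto simp: orth_def idem_def)
  have z: "x * a = 0" "y * b = 0" "b * x = 0" "a * y = 0" "x * x = 0" "y * y = 0"
    "x * c = 0" "c * x = 0" "y * c = 0" "c * y = 0"
    by (metis xy ab ac mult.assoc mult_zero_left mult_zero_right)+
  have "persp a (a + y)" "persp (a + y) (b + x)" "persp (b + x) b"
    unfolding persp_def idem_def using xy aa ab z by (simp_all add: algebra_simps)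
  moreover have "orth (a + y) c" "orth (b + x) c"
    using ac z by (simp_all add: orth_def algebra_simps)
  ultimately have "persp (a + c) (a + y + c)" "persp (a + y + c) (b + x + c)" "persp (b + x + c) (b + c)"
    using persp_add assms by blast+
  then show ?thesis
    by (meson converse_rtranclp_into_rtranclp r_into_rtranclp)
qed

theorem persp_of_equiv:
  assumes ex: "exchange_ring TYPE('a::ring_1)" and sc: "separative_cancel TYPE('a)"
    and e: "idem (e::'a)" and p: "idem p" "e * p = p" "p * e = p"
    and q: "idem q" "e * q = q" "q * e = q"
    and pq: "alg_equiv p q" and epq: "alg_equiv (e - p) (e - q)"
    and full: "e = (\<Sum>i<(n::nat). xs i * p * ys i)"
  shows "persp\<^sup>*\<^sup>* p q"
proof -
  have ee: "e * e = e" and qq: "q * q = q" and pp: "p * p = p" using e q p by (auto simp: idem_def)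
  define r where "r = e - p"
  have r: "idem r" "e * r = r" "r * e = r" unfolding r_def
    using e p idem_diff[of e p] by (auto simp: algebra_simps idem_def)
  have rr: "r * r = r" using r by (simp add: idem_def)
  define q' where "q' = e - q"
  have q': "idem q'" "e * q' = q'" "q' * e = q'" unfolding q'_def
    using e q idem_diff[of e q] by (auto simp: algebra_simps idem_def)
  have qq': "q' * q' = q'" "q * q' = 0" "q' * q = 0"
    using q' q unfolding q'_def idem_def by (simp_all add: algebra_simps)
  have b: "r * (r * q * r) = r * q * r" "r * q * r * r = r * q * r" by (simp_all add: mult.assoc rr rr[THEN mult_eq_assoc])
  \<comment> \<open>Exchange in the corner of \<open>r\<close> splits \<open>r\<close> into
    \<open>h\<close>, which factors through \<open>q\<close>, and \<open>k\<close>, which factors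
    through \<open>q'\<close>.\<close>
  obtain h s t where h: "idem h" "r * h = h" "h * r = h" "h = r * q * r * s" "r - h = (r - r * q * r) * t"
    "r * s = s" "s * r = s" "r * t = t" "t * r = t"
    using corner_exchange[OF ex r(1) b] by metis
  define k where "k = r - h"
  have hh: "h * h = h" using h by (simp add: idem_def)
  have k: "k * k = k" "r * k = k" "k * r = k" "h * k = 0" "k * h = 0"
    unfolding k_def using hh h rr by (simp_all add: algebra_simps)
  have hs: "h = r * (q * s)" using h(4,6) by (metis mult.assoc)
  have "r - r * q * r = r * q' * r" unfolding q'_def using r rr by (simp add: algebra_simps)
  then have kt: "k = r * (q' * t)" using h(5,8) unfolding k_def by (metis mult.assoc)
  have hq: "h * (q * s) = h" using hs h(3) hh by (metis mult.assoc)
  have kq: "k * (q' * t) = k" using kt k by (metis mult.assoc)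
  \<comment> \<open>\<open>g\<close> is the copy of \<open>h\<close> below \<open>q\<close>:
    \<open>h * q\<close> and \<open>q * s * h\<close> compose to \<open>h\<close> in one order and
    to \<open>g\<close> in the other. Likewise \<open>g'\<close> is the copy of \<open>k\<close>
    below \<open>q'\<close>.\<close>
  define g g' where "g = q * s * h * q" and "g' = q' * t * k * q'"
  note S = mult.assoc hh[THEN mult_eq_assoc] k[THEN mult_eq_assoc] qq qq[THEN mult_eq_assoc]
    qq' qq'[THEN mult_eq_assoc] hh k hq kq mult_eq_assoc[OF hq, simplified mult.assoc]
     mult_eq_assoc[OF kq, simplified mult.assoc]
  have g: "g * g = g" "q * g = g" "g * q = g" unfolding g_def by (simp_all add: S)
  have g': "g' * g' = g'" "q' * g' = g'" "g' * q' = g'" unfolding g'_def by (simp_all add: S)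
  have gg': "g * g' = 0" "g' * g = 0" "q * g' = 0" "g' * q = 0" "q' * g = 0" "g * q' = 0"
    unfolding g_def g'_def by (simp_all add: S)
  \<comment> \<open>\<open>m\<close> has the kernel of \<open>r\<close> and the range of
    \<open>g + g'\<close>. Two perspectivities thus turn \<open>r\<close> into an idempotent
    commuting with \<open>q\<close>.\<close>
  define m where "m = q * s * h + q' * t * k"
  have rm: "r * m = r"
  proof -
    have "r * m = (r * (q * s)) * h + (r * (q' * t)) * k" unfolding m_def by (simp add: algebra_simps)
    also have "\<dots> = h + k" using hs kt hh k by simp
    finally show ?thesis by (simp add: k_def)
  qed
  have mr: "m * r = m" unfolding m_def using h k by (simp add: algebra_simps)
  have mm: "m * m = m" using rm mr by (metis mult.assoc)
  have Gm: "(g + g') * m = m" unfolding g_def g'_def m_def by (simp add: algebra_simps S)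
  have mG: "m * (g + g') = g + g'"
  proof -
    have "m * (g + g') = m * r * (g + g')" using mr by simp
    also have "r * (g + g') = h * q + k * q'"
    proof -
      have "r * (g + g') = (r * (q * s)) * (h * q) + (r * (q' * t)) * (k * q')"
        unfolding g_def g'_def by (simp add: algebra_simps)
      then show ?thesis using hs kt hh k by (simp add: mult.assoc[symmetric])
    qed
    then have "m * r * (g + g') = m * (h * q + k * q')" by (simp add: mult.assoc)
    also have "\<dots> = g + g'" unfolding m_def g_def g'_def by (simp add: algebra_simps S)
    finally show ?thesis .
  qed
  have iG: "idem (g + g')" using g g' gg' by (simp add: idem_def algebra_simps)
  have P1: "persp r m" and P2: "persp m (g + g')"
    unfolding persp_def using rm mr Gm mG iG mm r by (auto simp: idem_def)
  have em: "e * m = m" "m * e = m"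
    using mr r q q' unfolding m_def by (metis distrib_left mult.assoc, metis mult.assoc)
  define X Y Z W where "X = g" and "Y = q - g" and "Z = g'" and "W = q' - g'"
  have iX: "idem X" and iZ: "idem Z" using g g' by (auto simp: X_def Z_def idem_def)
  have iY: "idem Y" unfolding Y_def using idem_diff[of q g] q g by (auto simp: idem_def)
  have iW: "idem W" unfolding W_def using idem_diff[of q' g'] q' g' by (auto simp: idem_def)
  have o: "orth X Y" "orth X Z" "orth X W" "orth Y Z" "orth Y W" "orth Z W"
    using g g' gg' qq qq' unfolding orth_def X_def Y_def Z_def W_def by (simp_all add: algebra_simps)
  have sum: "X + Y = q" "Z + W = q'" by (simp_all add: X_def Y_def Z_def W_def)
  have YW: "e - (g + g') = Y + W" unfolding Y_def W_def q'_def by simp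
  have eg: "e * (g + g') = g + g'" "(g + g') * e = g + g'"
    using g g' q q' by (metis distrib_left mult.assoc, metis distrib_right mult.assoc)
  \<comment> \<open>Complements in \<open>e\<close> exchange equal kernels and equal ranges, so the
    chain starting at \<open>r\<close> becomes one starting at \<open>p\<close>.\<close>
  have "persp (e - r) (e - m)" "persp (e - m) (e - (g + g'))"
    using persp_compl[OF P1] persp_compl[OF P2] e r em eg by blast+
  then have P3: "persp p (e - m)" "persp (e - m) (Y + W)"
    unfolding YW by (simp_all add: r_def)
  then have p_YW: "persp\<^sup>*\<^sup>* p (Y + W)" by auto
  have iYW: "idem (Y + W)" using idem_add iY iW o by blast
  have eq1: "alg_equiv p (Y + W)"
    using P3 persp_imp_alg_equiv persp_idem alg_equiv_trans by blast
  \<comment> \<open>\<open>X + Z\<close> is equivalent to \<open>r = e - p\<close>, hence by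
    \<open>epq\<close> to \<open>e - q = Z + W\<close>.\<close>
  have "alg_equiv r (X + Z)"
    using alg_equiv_trans[OF P1[THEN persp_imp_alg_equiv] P2[THEN persp_imp_alg_equiv]]
      P1[THEN persp_idem(1)] P2[THEN persp_idem(1)] P2[THEN persp_idem(2)]
    unfolding X_def Z_def by blast
  then have "alg_equiv (X + Z) r" by (rule alg_equiv_sym)
  then have XZ: "alg_equiv (X + Z) (W + Z)"
    using epq alg_equiv_trans[OF _ _ _ r(1) q'(1)] idem_add[OF iX iZ o(2)] sum(2)
    unfolding r_def[symmetric] q'_def[symmetric] by (simp add: add.commute)
  have pXY: "lsub p (X + Y)" and pWY: "lsub p (W + Y)"
    using pq eq1 p(1) alg_equiv_imp_lsub sum by (auto simp: add.commute)
  have "e * Z = Z" "Z * e = Z" using g' q' unfolding Z_def by (metis mult.assoc)+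
  then have "Z = Z * e * Z" using iZ by (simp add: idem_def)
  also have "\<dots> = (\<Sum>i<n. (Z * xs i) * p * (ys i * Z))"
    unfolding full by (simp add: sum_distrib_left sum_distrib_right mult.assoc)
  finally have "decomp (\<lambda>a. lsub a p) Z" by (rule decomp_ideal[OF ex iZ])
  \<comment> \<open>A piece below \<open>p\<close> is refined twice: along \<open>X + Y\<close>, as
    \<open>p\<close> is equivalent to \<open>q\<close>, and its part below \<open>X\<close> once
    more along \<open>W + Y\<close>, as \<open>p\<close> is equivalent to
    \<open>Y + W\<close>.\<close>
  then have dZ: "decomp (\<lambda>a. lsub a X \<and> lsub a W \<or> lsub a Y) Z"
  proof (rule decomp_refine)
    fix a assume a: "idem a" "lsub a p"
    then have "lsub a (X + Y)" using pXY lsub_trans by blast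
    then obtain b c where bc: "a = b + c" "idem b" "idem c" "orth b c" "lsub b X" "lsub c Y" "lsub b a"
      using exchange_split2[OF ex a(1)] by metis
    have "lsub b (W + Y)" using bc a pWY lsub_trans by blast
    then obtain b' c' where bc': "b = b' + c'" "idem b'" "idem c'" "orth b' c'" "lsub b' W" "lsub c' Y" "lsub b' b"
      using exchange_split2[OF ex bc(2)] by metis
    have "lsub b' X" using bc' bc lsub_trans by blast
    then have "decomp (\<lambda>a. lsub a X \<and> lsub a W \<or> lsub a Y) b"
      unfolding bc' using bc' by (intro decomp_add decomp_single) auto
    then show "decomp (\<lambda>a. lsub a X \<and> lsub a W \<or> lsub a Y) a"
      unfolding bc(1) using bc decomp_single[of c] by (intro decomp_add) auto
  qed
  obtain z where z: "idem z" "orth z X" "orth z W" "orth z Y" "lsub z Y" "alg_equiv (X + z) (W + z)"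
  proof -
    \<comment> \<open>The accumulator of \<open>merge_pieces\<close> starts empty.\<close>
    have "idem (0::'a)" "lsub 0 Y" "orth 0 X" "orth 0 W" "orth 0 Y" "orth 0 Z"
      by (auto simp: idem_def orth_def lsub_def intro: exI[of _ 0])
    moreover have "alg_equiv (X + 0 + Z) (W + 0 + Z)" using XZ by simp
    ultimately show ?thesis
      using that merge_pieces[OF ex sc iX iW iY dZ, of 0] o orth_sym by blast
  qed
  obtain y where y: "idem y" "Y * y = y" "y * Y = y" "alg_equiv z y"
    using lsub_sub_idem[OF z(5,1) iY] .
  have iYy: "idem (Y - y)" and oYy: "orth (Y - y) y" using idem_diff orth_diff iY y by blast+
  have orth_sub: "orth y c" if "orth c Y" for c
    using that y unfolding orth_def by (metis mult.assoc mult_zero_left mult_zero_right)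
  have orth_sub': "orth (Y - y) c" if "orth c Y" for c
    using that orth_sub[OF that] unfolding orth_def by (simp add: algebra_simps)
  have oy: "orth y X" "orth y W" "orth y z" "orth (Y - y) X" "orth (Y - y) W" "orth (Y - y) z"
    using orth_sub orth_sub' o z orth_sym by blast+
  have "alg_equiv (y + X) (z + X)"
    using alg_equiv_add y z oy iX alg_equiv_sym alg_equiv_refl by blast
  moreover have "alg_equiv (z + X) (z + W)" using z(6) by (simp add: add.commute)
  moreover have i: "idem (y + X)" "idem (z + X)" "idem (z + W)"
    using idem_add y z oy iX iW by blast+
  ultimately have E: "alg_equiv (y + X) (z + W)" using alg_equiv_trans by blast
  have "persp\<^sup>*\<^sup>* (y + X + (Y - y)) (z + W + (Y - y))"
  proof (rule orth_equiv_persp[OF E i(1,3) _ iYy])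
    show "orth (y + X) (z + W)" "orth (y + X) (Y - y)" "orth (z + W) (Y - y)"
      using oy z o oYy by (auto intro!: orth_add orth_add_left intro: orth_sym)
  qed
  moreover have "persp\<^sup>*\<^sup>* (z + (W + (Y - y))) (y + (W + (Y - y)))"
  proof (rule orth_equiv_persp[OF y(4) z(1) y(1)])
    show "orth z y" "idem (W + (Y - y))" "orth z (W + (Y - y))" "orth y (W + (Y - y))"
      using oy z o oYy iW iYy by (auto intro!: orth_add idem_add intro: orth_sym)
  qed
  ultimately have "persp\<^sup>*\<^sup>* q (Y + W)"
    using sum(1) by (auto simp: algebra_simps)
  moreover have "symp (persp :: 'a \<Rightarrow> _)" unfolding symp_def persp_def by auto
  then have "symp (persp\<^sup>*\<^sup>* :: 'a \<Rightarrow> _)" by (rule symp_rtranclp)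
  ultimately have "persp\<^sup>*\<^sup>* (Y + W) q" by (auto dest: sympD)
  with p_YW show ?thesis by simp
qed

section \<open>Spectral decomposition of self-adjoint elements with finite spectrum\<close>

lemma cstar_0 [simp]: "cstar (0::'a::cstar_algebra) = 0"
  by (metis add_cancel_right_left cstar_add)

lemma cstar_1 [simp]: "cstar (1::'a::cstar_algebra) = 1"
  by (metis cstar_cstar cstar_mult mult.left_neutral mult_1_right)

lemma scaleC_0_left [simp]: "scaleC 0 (x::'a::cstar_algebra) = 0"
  by (metis norm_eq_zero norm_scaleC norm_zero mult_zero_left)

lemma scaleC_0_right [simp]: "scaleC c (0::'a::cstar_algebra) = 0"
  by (metis mult_scaleC_left mult_zero_right)

lemma scaleC_minus_left: "scaleC (- c) (x::'a::cstar_algebra) = - scaleC c x"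
  by (metis add.right_inverse add_eq_0_iff scaleC_0_left scaleC_add_left)

lemma scaleC_minus_right: "scaleC c (- x::'a::cstar_algebra) = - scaleC c x"
  by (metis add.right_inverse add_eq_0_iff scaleC_0_right scaleC_add_right)

lemma scaleC_diff_left: "scaleC (c - d) (x::'a::cstar_algebra) = scaleC c x - scaleC d x"
  by (metis diff_conv_add_uminus scaleC_add_left scaleC_minus_left)

lemma scaleC_diff_right: "scaleC c (x - y::'a::cstar_algebra) = scaleC c x - scaleC c y"
  by (metis diff_conv_add_uminus scaleC_add_right scaleC_minus_right)

lemma cstar_minus: "cstar (- x::'a::cstar_algebra) = - cstar x"
  by (metis add.right_inverse add_eq_0_iff cstar_0 cstar_add)

lemma cstar_diff: "cstar (x - y::'a::cstar_algebra) = cstar x - cstar y"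
  by (metis cstar_add cstar_minus diff_conv_add_uminus)

lemma cstar_scaleR: "cstar (r *\<^sub>R x::'a::cstar_algebra) = r *\<^sub>R cstar x"
  by (simp add: scaleR_scaleC cstar_scaleC)

lemma norm_cstar [simp]: "norm (cstar x::'a::cstar_algebra) = norm x"
proof -
  have *: "norm y \<le> norm (cstar y)" for y :: 'a
  proof (cases "y = 0")
    case False
    have "norm y * norm y \<le> norm (cstar y) * norm y"
      using norm_mult_ineq[of "cstar y" y] cstar_identity[of y] by (simp add: power2_eq_square)
    with False show ?thesis by simp
  qed simp
  from *[of x] *[of "cstar x"] show ?thesis by (simp add: cstar_cstar)
qed

lemma bounded_linear_cstar: "bounded_linear (cstar :: 'a::cstar_algebra \<Rightarrow> 'a)"
  by (rule bounded_linear_intro[of _ 1]) (simp_all add: cstar_add cstar_scaleR)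

lemmas continuous_on_cstar [continuous_intros] = bounded_linear.continuous_on[OF bounded_linear_cstar]

lemma cstar_sum: "cstar (\<Sum>i\<in>I. f i :: 'a::cstar_algebra) = (\<Sum>i\<in>I. cstar (f i))"
  by (rule linear_sum[OF bounded_linear.linear[OF bounded_linear_cstar]])

lemma closed_self_adjoint: "closed {a::'a::cstar_algebra. self_adjoint a}"
  unfolding self_adjoint_def
  by (intro closed_Collect_eq continuous_intros)

lemma self_adjoint_1 [simp]: "self_adjoint (1::'a::cstar_algebra)"
  by (simp add: self_adjoint_def)

lemma self_adjoint_0 [simp]: "self_adjoint (0::'a::cstar_algebra)"
  by (simp add: self_adjoint_def)

lemma self_adjoint_add: "self_adjoint a \<Longrightarrow> self_adjoint b \<Longrightarrow> self_adjoint (a + b)"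
  by (simp add: self_adjoint_def cstar_add)

lemma self_adjoint_diff: "self_adjoint a \<Longrightarrow> self_adjoint b \<Longrightarrow> self_adjoint (a - b)"
  by (simp add: self_adjoint_def cstar_diff)

lemma self_adjoint_scaleR: "self_adjoint a \<Longrightarrow> self_adjoint (r *\<^sub>R a)"
  by (simp add: self_adjoint_def cstar_scaleR)

lemma self_adjoint_power: "self_adjoint a \<Longrightarrow> self_adjoint (a ^ n)"
  by (induction n) (simp_all add: self_adjoint_def cstar_mult power_commutes)

lemma self_adjoint_cstar_mult: "self_adjoint (cstar x * x)" "self_adjoint (x * cstar x)"
  by (simp_all add: self_adjoint_def cstar_mult cstar_cstar)

lemma norm_self_adjoint_square: "self_adjoint a \<Longrightarrow> norm (a * a) = (norm a)\<^sup>2"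
  using cstar_identity[of a] by (simp add: self_adjoint_def)

lemma norm_self_adjoint_power:
  assumes "self_adjoint (a::'a::cstar_algebra)"
  shows "norm (a ^ (2 ^ k)) = norm a ^ (2 ^ k)"
proof (induction k)
  case (Suc k)
  have "a ^ (2 ^ Suc k) = a ^ (2 ^ k) * a ^ (2 ^ k)"
    by (simp flip: power_add add: mult_2)
  then have "norm (a ^ (2 ^ Suc k)) = (norm (a ^ (2 ^ k)))\<^sup>2"
    using norm_self_adjoint_square[OF self_adjoint_power[OF assms]] by simp
  then show ?case using Suc by (simp flip: power_mult add: mult.commute)
qed simp

lemma norm_proj_le: "is_proj p \<Longrightarrow> norm p \<le> 1"
proof -
  assume "is_proj p"
  then have "norm p = norm p * norm p"
    using cstar_identity[of p] by (simp add: is_proj_def power2_eq_square)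
  then show ?thesis by (metis mult_cancel_right2 norm_zero order_refl zero_le_one)
qed

lemma norm_proj: "is_proj p \<Longrightarrow> p \<noteq> 0 \<Longrightarrow> norm p = 1"
  using cstar_identity[of p] by (simp add: is_proj_def power2_eq_square)

section \<open>Inverses, Neumann series and real spectra\<close>

definition is_inv :: "'a::monoid_mult \<Rightarrow> 'a \<Rightarrow> bool" where
  "is_inv a b \<longleftrightarrow> a * b = 1 \<and> b * a = 1"

lemma is_inv_mult: "is_inv a b \<Longrightarrow> is_inv c d \<Longrightarrow> is_inv (a * c) (d * b)"
  unfolding is_inv_def by (metis mult.assoc mult_1_right)

lemma is_inv_unique: "is_inv a b \<Longrightarrow> is_inv a c \<Longrightarrow> b = c"
  unfolding is_inv_def by (metis mult.assoc mult_1_left mult_1_right)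

lemma neumann:
  fixes d :: "'a::{real_normed_algebra_1, banach}"
  assumes "norm d < 1"
  obtains b where "is_inv (1 - d) b" "norm (b - 1) \<le> norm d / (1 - norm d)"
proof -
  have s: "summable (\<lambda>n. d ^ n)" by (rule complete_algebra_summable_geometric[OF assms])
  define b where "b = (\<Sum>n. d ^ n)"
  have "b = (\<Sum>n. d ^ Suc n) + 1"
    unfolding b_def using suminf_split_head[OF s] by simp
  moreover have "(\<Sum>n. d ^ Suc n) = d * b" "(\<Sum>n. d ^ Suc n) = b * d"
    unfolding b_def using suminf_mult[OF s, of d] suminf_mult2[OF s, of d]
    by (simp_all add: power_commutes)
  ultimately have b: "b = d * b + 1" "b = b * d + 1" by auto
  then have "is_inv (1 - d) b" unfolding is_inv_def by (simp add: algebra_simps)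
  moreover have "norm (b - 1) \<le> norm d / (1 - norm d)"
  proof -
    have "b - 1 = d * (b - 1) + d" using b(1) by (simp add: algebra_simps)
    then have "norm (b - 1) \<le> norm d * norm (b - 1) + norm d"
      by (metis add_mono_thms_linordered_semiring(3) norm_mult_ineq norm_triangle_le)
    then show ?thesis using assms by (simp add: field_simps)
  qed
  ultimately show ?thesis using that by blast
qed

lemma neumann':
  fixes t :: "'a::{real_normed_algebra_1, banach}"
  assumes "norm (t - 1) < 1"
  obtains b where "is_inv t b" "norm (b - 1) \<le> norm (t - 1) / (1 - norm (t - 1))"
  using neumann[of "1 - t"] assms by (auto simp: norm_minus_commute)

text \<open>The resolvent identity \<open>k t - k t0 = k t * (g t0 - g t) * k t0\<close> gives
  continuity once \<open>k t\<close> is bounded near \<open>t0\<close>.\<close>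

lemma continuous_on_inverse_algebra:
  fixes g k :: "'b::topological_space \<Rightarrow> 'a::real_normed_algebra_1"
  assumes g: "continuous_on S g" and k: "\<And>t. t \<in> S \<Longrightarrow> is_inv (g t) (k t)"
  shows "continuous_on S k"
  unfolding continuous_on_def
proof
  fix t0 assume t0: "t0 \<in> S"
  define N where "N = norm (k t0)"
  have N: "N \<ge> 0" by (simp add: N_def)
  have lim: "((\<lambda>t. norm (g t - g t0)) \<longlongrightarrow> 0) (at t0 within S)"
    using g t0 tendsto_diff[OF _ tendsto_const, of g "g t0" _ "g t0"] tendsto_norm_zero
    unfolding continuous_on_def by fastforce
  \<comment> \<open>This radius makes \<open>norm (g t - g t0) * N\<close> at most 1/2, whence
    \<open>norm (k t) \<le> 2 * N\<close>; the summand 1 keeps the denominator positive even for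
    \<open>N = 0\<close>.\<close>
  have ev: "\<forall>\<^sub>F t in at t0 within S. norm (g t - g t0) < 1 / (2 * N + 1)"
    using order_tendstoD(2)[OF lim, of "1 / (2 * N + 1)"] N by simp
  have evS: "\<forall>\<^sub>F t in at t0 within S. t \<in> S"
    by (simp add: eventually_at_filter)
  have "\<forall>\<^sub>F t in at t0 within S. norm (k t - k t0) \<le> 2 * N * N * norm (g t - g t0)"
    using ev evS
  proof eventually_elim
    case (elim t)
    have "k t * (g t0 * k t0) = k t" "(k t * g t) * k t0 = k t0"
      using k[OF t0] k[OF elim(2)] by (simp_all add: is_inv_def)
    then have "k t - k t0 = k t * (g t0 - g t) * k t0" by (simp add: algebra_simps)
    then have "norm (k t - k t0) \<le> norm (k t * (g t0 - g t)) * N"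
      unfolding N_def by (simp only: norm_mult_ineq)
    also have "\<dots> \<le> norm (k t) * norm (g t0 - g t) * N"
      using N by (intro mult_right_mono norm_mult_ineq)
    finally have 1: "norm (k t - k t0) \<le> norm (k t) * norm (g t - g t0) * N"
      by (simp add: norm_minus_commute)
    also have "norm (k t) * norm (g t - g t0) * N \<le> norm (k t) * (1 / (2 * N + 1)) * N"
      using elim N by (intro mult_right_mono mult_left_mono) auto
    also have "\<dots> = norm (k t) * (N / (2 * N + 1))" by simp
    also have "\<dots> \<le> norm (k t) * (1 / 2)"
      using N by (intro mult_left_mono) (auto simp: field_simps)
    finally have "norm (k t - k t0) \<le> norm (k t) / 2" by simp
    then have "norm (k t) \<le> 2 * N"
      using norm_triangle_ineq2[of "k t" "k t0"] by (simp add: N_def)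
    then have "norm (k t) * norm (g t - g t0) * N \<le> (2 * N) * norm (g t - g t0) * N"
      using N by (intro mult_right_mono) auto
    with 1 show ?case by (simp add: mult_ac)
  qed
  moreover have "((\<lambda>t. 2 * N * N * norm (g t - g t0)) \<longlongrightarrow> 0) (at t0 within S)"
    using tendsto_mult_right_zero[OF lim] by simp
  ultimately have "((\<lambda>t. k t - k t0) \<longlongrightarrow> 0) (at t0 within S)"
    by (rule Lim_null_comparison)
  then show "(k \<longlongrightarrow> k t0) (at t0 within S)" by (simp add: LIM_zero_iff)
qed

lemma is_inv_scaleC: "c \<noteq> 0 \<Longrightarrow> is_inv a b \<Longrightarrow> is_inv (scaleC c a) (scaleC (1 / c) (b::'a::cstar_algebra))"
  by (simp add: is_inv_def mult_scaleC_left mult_scaleC_right scaleC_scaleC scaleC_one)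

lemma is_inv_diff_scaleC:
  assumes "norm (a::'a::cstar_algebra) < cmod z"
  shows "\<exists>b. is_inv (a - scaleC z 1) b"
proof -
  have z: "z \<noteq> 0" using assms by (smt (verit) norm_eq_zero norm_ge_zero)
  have "norm (scaleC (1 / z) a) < 1" using assms z by (simp add: norm_scaleC norm_divide field_simps)
  then obtain b where "is_inv (1 - scaleC (1 / z) a) b" using neumann by blast
  from is_inv_scaleC[OF _ this, of "- z"] z
  show ?thesis by (auto simp: scaleC_diff_right scaleC_scaleC scaleC_minus_left scaleC_one)
qed

lemma spectrum_iff: "z \<in> spectrum a \<longleftrightarrow> \<not> (\<exists>b. is_inv (a - scaleC z 1) b)"
  by (simp add: spectrum_def is_inv_def)

text \<open>Arens' shift: adding \<open>\<i> * l\<close> moves the alleged spectral value to squared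
  modulus \<open>(Re z)\<^sup>2 + (Im z + l)\<^sup>2\<close>, while the squared norm grows to at
  most \<open>(norm a)\<^sup>2 + l\<^sup>2\<close>. The choice of \<open>l\<close> makes the former
  larger, which contradicts the Neumann series.\<close>

lemma spectrum_self_adjoint_real:
  assumes a: "self_adjoint (a::'a::cstar_algebra)" and z: "z \<in> spectrum a"
  shows "Im z = 0"
proof (rule ccontr)
  assume b0: "Im z \<noteq> 0"
  define l where "l = ((norm a)\<^sup>2 + 1) / (2 * Im z)"
  have l: "2 * Im z * l = (norm a)\<^sup>2 + 1" using b0 by (simp add: l_def)
  define w where "w = a + scaleC (\<i> * l) 1"
  have aa: "cstar a = a" using a by (simp add: self_adjoint_def)
  have "cstar w * w = a * a + (l\<^sup>2) *\<^sub>R 1"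
    unfolding w_def by (simp add: cstar_add aa cstar_scaleC algebra_simps mult_scaleC_left mult_scaleC_right
        scaleC_scaleC scaleR_scaleC scaleC_minus_left scaleC_diff_right power2_eq_square)
  then have "(norm w)\<^sup>2 \<le> (norm a)\<^sup>2 + l\<^sup>2"
    using cstar_identity[of w] norm_triangle_ineq[of "a * a" "l\<^sup>2 *\<^sub>R 1"] norm_self_adjoint_square[OF a]
    by simp
  also have "\<dots> < (Re z)\<^sup>2 + (Im z + l)\<^sup>2"
    using l by (simp add: power2_eq_square algebra_simps) (smt (verit) zero_le_square)
  also have "\<dots> = (cmod (z + \<i> * l))\<^sup>2" by (simp add: cmod_power2)
  finally have "norm w < cmod (z + \<i> * l)" by (rule power_less_imp_less_base) simp
  then obtain b where "is_inv (w - scaleC (z + \<i> * l) 1) b" using is_inv_diff_scaleC by blast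
  then show False using z unfolding spectrum_iff w_def by (auto simp: scaleC_add_left)
qed

text \<open>Averaging the resolvent over the roots of unity of order $2^k$ gives the resolvent of
$a^{2^k}$; as the averages are equicontinuous, letting $k \to \infty$ inside and on the unit circle
shows that $a^{2^k}$ tends to $0$.\<close>

lemma self_adjoint_quasinilpotent:
  assumes a: "self_adjoint (a::'a::cstar_algebra)"
    and inv: "\<And>z. \<exists>b. is_inv (1 - scaleC z a) b"
  shows "a = 0"
proof (rule ccontr)
  assume "a \<noteq> 0"
  define c where "c = (1 / norm a) *\<^sub>R a"
  have nc: "norm c = 1" using \<open>a \<noteq> 0\<close> by (simp add: c_def)
  have c: "self_adjoint c" unfolding c_def by (rule self_adjoint_scaleR[OF a])
  have "\<exists>b. is_inv (1 - scaleC z c) b" for z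
    using inv[of "z * (1 / norm a)"] by (simp add: c_def scaleR_scaleC scaleC_scaleC)
  then obtain R where R: "\<And>z. is_inv (1 - scaleC z c) (R z)" by metis
  have contscale: "continuous_on S (\<lambda>z. scaleC z c)" for S
  proof -
    have "bounded_linear (\<lambda>z. scaleC z c)"
      by (rule bounded_linear_intro[of _ "norm c"])
         (simp_all add: scaleC_add_left scaleR_scaleC scaleC_scaleC norm_scaleC scaleR_conv_of_real)
    then show ?thesis using bounded_linear.continuous_on continuous_on_id by blast
  qed
  have "continuous_on (cball 0 1) R"
    by (rule continuous_on_inverse_algebra[where g = "\<lambda>z. 1 - scaleC z c"])
       (use R contscale in \<open>auto intro!: continuous_intros\<close>)
  then have uc: "uniformly_continuous_on (cball 0 1) R"
    by (rule compact_uniformly_continuous) simp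
  obtain \<delta> where \<delta>: "\<delta> > 0" "\<And>z w. cmod z \<le> 1 \<Longrightarrow> cmod w \<le> 1 \<Longrightarrow> dist z w < \<delta> \<Longrightarrow> dist (R z) (R w) < 1/4"
    using uc unfolding uniformly_continuous_on_def
    by (metis mem_cball_0 dist_commute zero_less_divide_1_iff zero_less_numeral)
  have "\<exists>G. \<forall>z. is_inv (1 - scaleC (z ^ (2 ^ k)) (c ^ (2 ^ k))) (G z) \<and>
     (\<forall>w. cmod z \<le> 1 \<longrightarrow> cmod w \<le> 1 \<longrightarrow> dist z w < \<delta> \<longrightarrow> dist (G z) (G w) < 1/4)" for k
  proof (induction k)
    case 0
    show ?case using R \<delta>(2) by (intro exI[of _ R]) simp
  next
    case (Suc k)
    then obtain G where G: "\<And>z. is_inv (1 - scaleC (z ^ (2 ^ k)) (c ^ (2 ^ k))) (G z)"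
      "\<And>z w. cmod z \<le> 1 \<Longrightarrow> cmod w \<le> 1 \<Longrightarrow> dist z w < \<delta> \<Longrightarrow> dist (G z) (G w) < 1/4" by blast
    \<comment> \<open>Multiplication by \<open>\<zeta>\<close> changes the sign of
      \<open>z ^ (2 ^ k)\<close> and preserves the disc and all distances, so the modulus of
      continuity survives averaging.\<close>
    define \<zeta> where "\<zeta> = cis (pi / 2 ^ k)"
    have \<zeta>: "\<zeta> ^ (2 ^ k) = -1" "cmod \<zeta> = 1" by (simp_all add: \<zeta>_def Complex.DeMoivre)
    \<comment> \<open>The average of the inverses of \<open>1 - x\<close> and \<open>1 + x\<close>
      is the inverse of \<open>1 - x * x\<close>.\<close>
    define H where "H z = (1/2) *\<^sub>R (G z + G (\<zeta> * z))" for z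
    show ?case
    proof (intro exI[of _ H] allI conjI impI)
      fix z
      define x where "x = scaleC (z ^ (2 ^ k)) (c ^ (2 ^ k))"
      have x2: "scaleC (z ^ (2 ^ Suc k)) (c ^ (2 ^ Suc k)) = x * x"
        by (simp add: x_def mult_scaleC_left mult_scaleC_right scaleC_scaleC mult_2 power_add)
      have 1: "is_inv (1 - x) (G z)" using G(1) x_def by simp
      have 2: "is_inv (1 + x) (G (\<zeta> * z))"
        using G(1)[of "\<zeta> * z"] by (simp add: x_def power_mult_distrib \<zeta> scaleC_minus_left)
      have e1: "(1 - x * x) = (1 + x) * (1 - x)" "(1 - x * x) = (1 - x) * (1 + x)"
        by (simp_all add: algebra_simps)
      have "(1 - x * x) * G z = 1 + x" "G z * (1 - x * x) = 1 + x"
        using 1 e1 unfolding is_inv_def by (metis mult.assoc mult_1_left mult_1_right)+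
      moreover have "(1 - x * x) * G (\<zeta> * z) = 1 - x" "G (\<zeta> * z) * (1 - x * x) = 1 - x"
        using 2 e1 unfolding is_inv_def by (metis mult.assoc mult_1_left mult_1_right)+
      ultimately have "is_inv (1 - x * x) (H z)"
        unfolding is_inv_def H_def by (simp add: distrib_left distrib_right flip: scaleR_2)
      then show "is_inv (1 - scaleC (z ^ 2 ^ Suc k) (c ^ 2 ^ Suc k)) (H z)" using x2 by simp
      fix w assume zw: "cmod z \<le> 1" "cmod w \<le> 1" "dist z w < \<delta>"
      have "dist (\<zeta> * z) (\<zeta> * w) = dist z w"
        by (simp add: dist_norm norm_mult \<zeta> flip: right_diff_distrib)
      then have d: "dist (G z) (G w) < 1/4" "dist (G (\<zeta> * z)) (G (\<zeta> * w)) < 1/4"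
        using zw G(2)[of z w] G(2)[of "\<zeta> * z" "\<zeta> * w"] by (simp_all add: norm_mult \<zeta>)
      have "H z - H w = (1/2) *\<^sub>R ((G z - G w) + (G (\<zeta> * z) - G (\<zeta> * w)))"
        by (simp add: H_def algebra_simps)
      then have "norm (H z - H w) \<le> (1/2) * (norm (G z - G w) + norm (G (\<zeta> * z) - G (\<zeta> * w)))"
        using norm_triangle_ineq[of "G z - G w"] by simp
      then show "dist (H z) (H w) < 1/4" using d by (simp add: dist_norm)
    qed
  qed
  then obtain G where G: "\<And>k z. is_inv (1 - scaleC (z ^ (2 ^ k)) (c ^ (2 ^ k))) (G k z)"
     "\<And>k z w. cmod z \<le> 1 \<Longrightarrow> cmod w \<le> 1 \<Longrightarrow> dist z w < \<delta> \<Longrightarrow> dist (G k z) (G k w) < 1/4"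
    by metis
  \<comment> \<open>\<open>r\<close> is a point inside the disc within \<open>\<delta>\<close> of 1;
    the bound 1/2 keeps it positive if \<open>\<delta>\<close> is large. Below,
    \<open>r ^ (2 ^ k) < 1/5\<close> gives the Neumann bound (1/5)/(4/5) = 1/4, and equicontinuity
    adds less than 1/4. So \<open>G k 1\<close> is within 1/2 of 1, which is impossible for
    \<open>norm y = 1\<close>.\<close>
  define r where "r = max (1/2) (1 - \<delta> / 2)"
  have r: "0 < r" "r < 1" "1 - r < \<delta>" using \<delta>(1) by (auto simp: r_def)
  obtain k where k: "r ^ k < 1/5" using real_arch_pow_inv[of "1/5" r] r by auto
  have "r ^ (2 ^ k) \<le> r ^ k" using r by (intro power_decreasing) (auto simp: less_imp_le)
  with k have k: "r ^ (2 ^ k) < 1/5" by simp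
  define y where "y = c ^ (2 ^ k)"
  have ny: "norm y = 1" using norm_self_adjoint_power[OF c] nc by (simp add: y_def)
  have nx: "norm (scaleC (of_real r ^ (2 ^ k)) y) = r ^ (2 ^ k)"
    using ny r by (simp add: norm_scaleC norm_power)
  then obtain b where b: "is_inv (1 - scaleC (of_real r ^ (2 ^ k)) y) b"
    "norm (b - 1) \<le> r ^ (2 ^ k) / (1 - r ^ (2 ^ k))"
    using neumann[of "scaleC (of_real r ^ (2 ^ k)) y"] k by auto
  have "b = G k (of_real r)" using is_inv_unique[OF b(1)] G(1)[of "of_real r" k] by (simp add: y_def)
  moreover have "r ^ (2 ^ k) / (1 - r ^ (2 ^ k)) \<le> 1/4" using k by (simp add: field_simps)
  ultimately have 1: "norm (G k (of_real r) - 1) \<le> 1/4" using b order_trans by blast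
  have "dist (1::complex) (of_real r) = 1 - r"
    using r by (metis dist_norm norm_of_real of_real_1 of_real_diff abs_of_pos diff_gt_0_iff_gt)
  then have "norm (G k 1 - G k (of_real r)) < 1/4"
    using G(2)[of 1 "of_real r" k] r by (simp add: dist_norm)
  with 1 have G1: "norm (G k 1 - 1) < 1/2"
    using norm_triangle_ineq[of "G k 1 - G k (of_real r)" "G k (of_real r) - 1"] by simp
  have "(1 - y) * G k 1 = 1" using G(1)[of 1 k] by (simp add: is_inv_def y_def scaleC_one)
  then have "y = (G k 1 - 1) - y * (G k 1 - 1)" by (simp add: algebra_simps)
  then have "norm y \<le> norm (G k 1 - 1) + norm (y * (G k 1 - 1))"
    by (metis norm_triangle_ineq4)
  also have "norm (y * (G k 1 - 1)) \<le> norm (G k 1 - 1)"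
    using norm_mult_ineq[of y "G k 1 - 1"] ny by simp
  finally show False using ny G1 by simp
qed

section \<open>Polynomial calculus and finite spectral sums\<close>

definition poly_ev :: "'a::cstar_algebra \<Rightarrow> complex poly \<Rightarrow> 'a" where
  "poly_ev a p = fold_coeffs (\<lambda>c r. scaleC c 1 + a * r) p 0"

lemma poly_ev_0 [simp]: "poly_ev a 0 = 0"
  by (simp add: poly_ev_def)

lemma poly_ev_pCons: "poly_ev a (pCons c p) = scaleC c 1 + a * poly_ev a p"
  by (cases "c = 0 \<and> p = 0") (auto simp: poly_ev_def)

lemma poly_ev_1 [simp]: "poly_ev a 1 = 1"
  by (simp add: one_pCons poly_ev_pCons scaleC_one)

lemma poly_ev_add: "poly_ev a (p + q) = poly_ev a p + poly_ev a q"
  by (induction p q rule: poly_induct2) (simp_all add: poly_ev_pCons scaleC_add_left algebra_simps)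

lemma poly_ev_smult: "poly_ev a (smult c p) = scaleC c (poly_ev a p)"
  by (induction p) (simp_all add: poly_ev_pCons scaleC_add_right scaleC_scaleC mult_scaleC_right)

lemma poly_ev_diff: "poly_ev a (p - q) = poly_ev a p - poly_ev a q"
  using poly_ev_add[of a "p - q" q] by simp

lemma poly_ev_mult: "poly_ev a (p * q) = poly_ev a p * poly_ev a q"
  by (induction p)
     (simp_all add: poly_ev_pCons poly_ev_add poly_ev_smult mult_scaleC_left algebra_simps)

lemma poly_ev_sum: "poly_ev a (\<Sum>i\<in>I. f i) = (\<Sum>i\<in>I. poly_ev a (f i))"
  by (induction I rule: infinite_finite_induct) (simp_all add: poly_ev_add)

lemma poly_ev_X: "poly_ev a [:- c, 1:] = a - scaleC c 1"
  by (simp add: poly_ev_pCons scaleC_minus_left scaleC_one)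

lemma self_adjoint_poly_ev:
  assumes a: "self_adjoint a"
  shows "(\<And>i. coeff p i \<in> \<real>) \<Longrightarrow> self_adjoint (poly_ev a p)"
proof (induction p)
  case (pCons c p)
  have "coeff (pCons c p) 0 \<in> \<real>" by (rule pCons.prems)
  then have "cnj c = c" by (simp add: Reals_cnj_iff)
  moreover have "coeff p i \<in> \<real>" for i using pCons.prems[of "Suc i"] by simp
  then have "self_adjoint (poly_ev a p)" by (rule pCons.IH)
  moreover have "a * poly_ev a p = poly_ev a p * a"
  proof -
    have "poly_ev a ([:0, 1:] * p) = poly_ev a (p * [:0, 1:])" by (simp add: mult.commute)
    then show ?thesis by (simp only: poly_ev_mult) (simp add: poly_ev_pCons scaleC_one)
  qed
  ultimately show ?case
    using a by (simp add: self_adjoint_def poly_ev_pCons cstar_add cstar_scaleC cstar_mult)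
qed simp

text \<open>Half of the spectral mapping theorem: over the complex numbers the polynomial splits
  into linear factors, each invertible at \<open>a\<close>.\<close>

lemma is_inv_poly_ev:
  assumes "p \<noteq> 0" "\<And>r. poly p r = 0 \<Longrightarrow> r \<notin> spectrum a"
  shows "\<exists>b. is_inv (poly_ev a p) b"
  using assms
proof (induction "degree p" arbitrary: p)
  case 0
  then obtain c where "p = [:c:]" by (metis degree_eq_zeroE)
  with 0 have "poly_ev a p = scaleC c 1" "c \<noteq> 0" by (auto simp: poly_ev_pCons)
  then show ?case using is_inv_scaleC[of c 1 1] by (auto simp: is_inv_def)
next
  case (Suc n)
  have "\<not> constant (poly p)" using Suc.hyps(2) by (simp add: constant_degree)
  then obtain r where r: "poly p r = 0" using fundamental_theorem_of_algebra by blast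
  then obtain q where q: "p = [:- r, 1:] * q" by (metis dvdE poly_eq_0_iff_dvd)
  have "q \<noteq> 0" using Suc.prems(1) q by auto
  then have "degree p = Suc (degree q)" unfolding q by (subst degree_mult_eq) auto
  moreover have "\<And>s. poly q s = 0 \<Longrightarrow> s \<notin> spectrum a" using Suc.prems(2) q by auto
  ultimately obtain b where "is_inv (poly_ev a q) b"
    using Suc.hyps(1)[of q] Suc.hyps(2) \<open>q \<noteq> 0\<close> by auto
  moreover obtain c where "is_inv (a - scaleC r 1) c"
    using Suc.prems(2)[OF r] by (auto simp: spectrum_iff)
  ultimately show ?case
    unfolding q poly_ev_mult poly_ev_X using is_inv_mult by blast
qed

lemma prod_linear_dvd:
  fixes g :: "'b::field poly"
  assumes "finite T" "\<And>t. t \<in> T \<Longrightarrow> poly g t = 0"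
  shows "(\<Prod>t\<in>T. [:- t, 1:]) dvd g"
  using assms
proof (induction arbitrary: g rule: finite_induct)
  case (insert a T)
  obtain k where k: "g = [:- a, 1:] * k" using insert.prems[of a] by (metis dvdE insertI1 poly_eq_0_iff_dvd)
  have "poly k t = 0" if "t \<in> T" for t
    using insert.prems[of t] insert.hyps(2) that unfolding k by auto
  then have "(\<Prod>t\<in>T. [:- t, 1:]) dvd k" by (rule insert.IH)
  then show ?case unfolding k by (simp only: prod.insert[OF insert.hyps] mult_dvd_mono dvd_refl)
qed simp

lemma coeff_prod_real:
  fixes f :: "'c \<Rightarrow> complex poly"
  assumes "\<And>t i. t \<in> T \<Longrightarrow> coeff (f t) i \<in> \<real>"
  shows "coeff (\<Prod>t\<in>T. f t) i \<in> \<real>"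
  using assms
proof (induction T arbitrary: i rule: infinite_finite_induct)
  case (insert x T)
  then show ?case by (auto simp: coeff_mult intro!: sum_in_Reals Reals_mult)
qed (auto simp: one_pCons coeff_pCons split: nat.splits)

text \<open>Zero projections are excluded so that every index is a genuine spectral value and bounds
  the norm from below, see \<open>norm_fcalc_ge\<close>.\<close>

definition spectral_system :: "real set \<Rightarrow> (real \<Rightarrow> 'a::cstar_algebra) \<Rightarrow> bool" where
  "spectral_system S E \<longleftrightarrow> finite S \<and> (\<forall>s\<in>S. is_proj (E s) \<and> E s \<noteq> 0) \<and>
     (\<forall>s\<in>S. \<forall>t\<in>S. s \<noteq> t \<longrightarrow> E s * E t = 0) \<and> (\<Sum>s\<in>S. E s) = 1"

text \<open>Let \<open>f\<close> have simple zeros at the points of the spectrum. Then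
  \<open>1 - smult z f\<close> equals 1 there for every \<open>z\<close>, so
  \<open>1 - scaleC z (poly_ev b f)\<close> is always invertible and the self-adjoint
  \<open>poly_ev b f\<close> vanishes. Polynomials in \<open>b\<close> therefore depend only on
  their values at those points, and Lagrange polynomials yield the projections.\<close>

theorem finite_spectrum_decomposition:
  assumes b: "self_adjoint (b::'a::cstar_algebra)" and fin: "finite (spectrum b)"
  obtains S E where "spectral_system S E" "b = (\<Sum>s\<in>S. s *\<^sub>R E s)"
proof -
  \<comment> \<open>Adding 0 makes \<open>T\<close> nonempty without appeal to nonemptiness of the
    spectrum. If 0 is not a spectral value its projection vanishes and is dropped in
    \<open>S\<close>.\<close>
  define T where "T = insert 0 (spectrum b)"
  have T: "finite T" "T \<noteq> {}" using fin by (auto simp: T_def)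
  have TR: "t \<in> \<real>" if "t \<in> T" for t
    using spectrum_self_adjoint_real[OF b] that by (auto simp: T_def complex_is_Real_iff)
  define f where "f = (\<Prod>t\<in>T. [:- t, 1:])"
  have deg: "degree f > 0"
    using T unfolding f_def by (subst degree_prod_eq_sum_degree) (auto simp: sum_pos)
  have lin_real: "coeff [:- t, 1:] i \<in> \<real>" if "t \<in> T" for t i
    using TR[OF that] by (auto simp: coeff_pCons split: nat.splits)
  have "self_adjoint (poly_ev b f)"
    unfolding f_def by (intro self_adjoint_poly_ev b coeff_prod_real lin_real)
  moreover have "\<exists>c. is_inv (1 - scaleC z (poly_ev b f)) c" for z
  proof -
    have *: "poly_ev b (1 - smult z f) = 1 - scaleC z (poly_ev b f)"
      by (simp add: poly_ev_diff poly_ev_smult)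
    have root: "poly (1 - smult z f) t = 1" if "t \<in> T" for t
      using T that by (simp add: f_def poly_prod)
    then have "1 - smult z f \<noteq> 0" using T by force
    moreover have "r \<notin> spectrum b" if "poly (1 - smult z f) r = 0" for r
      using root[of r] that by (auto simp: T_def)
    ultimately show ?thesis using is_inv_poly_ev * by metis
  qed
  ultimately have f0: "poly_ev b f = 0" by (rule self_adjoint_quasinilpotent)
  have ev0: "poly_ev b g = 0" if "\<And>t. t \<in> T \<Longrightarrow> poly g t = 0" for g
  proof -
    have "f dvd g" unfolding f_def using T that by (intro prod_linear_dvd) auto
    then show ?thesis using f0 by (auto simp: poly_ev_mult elim!: dvdE)
  qed
  have ev_eq: "poly_ev b g = poly_ev b h" if "\<And>t. t \<in> T \<Longrightarrow> poly g t = poly h t" for g h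
    using ev0[of "g - h"] that by (simp add: poly_ev_diff)
  \<comment> \<open>Lagrange basis polynomials at the nodes \<open>T\<close>.\<close>
  define L where "L s = smult (1 / (\<Prod>t\<in>T - {s}. s - t)) (\<Prod>t\<in>T - {s}. [:- t, 1:])" for s
  have L: "poly (L s) t = (if s = t then 1 else 0)" if "s \<in> T" "t \<in> T" for s t
    using that T by (auto simp: L_def poly_prod prod_zero_iff)
  have Lreal: "self_adjoint (poly_ev b (L s))" if "s \<in> T" for s
  proof (intro self_adjoint_poly_ev b)
    fix i
    have "(\<Prod>t\<in>T - {s}. s - t) \<in> \<real>" using TR that by (intro prod_in_Reals Reals_diff) auto
    moreover have "coeff (\<Prod>t\<in>T - {s}. [:- t, 1:]) i \<in> \<real>"
      by (intro coeff_prod_real lin_real) auto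
    ultimately show "coeff (L s) i \<in> \<real>" by (auto simp: L_def intro!: Reals_mult Reals_divide)
  qed
  define E where "E s = poly_ev b (L (of_real s))" for s :: real
  define S0 where "S0 = Re ` T"
  define S where "S = {s \<in> S0. E s \<noteq> 0}"
  have S0T: "of_real s \<in> T" if "s \<in> S0" for s
    using that TR by (auto simp: S0_def)
  have bij: "bij_betw complex_of_real S0 T"
    unfolding bij_betw_def inj_on_def S0_def using TR by (force simp: image_image)
  have finS: "finite S0" using T by (simp add: S0_def)
  have sumT: "(\<Sum>s\<in>S0. g (of_real s)) = (\<Sum>t\<in>T. g t)" for g :: "complex \<Rightarrow> 'a"
    using sum.reindex_bij_betw[OF bij] .
  have "is_proj (E s)" if "s \<in> S0" for s
  proof -
    have "poly_ev b (L (of_real s) * L (of_real s)) = poly_ev b (L (of_real s))"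
      using S0T[OF that] by (intro ev_eq) (simp add: L)
    then show ?thesis
      using Lreal[OF S0T[OF that]] unfolding is_proj_def E_def self_adjoint_def poly_ev_mult by simp
  qed
  moreover have "E s * E t = 0" if "s \<in> S0" "t \<in> S0" "s \<noteq> t" for s t
    unfolding E_def poly_ev_mult[symmetric] using that S0T by (intro ev0) (auto simp: L)
  moreover have "(\<Sum>s\<in>S. E s) = (\<Sum>s\<in>S0. E s)"
    using finS by (intro sum.mono_neutral_left) (auto simp: S_def)
  moreover have "\<dots> = 1"
  proof -
    have "(\<Sum>s\<in>S0. E s) = poly_ev b (\<Sum>t\<in>T. L t)"
      unfolding E_def using sumT[of "\<lambda>t. poly_ev b (L t)"] by (simp add: poly_ev_sum)
    also have "\<dots> = poly_ev b 1"
      using T by (intro ev_eq) (simp add: poly_sum L sum.delta cong: sum.cong)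
    finally show ?thesis by simp
  qed
  ultimately have "spectral_system S E"
    using finS unfolding spectral_system_def by (auto simp: S_def)
  moreover have "b = (\<Sum>s\<in>S. s *\<^sub>R E s)"
  proof -
    have "(\<Sum>s\<in>S. s *\<^sub>R E s) = (\<Sum>s\<in>S0. s *\<^sub>R E s)"
      using finS by (intro sum.mono_neutral_left) (auto simp: S_def)
    also have "\<dots> = poly_ev b (\<Sum>t\<in>T. smult t (L t))"
      unfolding E_def using sumT[of "\<lambda>t. scaleC t (poly_ev b (L t))"]
      by (simp add: poly_ev_sum poly_ev_smult scaleR_scaleC)
    also have "\<dots> = poly_ev b [:0, 1:]"
    proof (intro ev_eq)
      fix t assume t: "t \<in> T"
      have "poly (\<Sum>t\<in>T. smult t (L t)) t = (\<Sum>s\<in>T. if s = t then s else 0)"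
        using t unfolding poly_sum by (intro sum.cong) (auto simp: L)
      then show "poly (\<Sum>t\<in>T. smult t (L t)) t = poly [:0, 1:] t" using T t by simp
    qed
    also have "\<dots> = b" by (simp add: poly_ev_pCons scaleC_one)
    finally show ?thesis by simp
  qed
  ultimately show ?thesis using that by blast
qed

section \<open>Positivity and the exchange property in real rank zero\<close>

definition fcalc :: "real set \<Rightarrow> (real \<Rightarrow> 'a::cstar_algebra) \<Rightarrow> (real \<Rightarrow> real) \<Rightarrow> 'a" where
  "fcalc S E g = (\<Sum>s\<in>S. g s *\<^sub>R E s)"

context
  fixes S :: "real set" and E :: "real \<Rightarrow> 'a::cstar_algebra"
  assumes SE: "spectral_system S E"
begin

lemma spectral_system_mult: "s \<in> S \<Longrightarrow> t \<in> S \<Longrightarrow> E s * E t = (if s = t then E s else 0)"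
  using SE by (auto simp: spectral_system_def is_proj_def)

lemma fcalc_mult_E: "s \<in> S \<Longrightarrow> fcalc S E g * E s = g s *\<^sub>R E s"
  using SE unfolding fcalc_def spectral_system_def
  by (simp add: sum_distrib_right spectral_system_mult if_distrib cong: if_cong)

lemma E_mult_fcalc: "s \<in> S \<Longrightarrow> E s * fcalc S E g = g s *\<^sub>R E s"
  using SE unfolding fcalc_def spectral_system_def
  by (simp add: sum_distrib_left spectral_system_mult if_distrib cong: if_cong)

lemma fcalc_mult: "fcalc S E g * fcalc S E h = fcalc S E (\<lambda>s. g s * h s)"
proof -
  have "fcalc S E g * fcalc S E h = (\<Sum>s\<in>S. h s *\<^sub>R (fcalc S E g * E s))"
    unfolding fcalc_def[of S E h] by (simp add: sum_distrib_left)
  also have "\<dots> = fcalc S E (\<lambda>s. g s * h s)"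
    unfolding fcalc_def[of S E "\<lambda>s. g s * h s"]
    by (intro sum.cong) (simp_all add: fcalc_mult_E mult.commute)
  finally show ?thesis .
qed

lemma fcalc_cong: "(\<And>s. s \<in> S \<Longrightarrow> g s = h s) \<Longrightarrow> fcalc S E g = fcalc S E h"
  by (simp add: fcalc_def)

lemma fcalc_const: "fcalc S E (\<lambda>_. c) = c *\<^sub>R 1"
  using SE by (simp add: fcalc_def spectral_system_def flip: scaleR_sum_right)

lemma fcalc_add: "fcalc S E (\<lambda>s. g s + h s) = fcalc S E g + fcalc S E h"
  by (simp add: fcalc_def scaleR_add_left sum.distrib)

lemma fcalc_diff: "fcalc S E (\<lambda>s. g s - h s) = fcalc S E g - fcalc S E h"
  by (simp add: fcalc_def scaleR_diff_left sum_subtractf)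

lemma self_adjoint_fcalc: "self_adjoint (fcalc S E g)"
  using SE unfolding fcalc_def self_adjoint_def cstar_sum
  by (intro sum.cong) (auto simp: cstar_scaleR spectral_system_def is_proj_def)

lemma norm_fcalc_ge:
  assumes "s \<in> S"
  shows "\<bar>g s\<bar> \<le> norm (fcalc S E g)"
proof -
  have "norm (E s) = 1" using SE assms by (auto simp: spectral_system_def intro: norm_proj)
  then have "\<bar>g s\<bar> = norm (fcalc S E g * E s)" using assms by (simp add: fcalc_mult_E)
  also have "\<dots> \<le> norm (fcalc S E g)"
    using norm_mult_ineq[of "fcalc S E g" "E s"] \<open>norm (E s) = 1\<close> by simp
  finally show ?thesis .
qed

end

text \<open>\<open>x\<close> and \<open>y\<close> are the real and imaginary part of
  \<open>u = x + scaleC \<i> y\<close>, and \<open>cstar u * u\<close> is the scalar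
  \<open>K\<^sup>2\<close>. This bounds norms without any notion of positivity.\<close>

lemma norm_le_of_sum_squares:
  assumes "self_adjoint (x::'a::cstar_algebra)" "self_adjoint y" "x * y = y * x"
    and "x * x + y * y = K\<^sup>2 *\<^sub>R 1" "K \<ge> 0"
  shows "norm x \<le> K" "norm y \<le> K"
proof -
  define u where "u = x + scaleC \<i> y"
  have xy: "cstar x = x" "cstar y = y" using assms by (auto simp: self_adjoint_def)
  have cu: "cstar u = x - scaleC \<i> y"
    by (simp add: u_def cstar_add cstar_scaleC xy scaleC_minus_left)
  have "cstar u * u = x * x + y * y"
    unfolding cu unfolding u_def using assms(3)
    by (simp add: algebra_simps mult_scaleC_left mult_scaleC_right scaleC_scaleC scaleC_minus_left scaleC_one
        scaleC_diff_right scaleC_add_right)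
  then have "(norm u)\<^sup>2 = K\<^sup>2" using cstar_identity[of u] assms by simp
  then have nu: "norm u = K" using assms(5) by simp
  have "x = (1/2) *\<^sub>R (u + cstar u)" unfolding cu by (simp add: u_def flip: scaleR_2)
  then have "norm x \<le> (1/2) * (norm u + norm (cstar u))"
    using norm_triangle_ineq[of u "cstar u"] by simp
  then show "norm x \<le> K" using nu by simp
  have "2 *\<^sub>R scaleC \<i> y = u - cstar u" unfolding cu by (simp add: u_def scaleR_2)
  then have "2 * norm y = norm (u - cstar u)" by (metis norm_scaleR norm_scaleC norm_ii abs_numeral mult_1)
  then show "norm y \<le> K" using nu norm_triangle_ineq4[of u "cstar u"] by simp
qed

text \<open>The partner \<open>sqrt (K\<^sup>2 - (g s)\<^sup>2)\<close> completes \<open>g\<close>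
  to a pair on the circle of radius \<open>K\<close>, and \<open>norm_le_of_sum_squares\<close>
  applies.\<close>

lemma norm_fcalc_le:
  assumes SE: "spectral_system S E" and g: "\<And>s. s \<in> S \<Longrightarrow> \<bar>g s\<bar> \<le> K" and K: "K \<ge> 0"
  shows "norm (fcalc S E g) \<le> K"
proof (rule norm_le_of_sum_squares(1))
  let ?h = "\<lambda>s. sqrt (K\<^sup>2 - (g s)\<^sup>2)"
  show "fcalc S E g * fcalc S E ?h = fcalc S E ?h * fcalc S E g"
    by (simp add: fcalc_mult[OF SE] mult.commute)
  have "fcalc S E g * fcalc S E g + fcalc S E ?h * fcalc S E ?h
      = fcalc S E (\<lambda>s. g s * g s + ?h s * ?h s)"
    by (simp only: fcalc_mult[OF SE] fcalc_add[OF SE])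
  also have "\<dots> = fcalc S E (\<lambda>_. K\<^sup>2)"
  proof (rule fcalc_cong)
    fix s assume "s \<in> S"
    then have "(g s)\<^sup>2 \<le> K\<^sup>2" using g K abs_le_square_iff by fastforce
    then show "g s * g s + ?h s * ?h s = K\<^sup>2" by (simp add: power2_eq_square)
  qed (rule SE)
  finally show "fcalc S E g * fcalc S E g + fcalc S E ?h * fcalc S E ?h = K\<^sup>2 *\<^sub>R 1"
    by (simp add: fcalc_const[OF SE])
qed (use K self_adjoint_fcalc[OF SE] in auto)

lemma real_rank_zero_approx:
  assumes "real_rank_zero TYPE('a::cstar_algebra)" "self_adjoint (a::'a)" "\<epsilon> > 0"
  obtains S E where "spectral_system S E" "norm (a - fcalc S E (\<lambda>s. s)) < \<epsilon>"
proof -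
  obtain b where b: "self_adjoint b" "finite (spectrum b)" "dist a b < \<epsilon>"
    using assms unfolding real_rank_zero_def by blast
  obtain S E where "spectral_system S E" "b = (\<Sum>s\<in>S. s *\<^sub>R E s)"
    using finite_spectrum_decomposition[OF b(1,2)] .
  with b(3) show ?thesis by (intro that) (auto simp: fcalc_def dist_norm)
qed

text \<open>\<open>(1 - s) * (1 - s) = 1 - d\<close> is the fixed point equation of
  \<open>s \<mapsto> (1/2) *\<^sub>R (d + s * s)\<close>, a contraction of the ball of radius
  \<open>norm d\<close>. The set \<open>K\<close> passes on any closed property that this map
  preserves.\<close>

lemma sqrt_in_closed:
  fixes d :: "'a::{real_normed_algebra_1, banach}"
  assumes d: "norm d < 1" and K: "closed K" "0 \<in> K" "\<And>s. s \<in> K \<Longrightarrow> (1/2) *\<^sub>R (d + s * s) \<in> K"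
  obtains s where "s \<in> K" "norm s < 1" "(1 - s) * (1 - s) = 1 - d"
proof -
  define r where "r = norm d"
  have r: "0 \<le> r" "r < 1" using d by (auto simp: r_def)
  define f where "f s = (1/2) *\<^sub>R (d + s * s)" for s
  have "\<exists>!x\<in>K \<inter> cball 0 r. f x = x"
  proof (rule Banach_fix)
    show "complete (K \<inter> cball 0 r)" using K by (simp add: complete_eq_closed closed_Int)
    show "K \<inter> cball 0 r \<noteq> {}" using K r by auto
    show "f ` (K \<inter> cball 0 r) \<subseteq> K \<inter> cball 0 r"
    proof safe
      fix s assume s: "s \<in> K" "s \<in> cball 0 r"
      show "f s \<in> K" using K s by (simp add: f_def)
      have "norm (s * s) \<le> r * r"
        using norm_mult_ineq[of s s] mult_mono[of "norm s" r "norm s" r] s r by auto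
      also have "\<dots> \<le> r" using r mult_left_le[of r r] by simp
      finally have "norm (d + s * s) \<le> r + r" using norm_triangle_ineq[of d "s * s"] by (simp add: r_def)
      then show "f s \<in> cball 0 r" by (simp add: f_def)
    qed
    show "dist (f s) (f t) \<le> r * dist s t" if "s \<in> K \<inter> cball 0 r" "t \<in> K \<inter> cball 0 r" for s t
    proof -
      have "f s - f t = (1/2) *\<^sub>R (s * (s - t) + (s - t) * t)"
        by (simp add: f_def algebra_simps)
      then have "norm (f s - f t) = (1/2) * norm (s * (s - t) + (s - t) * t)" by simp
      also have "\<dots> \<le> (1/2) * (norm s * norm (s - t) + norm (s - t) * norm t)"
        by (intro mult_left_mono order_trans[OF norm_triangle_ineq] add_mono norm_mult_ineq) auto
      also have "\<dots> \<le> (1/2) * (r * norm (s - t) + norm (s - t) * r)"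
        using that by (intro mult_left_mono add_mono mult_right_mono mult_left_mono) auto
      finally show ?thesis by (simp add: dist_norm)
    qed
  qed (use r in auto)
  then obtain s where s: "s \<in> K" "norm s \<le> r" "f s = s" by auto
  have "2 *\<^sub>R s = 2 *\<^sub>R f s" using s by simp
  then have "s + s = d + s * s" by (simp add: f_def scaleR_2)
  then have "(1 - s) * (1 - s) = 1 - d" by (simp add: algebra_simps)
  with s r show ?thesis by (intro that) auto
qed

lemma closed_commutant: "closed {s::'a::real_normed_algebra. \<forall>c. c * d = d * c \<longrightarrow> c * s = s * c}"
proof -
  have "{s. \<forall>c. c * d = d * c \<longrightarrow> c * s = s * c} = (\<Inter>c\<in>{c. c * d = d * c}. {s. c * s = s * c})" by auto
  then show ?thesis by (auto intro!: closed_INT closed_Collect_eq continuous_intros)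
qed

text \<open>Self-adjointness and commuting with all that commutes with \<open>d\<close> are closed
  and stable under the iteration. \<open>K\<close> stays free for further constraints: later it is a
  corner or a closed ideal.\<close>

lemma self_adjoint_sqrt:
  assumes d: "self_adjoint (d::'a::cstar_algebra)" "norm d < 1"
    and K: "closed K" "0 \<in> K" "\<And>s. s \<in> K \<Longrightarrow> (1/2) *\<^sub>R (d + s * s) \<in> K"
  obtains s where "self_adjoint s" "s \<in> K" "norm s < 1" "(1 - s) * (1 - s) = 1 - d"
    "\<And>c. c * d = d * c \<Longrightarrow> c * s = s * c"
proof -
  let ?K = "K \<inter> {s. self_adjoint s} \<inter> {s. \<forall>c. c * d = d * c \<longrightarrow> c * s = s * c}"
  have step: "(1/2) *\<^sub>R (d + s * s) \<in> ?K" if s: "s \<in> ?K" for s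
  proof -
    have "c * ((1/2) *\<^sub>R (d + s * s)) = ((1/2) *\<^sub>R (d + s * s)) * c" if c: "c * d = d * c" for c
    proof -
      have "c * s = s * c" using s c by blast
      then have "c * (s * s) = (s * s) * c" by (metis mult.assoc)
      with c show ?thesis by (simp add: distrib_left distrib_right)
    qed
    moreover have "self_adjoint ((1/2) *\<^sub>R (d + s * s))"
    proof (intro self_adjoint_scaleR self_adjoint_add d)
      have "self_adjoint s" using s by blast
      then show "self_adjoint (s * s)" by (simp add: self_adjoint_def cstar_mult)
    qed
    ultimately show ?thesis using K(3) s by blast
  qed
  have "closed ?K" "0 \<in> ?K" using K by (auto intro!: closed_Int closed_self_adjoint closed_commutant)
  then obtain s where "s \<in> ?K" "norm s < 1" "(1 - s) * (1 - s) = 1 - d"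
    using sqrt_in_closed[OF d(2) _ _ step] by blast
  then show ?thesis by (intro that) blast+
qed

lemma is_inv_self_adjoint: "self_adjoint (a::'a::cstar_algebra) \<Longrightarrow> is_inv a b \<Longrightarrow> self_adjoint b"
  unfolding self_adjoint_def
  by (rule is_inv_unique[of a]) (auto simp: is_inv_def, (metis cstar_1 cstar_mult)+)

lemma is_inv_commute: "is_inv a b \<Longrightarrow> c * a = a * c \<Longrightarrow> c * b = b * c"
  unfolding is_inv_def by (metis mult.assoc mult_1_left mult_1_right)

lemma inverse_sqrt:
  assumes c: "self_adjoint (c::'a::cstar_algebra)" and M: "M > 0" "norm (1 - (1 / M) *\<^sub>R c) < 1"
  obtains r w where "self_adjoint r" "is_inv r w" "r * c * r = 1" "\<And>x. x * c = c * x \<Longrightarrow> x * r = r * x"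
proof -
  define d where "d = 1 - (1 / M) *\<^sub>R c"
  have d: "self_adjoint d" "norm d < 1"
    using c M by (auto simp: d_def intro!: self_adjoint_diff self_adjoint_scaleR)
  obtain s where s: "self_adjoint s" "norm s < 1" "(1 - s) * (1 - s) = 1 - d"
    "\<And>c. c * d = d * c \<Longrightarrow> c * s = s * c"
    using self_adjoint_sqrt[OF d, of UNIV] by auto
  obtain b where b: "is_inv (1 - s) b" using neumann s by blast
  have sab: "self_adjoint b"
    using is_inv_self_adjoint[OF _ b] s by (simp add: self_adjoint_diff)
  define r where "r = (1 / sqrt M) *\<^sub>R b"
  have cc: "c = M *\<^sub>R ((1 - s) * (1 - s))" using M by (simp add: s d_def)
  show ?thesis
  proof (rule that[of r "sqrt M *\<^sub>R (1 - s)"])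
    show "self_adjoint r" using sab by (simp add: r_def self_adjoint_scaleR)
    show "is_inv r (sqrt M *\<^sub>R (1 - s))" using b M by (simp add: is_inv_def r_def)
    have "b * ((1 - s) * (1 - s)) * b = (b * (1 - s)) * ((1 - s) * b)" by (simp only: mult.assoc)
    also have "\<dots> = 1" using b by (simp add: is_inv_def)
    finally show "r * c * r = 1" using M unfolding cc r_def by simp
    fix x assume "x * c = c * x"
    then have "x * d = d * x" by (simp add: d_def algebra_simps)
    then have "x * (1 - s) = (1 - s) * x" using s(4) by (simp add: algebra_simps)
    then have "x * b = b * x" by (rule is_inv_commute[OF b])
    then show "x * r = r * x" by (simp add: r_def)
  qed
qed

text \<open>If \<open>1 - s * s\<close> had a self-adjoint square root commuting with
  \<open>s\<close>, \<open>norm_le_of_sum_squares\<close> would bound that root by 1. Shrinking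
  \<open>s * s\<close> by a factor \<open>t < 1\<close> makes the root available.\<close>

lemma norm_one_minus_square:
  assumes s: "self_adjoint (s::'a::cstar_algebra)" "norm s \<le> 1"
  shows "norm (1 - s * s) \<le> 1"
proof (rule field_le_epsilon)
  fix e :: real assume "e > 0"
  define t where "t = 1 - min e (1/2)"
  have t: "0 < t" "t < 1" "1 - t \<le> e" using \<open>e > 0\<close> by (auto simp: t_def min_def)
  define d where "d = t *\<^sub>R (s * s)"
  have ns: "norm (s * s) \<le> 1" using norm_self_adjoint_square[OF s(1)] s(2) by (simp add: power_le_one)
  have "t * norm (s * s) < 1" using mult_left_mono[OF ns, of t] t by linarith
  then have "norm d < 1" using t by (simp add: d_def)
  moreover have "self_adjoint d" using s by (simp add: d_def self_adjoint_def cstar_scaleR cstar_mult)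
  ultimately obtain q where q: "self_adjoint q" "(1 - q) * (1 - q) = 1 - d"
    "\<And>c. c * d = d * c \<Longrightarrow> c * q = q * c"
    using self_adjoint_sqrt[of d UNIV] by auto
  have sq: "s * q = q * s" by (rule q(3)) (simp add: d_def mult.assoc)
  have "norm (1 - q) \<le> 1"
  proof (rule norm_le_of_sum_squares(2)[of "sqrt t *\<^sub>R s" _ 1])
    show "sqrt t *\<^sub>R s * (1 - q) = (1 - q) * sqrt t *\<^sub>R s" using sq by (simp add: algebra_simps)
    show "sqrt t *\<^sub>R s * sqrt t *\<^sub>R s + (1 - q) * (1 - q) = 1\<^sup>2 *\<^sub>R 1" using t unfolding q(2) by (simp add: d_def)
  qed (use s q in \<open>auto intro: self_adjoint_scaleR self_adjoint_diff\<close>)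
  then have "norm (1 - d) \<le> 1" using norm_mult_ineq[of "1 - q" "1 - q"] mult_le_one unfolding q(2)[symmetric]
    by (metis norm_ge_zero order_trans)
  moreover have "1 - s * s = (1 - d) - (1 - t) *\<^sub>R (s * s)" by (simp add: d_def algebra_simps)
  then have "norm (1 - s * s) \<le> norm (1 - d) + norm ((1 - t) *\<^sub>R (s * s))"
    by (simp only: norm_triangle_ineq4)
  then have "norm (1 - s * s) \<le> norm (1 - d) + (1 - t) * norm (s * s)" using t by simp
  moreover have "(1 - t) * norm (s * s) \<le> 1 - t" using ns t mult_left_le[of "norm (s * s)" "1 - t"] by simp
  ultimately have "norm (1 - s * s) \<le> 1 + (1 - t)" by linarith
  then show "norm (1 - s * s) \<le> 1 + e" using t by linarith
qed

text \<open>After scaling, each \<open>1 - x * x\<close> has norm at most 1, so three of them add up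
  to norm at most 3. By hypothesis their sum is \<open>3 + (1 / N\<^sup>2) *\<^sub>R e\<close>,
  which multiplies a nonzero \<open>e\<close> by more than 3.\<close>

lemma proj_plus_squares_eq_0:
  assumes e: "is_proj (e::'a::cstar_algebra)" and sa: "self_adjoint a" "self_adjoint b" "self_adjoint c"
    and sum: "e + a * a + b * b + c * c = 0"
  shows "e = 0"
proof (rule ccontr)
  assume "e \<noteq> 0"
  then have ne: "norm e = 1" and ee: "e * e = e" using e norm_proj by (auto simp: is_proj_def)
  define N where "N = norm a + norm b + norm c + 1"
  have N: "N > 0" by (simp add: N_def add_nonneg_pos)
  have nN: "norm a \<le> N" "norm b \<le> N" "norm c \<le> N" by (simp_all add: N_def)
  have *: "norm (1 - (1 / N\<^sup>2) *\<^sub>R (x * x)) \<le> 1" if "self_adjoint x" "norm x \<le> N" for x :: 'a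
    using norm_one_minus_square[of "(1 / N) *\<^sub>R x"] that N
    by (simp add: self_adjoint_scaleR power2_eq_square field_simps)
  have "norm (1 - (1 / N\<^sup>2) *\<^sub>R (a * a)) \<le> 1" "norm (1 - (1 / N\<^sup>2) *\<^sub>R (b * b)) \<le> 1"
    "norm (1 - (1 / N\<^sup>2) *\<^sub>R (c * c)) \<le> 1"
    using sa *[OF _ nN(1)] *[OF _ nN(2)] *[OF _ nN(3)] by blast+
  moreover have "norm (x + y + z) \<le> norm x + norm y + norm z" for x y z :: 'a
    using norm_triangle_ineq[of "x + y" z] norm_triangle_ineq[of x y] by linarith
  ultimately have "norm ((1 - (1 / N\<^sup>2) *\<^sub>R (a * a)) + (1 - (1 / N\<^sup>2) *\<^sub>R (b * b)) + (1 - (1 / N\<^sup>2) *\<^sub>R (c * c))) \<le> 3"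
    by (smt (verit))
  also have "(1 - (1 / N\<^sup>2) *\<^sub>R (a * a)) + (1 - (1 / N\<^sup>2) *\<^sub>R (b * b)) + (1 - (1 / N\<^sup>2) *\<^sub>R (c * c))
      = 3 - (1 / N\<^sup>2) *\<^sub>R (a * a + b * b + c * c)" by (simp add: algebra_simps)
  also have "a * a + b * b + c * c = - e" using sum by (simp add: eq_neg_iff_add_eq_0 algebra_simps)
  finally have 1: "norm (3 + (1 / N\<^sup>2) *\<^sub>R e) \<le> 3" by simp
  have "(3 + (1 / N\<^sup>2) *\<^sub>R e) * e = (3 + 1 / N\<^sup>2) *\<^sub>R e"
  proof -
    have "3 * e = 3 *\<^sub>R e" by (simp add: scaleR_conv_of_real)
    then show ?thesis using ee by (simp add: distrib_right scaleR_add_left)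
  qed
  then have "3 + 1 / N\<^sup>2 \<le> norm (3 + (1 / N\<^sup>2) *\<^sub>R e)"
    using norm_mult_ineq[of "3 + (1 / N\<^sup>2) *\<^sub>R e" e] ne by simp
  with 1 have "1 / N\<^sup>2 \<le> 0" by linarith
  with N show False by (simp add: field_simps)
qed

text \<open>A negative spectral value of an approximant of \<open>cstar x * x\<close> would yield $w$ with
$w^* w = -e$ for a nonzero projection $e$; then $-w w^*$ is a projection as well, although
$w^* w + w w^*$ is a sum of squares.\<close>

lemma approx_cstar_mult_nonneg:
  assumes SE: "spectral_system S E" and ap: "norm (cstar x * x - fcalc S E (\<lambda>s. s)) < \<epsilon>"
    and "m \<in> S"
  shows "- \<epsilon> \<le> m"
proof (rule ccontr)
  assume "\<not> - \<epsilon> \<le> m"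
  moreover have "\<epsilon> > 0" using ap norm_ge_zero le_less_trans by blast
  ultimately have l: "m < 0" "\<epsilon> < \<bar>m\<bar>" by auto
  define e where "e = E m"
  have e: "is_proj e" "e \<noteq> 0" using SE assms(3) by (auto simp: e_def spectral_system_def)
  have ee: "e * e = e" "cstar e = e" using e by (auto simp: is_proj_def)
  define a where "a = cstar x * x"
  have "e * fcalc S E (\<lambda>s. s) * e = m *\<^sub>R e"
    using E_mult_fcalc[OF SE assms(3), of "\<lambda>s. s"] ee by (simp add: e_def)
  then have "e * (a - fcalc S E (\<lambda>s. s)) * e = e * a * e - m *\<^sub>R e" by (simp add: algebra_simps)
  moreover have "norm (e * (a - fcalc S E (\<lambda>s. s)) * e) \<le> 1 * norm (a - fcalc S E (\<lambda>s. s)) * 1"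
    using norm_proj_le[OF e(1)]
    by (intro order_trans[OF norm_mult_ineq] mult_mono order_trans[OF norm_mult_ineq]) auto
  ultimately have n: "norm (e * a * e - m *\<^sub>R e) < \<epsilon>" using ap by (simp add: a_def)
  \<comment> \<open>\<open>e * a * e = m *\<^sub>R (e - d)\<close> with \<open>d\<close> small: in
    the corner of \<open>e\<close> the compression is a negative multiple of an element with a
    square root.\<close>
  define d where "d = e - (1 / m) *\<^sub>R (e * a * e)"
  have "d = - (1 / m) *\<^sub>R (e * a * e - m *\<^sub>R e)" using l by (simp add: d_def algebra_simps)
  then have "norm d = norm (e * a * e - m *\<^sub>R e) / \<bar>m\<bar>" by simp
  also have "\<dots> < 1" using n l by (subst pos_divide_less_eq) auto
  finally have nd: "norm d < 1" .
  have sad: "self_adjoint d"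
    using ee by (simp add: d_def a_def self_adjoint_def cstar_diff cstar_scaleR cstar_mult cstar_cstar mult.assoc)
  have ed: "e * d = d" "d * e = d" unfolding d_def
    by (simp_all add: algebra_simps ee mult_eq_assoc[OF ee(1)])
  \<comment> \<open>Taking the root inside the corner of \<open>e\<close> makes it commute with
    \<open>e\<close>.\<close>
  let ?K = "{s. e * s = s} \<inter> {s. s * e = s}"
  have cl: "closed ?K" by (intro closed_Int closed_Collect_eq continuous_intros)
  have step: "(1/2) *\<^sub>R (d + s * s) \<in> ?K" if "s \<in> ?K" for s
    using that ed by (auto simp: distrib_left distrib_right mult.assoc) (metis mult.assoc)
  have "0 \<in> ?K" by simp
  then obtain s where "self_adjoint s" "s \<in> ?K" "norm s < 1" "(1 - s) * (1 - s) = 1 - d"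
    by (rule self_adjoint_sqrt[OF sad nd cl _ step])
  then have s: "self_adjoint s" "e * s = s" "s * e = s" "norm s < 1" "(1 - s) * (1 - s) = 1 - d" by auto
  obtain b where b: "is_inv (1 - s) b" using neumann s by blast
  have sab: "cstar b = b"
    using is_inv_self_adjoint[OF _ b] s by (simp add: self_adjoint_diff self_adjoint_def[of b])
  have eb: "e * b = b * e" by (rule is_inv_commute[OF b]) (simp add: algebra_simps s)
  \<comment> \<open>The normalization by \<open>b\<close>, the inverse of \<open>1 - s\<close>, and
    by \<open>sqrt \<bar>m\<bar>\<close> turns the compression into exactly
    \<open>- e\<close>.\<close>
  define w where "w = (1 / sqrt \<bar>m\<bar>) *\<^sub>R (x * e * b)"
  have "cstar w * w = (1 / \<bar>m\<bar>) *\<^sub>R (b * (e * a * e) * b)"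
    unfolding w_def a_def by (simp add: cstar_scaleR cstar_mult ee sab mult.assoc)
  also have "(e * a * e) = m *\<^sub>R (e - d)" using l by (simp add: d_def)
  also have "e - d = (1 - s) * e * (1 - s)"
  proof -
    have "(1 - s) * e = e * (1 - s)" by (simp add: algebra_simps s)
    then have "(1 - s) * e * (1 - s) = e * ((1 - s) * (1 - s))" by (simp add: mult.assoc)
    then show ?thesis unfolding s(5) using ed by (simp add: algebra_simps)
  qed
  also have "(1 / \<bar>m\<bar>) *\<^sub>R (b * (m *\<^sub>R ((1 - s) * e * (1 - s))) * b) = - ((b * (1 - s)) * e * ((1 - s) * b))"
    using l by (simp add: mult.assoc)
  finally have ww: "cstar w * w = - e" using b by (simp add: is_inv_def)
  have "x * e * b * e = x * e * b" using eb ee by (metis mult.assoc)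
  then have we: "w * e = w" by (simp add: w_def)
  define f where "f = - (w * cstar w)"
  have "w * (cstar w * w) * cstar w = - (w * cstar w)" unfolding ww by (simp add: we)
  then have ff: "f * f = f" by (simp add: f_def mult.assoc)
  have saf: "self_adjoint f" by (simp add: f_def self_adjoint_def cstar_minus cstar_mult cstar_cstar)
  \<comment> \<open>Twice the real and imaginary part of \<open>w\<close>: their squares add up to
    twice \<open>cstar w * w + w * cstar w\<close>, that is to \<open>- 2 *\<^sub>R (e + f)\<close>.
    As \<open>f = f * f\<close>, this is a vanishing sum of a projection and three squares.\<close>
  define h k where "h = w + cstar w" and "k = scaleC (- \<i>) (w - cstar w)"
  have "self_adjoint h" by (simp add: h_def self_adjoint_def cstar_add cstar_cstar add.commute)
  moreover have "self_adjoint k"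
    by (simp add: k_def self_adjoint_def cstar_scaleC cstar_diff cstar_cstar scaleC_minus_left scaleC_diff_right)
  moreover have "h * h + k * k = 2 *\<^sub>R (cstar w * w + w * cstar w)"
    unfolding h_def k_def
    by (simp add: algebra_simps mult_scaleC_left mult_scaleC_right scaleC_scaleC scaleC_minus_left scaleC_one
       scaleC_diff_right scaleC_add_right scaleR_2)
  then have "h * h + k * k = - 2 *\<^sub>R (e + f)" by (simp add: ww f_def algebra_simps)
  then have "e + f * f + ((1 / sqrt 2) *\<^sub>R h) * ((1 / sqrt 2) *\<^sub>R h) + ((1 / sqrt 2) *\<^sub>R k) * ((1 / sqrt 2) *\<^sub>R k) = 0"
    by (simp add: ff add.assoc flip: scaleR_add_right)
  ultimately have "e = 0"
    using proj_plus_squares_eq_0[OF e(1) saf] self_adjoint_scaleR by blast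
  with e show False by simp
qed

text \<open>Positivity of \<open>cstar x * x\<close> in norm form. The spectral values of an
  approximant lie between \<open>- e / 2\<close> and \<open>M + e / 2\<close>, so those of
  \<open>M\<close> minus the approximant are at most \<open>M + e / 2\<close> in modulus.\<close>

lemma norm_cstar_mult_le:
  assumes rr: "real_rank_zero TYPE('a::cstar_algebra)" and M: "(norm (x::'a))\<^sup>2 \<le> M"
  shows "norm (M *\<^sub>R 1 - cstar x * x) \<le> M"
proof (rule field_le_epsilon)
  fix e :: real assume e: "e > 0"
  obtain S E where SE: "spectral_system S E" "norm (cstar x * x - fcalc S E (\<lambda>s. s)) < e / 2"
    using real_rank_zero_approx[OF rr self_adjoint_cstar_mult(1), of "e/2" x] e by auto
  have "norm (fcalc S E (\<lambda>s. s)) \<le> norm (cstar x * x) + e / 2"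
    using SE(2) norm_triangle_ineq2[of "fcalc S E (\<lambda>s. s)" "cstar x * x"] by (simp add: norm_minus_commute)
  then have n: "norm (fcalc S E (\<lambda>s. s)) \<le> M + e / 2" using M by (simp add: cstar_identity)
  have "norm (fcalc S E (\<lambda>s. M - s)) \<le> M + e / 2"
  proof (rule norm_fcalc_le[OF SE(1)])
    fix s assume s: "s \<in> S"
    have "- (e / 2) \<le> s" by (rule approx_cstar_mult_nonneg[OF SE s])
    moreover have "\<bar>s\<bar> \<le> M + e / 2" using norm_fcalc_ge[OF SE(1) s, of "\<lambda>s. s"] n by simp
    moreover have "M \<ge> 0" using M by (meson order_trans zero_le_power2)
    ultimately show "\<bar>M - s\<bar> \<le> M + e / 2" by linarith
  qed (use n norm_ge_zero order_trans in blast)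
  moreover have "fcalc S E (\<lambda>s. M - s) = M *\<^sub>R 1 - fcalc S E (\<lambda>s. s)"
    by (simp only: fcalc_diff[OF SE(1)] fcalc_const[OF SE(1)])
  then have "M *\<^sub>R 1 - cstar x * x = fcalc S E (\<lambda>s. M - s) - (cstar x * x - fcalc S E (\<lambda>s. s))" by simp
  then have "norm (M *\<^sub>R 1 - cstar x * x) \<le> norm (fcalc S E (\<lambda>s. M - s)) + norm (cstar x * x - fcalc S E (\<lambda>s. s))"
    by (metis norm_triangle_ineq4)
  ultimately show "norm (M *\<^sub>R 1 - cstar x * x) \<le> M + e" using SE(2) by simp
qed

text \<open>Dividing by \<open>M + 1\<close> brings \<open>1 + cstar x * x\<close> within
  \<open>M / (M + 1) < 1\<close> of 1, where the square root exists.\<close>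

lemma inverse_sqrt_one_plus:
  assumes rr: "real_rank_zero TYPE('a::cstar_algebra)"
  obtains r w where "self_adjoint r" "is_inv r w" "r * (1 + cstar x * x) * r = (1::'a)"
    "\<And>y. y * (cstar x * x) = (cstar x * x) * y \<Longrightarrow> y * r = r * y"
proof -
  define M where "M = (norm x)\<^sup>2"
  have M: "M \<ge> 0" by (simp add: M_def)
  let ?c = "1 + cstar x * x"
  have c: "self_adjoint ?c" by (intro self_adjoint_add self_adjoint_cstar_mult) simp
  have eq: "1 - (1 / (M + 1)) *\<^sub>R ?c = (1 / (M + 1)) *\<^sub>R (M *\<^sub>R 1 - cstar x * x)"
  proof -
    have "(1::'a) = (1 / (M + 1)) *\<^sub>R ((M + 1) *\<^sub>R 1)" using M by simp
    then have "1 - (1 / (M + 1)) *\<^sub>R ?c = (1 / (M + 1)) *\<^sub>R ((M + 1) *\<^sub>R 1 - ?c)"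
      by (metis scaleR_diff_right)
    then show ?thesis by (simp add: algebra_simps)
  qed
  have "norm (M *\<^sub>R 1 - cstar x * x) \<le> M" by (rule norm_cstar_mult_le[OF rr]) (simp add: M_def)
  then have "norm (1 - (1 / (M + 1)) *\<^sub>R ?c) < 1" unfolding eq using M by (simp add: divide_less_eq)
  then obtain r w where r: "self_adjoint r" "is_inv r w" "r * ?c * r = 1" "\<And>x. x * ?c = ?c * x \<Longrightarrow> x * r = r * x"
    using inverse_sqrt[OF c, of "M + 1"] M by auto
  show ?thesis by (rule that[OF r(1-3)]) (rule r(4), simp add: algebra_simps)
qed

text \<open>For a finite spectral sum \<open>b'\<close> the spectral projection of the values from
  1/2 upwards solves the problem exactly, with multipliers \<open>y\<close> and \<open>z\<close> of
  norm at most 2. Since \<open>b\<close> is within 1/4 of \<open>b'\<close>, the element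
  \<open>t\<close> below is within 1 of the identity, and conjugation by it repairs the
  error.\<close>

lemma self_adjoint_exchange:
  assumes rr: "real_rank_zero TYPE('a::cstar_algebra)" and b: "self_adjoint (b::'a)"
  obtains h y z where "idem h" "h = b * y" "1 - h = (1 - b) * z"
proof -
  obtain S E where SE: "spectral_system S E" "norm (b - fcalc S E (\<lambda>s. s)) < 1/4"
    using real_rank_zero_approx[OF rr b, of "1/4"] by auto
  note fm = fcalc_mult[OF SE(1)]
  define b' where "b' = fcalc S E (\<lambda>s. s)"
  define e where "e = fcalc S E (\<lambda>s. if s \<ge> 1/2 then 1 else 0)"
  define y where "y = fcalc S E (\<lambda>s. if s \<ge> 1/2 then 1 / s else 0)"
  define z where "z = fcalc S E (\<lambda>s. if s \<ge> 1/2 then 0 else 1 / (1 - s))"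
  have one: "1 - fcalc S E g = fcalc S E (\<lambda>s. 1 - g s)" for g
    by (simp add: fcalc_diff[OF SE(1)] fcalc_const[OF SE(1)])
  have ee: "e * e = e" unfolding e_def fm by (intro fcalc_cong[OF SE(1)]) auto
  have ye: "y * e = y" "z * e = 0"
    unfolding e_def y_def z_def fm
    using fcalc_const[OF SE(1), of 0] by (auto intro!: fcalc_cong[OF SE(1)] simp: if_distrib cong: if_cong)
  have by': "b' * y = e" "(1 - b') * z = 1 - e"
    unfolding e_def y_def z_def b'_def fm one by (auto intro!: fcalc_cong[OF SE(1)])
  have ny: "norm y \<le> 2" "norm z \<le> 2"
    unfolding y_def z_def by (auto intro!: norm_fcalc_le[OF SE(1)] simp: field_simps)
  define t where "t = b * y + (1 - b) * z"
  have "t - 1 = (b - b') * y - (b - b') * z"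
    using by' by (simp add: t_def algebra_simps)
  then have "norm (t - 1) \<le> norm ((b - b') * y) + norm ((b - b') * z)"
    by (simp only: norm_triangle_ineq4)
  also have "\<dots> \<le> norm (b - b') * norm y + norm (b - b') * norm z"
    by (intro add_mono norm_mult_ineq)
  also have "\<dots> \<le> norm (b - b') * 2 + norm (b - b') * 2"
    using ny by (intro add_mono mult_left_mono) auto
  also have "\<dots> < 1" using SE(2) by (simp add: b'_def)
  finally obtain w where w: "is_inv t w" using neumann' by blast
  have te: "t * e = b * y" using ye by (simp add: t_def distrib_right mult.assoc)
  then have te': "t * (1 - e) = (1 - b) * z" by (simp add: t_def algebra_simps)
  show ?thesis
  proof (rule that[of "t * e * w" "y * w" "z * w"])
    have "t * e * w * (t * e * w) = t * e * (w * t) * e * w" by (simp only: mult.assoc)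
    also have "\<dots> = t * e * w" using w ee by (simp add: is_inv_def mult.assoc mult_eq_assoc[OF ee])
    finally show "idem (t * e * w)" by (simp add: idem_def)
    show "t * e * w = b * (y * w)" by (simp add: te mult.assoc)
    have "1 - t * e * w = t * (1 - e) * w" using w by (simp add: is_inv_def algebra_simps)
    then show "1 - t * e * w = (1 - b) * (z * w)" by (simp add: te' mult.assoc)
  qed
qed

text \<open>\<open>a * cstar a + (1 - a) * cstar (1 - a)\<close> is half of
  \<open>1 + cstar v * v\<close>, hence invertible. Normalizing it to 1 by \<open>r\<close> makes
  the two summands into a self-adjoint \<open>b\<close> and \<open>1 - b\<close>; an exchange
  idempotent for \<open>b\<close>, conjugated by \<open>w\<close>, serves \<open>a\<close>.\<close>

theorem exchange_ring_of_real_rank_zero: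
  assumes rr: "real_rank_zero TYPE('a::cstar_algebra)"
  shows "exchange_ring TYPE('a)"
  unfolding exchange_ring_def
proof
  fix a :: 'a
  define v where "v = cstar (2 *\<^sub>R a - 1)"
  obtain r w where r: "self_adjoint r" "is_inv r w" "r * (1 + cstar v * v) * r = 1"
    using inverse_sqrt_one_plus[OF rr, of v] by metis
  define b where "b = 2 *\<^sub>R (r * a * cstar a * r)"
  have cr: "cstar r = r" using r by (simp add: self_adjoint_def)
  have "self_adjoint b"
    by (simp add: b_def self_adjoint_def cstar_scaleR cstar_mult cstar_cstar cr mult.assoc)
  then obtain h y z where h: "idem h" "h = b * y" "1 - h = (1 - b) * z"
    using self_adjoint_exchange[OF rr] by blast
  have "1 + cstar v * v = 2 *\<^sub>R (a * cstar a + (1 - a) * cstar (1 - a))"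
    unfolding v_def by (simp add: cstar_cstar cstar_diff cstar_add algebra_simps scaleR_2)
  then have "b + 2 *\<^sub>R (r * (1 - a) * cstar (1 - a) * r) = r * (1 + cstar v * v) * r"
    unfolding b_def by (simp add: distrib_left distrib_right mult.assoc scaleR_add_right)
  then have b1: "1 - b = 2 *\<^sub>R (r * (1 - a) * cstar (1 - a) * r)"
    unfolding r(3) by (simp only: eq_diff_eq diff_eq_eq add.commute)
  have wr: "w * r = 1" "r * w = 1" using r(2) by (auto simp: is_inv_def)
  show "\<exists>h s t. idem h \<and> h = a * s \<and> 1 - h = (1 - a) * t"
  proof (intro exI conjI)
    have "w * h * r * (w * h * r) = w * h * (r * w) * h * r" by (simp only: mult.assoc)
    also have "\<dots> = w * h * r" using wr h(1) by (simp add: idem_def mult.assoc mult_eq_assoc[of h h h])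
    finally show "idem (w * h * r)" by (simp add: idem_def)
    have "w * h * r = (w * r) * a * (2 *\<^sub>R (cstar a * r * y * r))"
      unfolding h(2) b_def by (simp add: mult.assoc)
    then show "w * h * r = a * (2 *\<^sub>R (cstar a * r * y * r))" using wr by simp
    have "1 - w * h * r = w * (1 - h) * r" using wr by (simp add: algebra_simps)
    also have "\<dots> = (w * r) * (1 - a) * (2 *\<^sub>R (cstar (1 - a) * r * z * r))"
      unfolding h(3) b1 by (simp add: mult.assoc)
    finally show "1 - w * h * r = (1 - a) * (2 *\<^sub>R (cstar (1 - a) * r * z * r))" using wr by simp
  qed
qed

section \<open>From idempotents to projections\<close>

lemma inverse_one_plus:
  assumes rr: "real_rank_zero TYPE('a::cstar_algebra)"
  obtains k where "is_inv (1 + cstar x * x) (k::'a)"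
proof -
  obtain r w where r: "is_inv r w" "r * (1 + cstar x * x) * r = 1"
    using inverse_sqrt_one_plus[OF rr, of x] by metis
  have "w * (r * (1 + cstar x * x) * r) * w = (w * r) * (1 + cstar x * x) * (r * w)"
    by (simp only: mult.assoc)
  then have "1 + cstar x * x = w * w" using r by (simp add: is_inv_def)
  then have "is_inv (1 + cstar x * x) (r * r)"
    using r(1) is_inv_mult[of w r w r] by (simp add: is_inv_def)
  then show ?thesis by (rule that)
qed

text \<open>Kaplansky's denominator \<open>z\<close>: it commutes with \<open>h\<close> and
  \<open>cstar h\<close>, and \<open>h * z = h * cstar h * h\<close>. Having the form
  \<open>1 + cstar x * x\<close> it is invertible, and it depends continuously on
  \<open>h\<close>.\<close>

definition range_proj_den :: "'a::cstar_algebra \<Rightarrow> 'a" where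
  "range_proj_den h = 1 + cstar (cstar h - h) * (cstar h - h)"

text \<open>The orthogonal projection with the same range as the idempotent \<open>h\<close>.\<close>

definition range_proj :: "'a::cstar_algebra \<Rightarrow> 'a" where
  "range_proj h = h * cstar h * (SOME k. is_inv (range_proj_den h) k)"

lemma is_inv_range_proj_den:
  assumes "real_rank_zero TYPE('a::cstar_algebra)"
  shows "is_inv (range_proj_den h) (SOME k. is_inv (range_proj_den (h::'a)) k)"
  unfolding range_proj_den_def
  by (rule someI_ex) (metis inverse_one_plus[OF assms])

lemma range_proj:
  assumes rr: "real_rank_zero TYPE('a::cstar_algebra)" and h: "idem (h::'a)"
  shows "is_proj (range_proj h)" "h * range_proj h = range_proj h" "range_proj h * h = h"
proof -
  define z k where "z = range_proj_den h" and "k = (SOME k. is_inv (range_proj_den h) k)"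
  have zk: "is_inv z k" unfolding z_def k_def by (rule is_inv_range_proj_den[OF rr])
  have p: "range_proj h = h * cstar h * k" by (simp add: range_proj_def k_def)
  have hh: "h * h = h" using h by (simp add: idem_def)
  have ch: "cstar h * cstar h = cstar h" using hh by (metis cstar_mult)
  have hz: "h * z = h * cstar h * h" "z * h = h * cstar h * h"
    unfolding z_def range_proj_den_def
    by (simp_all add: cstar_diff cstar_cstar algebra_simps hh ch mult_eq_assoc[OF hh] mult_eq_assoc[OF ch])
  have sz: "cstar z = z"
    unfolding z_def range_proj_den_def by (simp add: cstar_add cstar_mult cstar_cstar)
  have sk: "cstar k = k"
    using is_inv_self_adjoint[OF _ zk] sz by (simp add: self_adjoint_def)
  have "h * z = z * h" using hz by simp
  moreover from this have "cstar h * z = z * cstar h" by (metis cstar_mult sz)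
  ultimately have hk: "h * k = k * h" and chk: "cstar h * k = k * cstar h"
    using is_inv_commute[OF zk] by blast+
  have "cstar (range_proj h) = range_proj h"
  proof -
    have "k * (h * cstar h) = (h * k) * cstar h" by (simp only: hk mult.assoc)
    also have "\<dots> = h * cstar h * k" by (simp only: chk mult.assoc)
    finally show ?thesis unfolding p by (simp add: cstar_mult cstar_cstar sk mult.assoc)
  qed
  moreover have "range_proj h * range_proj h = range_proj h"
  proof -
    have "range_proj h * range_proj h = (h * cstar h * h) * cstar h * k * k"
    proof -
      have "k * (h * (cstar h * k)) = h * (cstar h * (k * k))"
        by (metis hk chk mult.assoc)
      then show ?thesis unfolding p
        by (simp add: mult.assoc)
    qed
    also have "\<dots> = h * z * cstar h * k * k" using hz by simp
    also have "\<dots> = h * cstar h * (z * k) * k"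
      using \<open>cstar h * z = z * cstar h\<close> by (metis mult.assoc)
    finally show ?thesis using zk by (simp add: p is_inv_def)
  qed
  ultimately show "is_proj (range_proj h)" by (simp add: is_proj_def)
  show "h * range_proj h = range_proj h" unfolding p by (simp add: mult.assoc mult_eq_assoc[OF hh])
  have "range_proj h * h = (h * cstar h * h) * k" unfolding p by (metis hk mult.assoc)
  also have "\<dots> = h * (z * k)" unfolding hz(1)[symmetric] by (simp only: mult.assoc)
  finally show "range_proj h * h = h" using zk by (simp add: is_inv_def)
qed

lemma range_proj_of_proj:
  assumes rr: "real_rank_zero TYPE('a::cstar_algebra)" and h: "is_proj (h::'a)"
  shows "range_proj h = h"
proof -
  have "range_proj_den h = 1" using h by (simp add: range_proj_den_def is_proj_def)
  then have "(SOME k. is_inv (range_proj_den h) k) = 1"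
    using is_inv_range_proj_den[OF rr, of h] by (simp add: is_inv_def)
  then show ?thesis using h by (simp add: range_proj_def is_proj_def)
qed

lemma continuous_on_range_proj:
  assumes rr: "real_rank_zero TYPE('a::cstar_algebra)"
  shows "continuous_on S (range_proj :: 'a \<Rightarrow> 'a)"
proof -
  have "continuous_on S (\<lambda>h::'a. SOME k. is_inv (range_proj_den h) k)"
    by (rule continuous_on_inverse_algebra[where g = range_proj_den])
       (auto simp: range_proj_den_def intro!: continuous_intros is_inv_range_proj_den[OF rr, unfolded range_proj_den_def])
  then show ?thesis unfolding range_proj_def by (intro continuous_intros)
qed

lemma is_proj_idem: "is_proj p \<Longrightarrow> idem p"
  by (simp add: is_proj_def idem_def)

lemma proj_homotopic_iff_path_component: "proj_homotopic p q \<longleftrightarrow> path_component {h. is_proj h} p q"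
  unfolding proj_homotopic_def path_component_def path_def path_image_def pathstart_def pathfinish_def
  by (auto simp: image_subset_iff)

text \<open>\<open>range_proj\<close> is continuous and fixes projections, so it retracts the path
  without moving its ends.\<close>

lemma path_component_idem_imp_proj_homotopic:
  assumes rr: "real_rank_zero TYPE('a::cstar_algebra)"
    and pq: "is_proj (p::'a)" "is_proj q" "path_component {h. idem h} p q"
  shows "proj_homotopic p q"
proof -
  obtain g where g: "path g" "path_image g \<subseteq> {h. idem h}" "pathstart g = p" "pathfinish g = q"
    using pq by (auto simp: path_component_def)
  have "path (range_proj \<circ> g)"
    using g(1) continuous_on_range_proj[OF rr] by (rule path_continuous_image)
  moreover have "path_image (range_proj \<circ> g) \<subseteq> {h. is_proj h}"
    using g(2) range_proj[OF rr] by (auto simp: path_image_def)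
  moreover have "pathstart (range_proj \<circ> g) = p" "pathfinish (range_proj \<circ> g) = q"
    using g pq range_proj_of_proj[OF rr] by (simp_all add: pathstart_compose pathfinish_compose)
  ultimately show ?thesis
    unfolding proj_homotopic_iff_path_component path_component_def by blast
qed

text \<open>For perspective \<open>a\<close>, \<open>b\<close> the difference \<open>d\<close>
  satisfies \<open>d * d = 0\<close> and \<open>a * d + d * a = d\<close>, so the whole segment
  consists of idempotents.\<close>

lemma persp_imp_path_component:
  assumes "persp a (b::'a::real_normed_algebra_1)"
  shows "path_component {h. idem h} a b"
  unfolding path_component_def
proof (intro exI conjI)
  show "path_image (linepath a b) \<subseteq> {h. idem h}"
  proof (clarsimp simp: path_image_def linepath_def idem_def)
    fix t :: real
    define d where "d = b - a"
    have "(1 - t) *\<^sub>R a + t *\<^sub>R b = a + t *\<^sub>R d" by (simp add: d_def algebra_simps)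
    moreover have "a * a = a" "d * d = 0" "a * d + d * a = d"
      using assms unfolding persp_def idem_def d_def by (auto simp: algebra_simps)
    then have "(a + t *\<^sub>R d) * (a + t *\<^sub>R d) = a + t *\<^sub>R d"
      by (simp add: distrib_left distrib_right add.assoc) (simp flip: scaleR_add_right add: add.commute)
    ultimately show "((1 - t) *\<^sub>R a + t *\<^sub>R b) * ((1 - t) *\<^sub>R a + t *\<^sub>R b) = (1 - t) *\<^sub>R a + t *\<^sub>R b"
      by simp
  qed
qed simp_all

lemma persp_rtranclp_imp_path_component:
  assumes "persp\<^sup>*\<^sup>* a (b::'a::real_normed_algebra_1)" "idem a"
  shows "path_component {h. idem h} a b"
  using assms
  by (induction rule: rtranclp_induct) (auto intro: path_component_refl path_component_trans persp_imp_path_component)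

text \<open>The partial isometry is the polar part of \<open>x\<close>: \<open>v\<close> is
  \<open>x\<close> times the inverse root of \<open>cstar x * x\<close> in the corner of
  \<open>a\<close>, where \<open>y\<close> witnesses that this element is bounded below.\<close>

lemma alg_equiv_proj_polar:
  assumes rr: "real_rank_zero TYPE('a::cstar_algebra)"
    and ab: "is_proj (a::'a)" "is_proj b" "alg_equiv a b"
  obtains v where "cstar v * v = a" "v * cstar v = b" "b * v = v" "v * a = v"
proof -
  have ia: "idem a" "idem b" using ab is_proj_idem by auto
  have a: "a * a = a" "cstar a = a" "cstar b = b" using ab by (auto simp: is_proj_def)
  obtain y x where xy: "y * x = a" "x * y = b" "a * y = y" "y * b = y" "b * x = x" "x * a = x"
    using alg_equivE[OF ab(3) ia] by metis
  \<comment> \<open>\<open>N\<close> exceeds \<open>(norm y)\<^sup>2\<close>, so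
    \<open>1 - d\<close> has a root. This exhibits \<open>N *\<^sub>R (cstar x * x) - a\<close> as
    some \<open>cstar g * g\<close>.\<close>
  define N where "N = (norm y)\<^sup>2 + 1"
  have N: "N > 0" by (simp add: N_def add_nonneg_pos)
  define d where "d = (1 / N) *\<^sub>R (cstar y * y)"
  have "norm d < 1" using N by (simp add: d_def cstar_identity) (simp add: N_def)
  moreover have "self_adjoint d" unfolding d_def by (intro self_adjoint_scaleR self_adjoint_cstar_mult)
  ultimately obtain s where s: "self_adjoint s" "(1 - s) * (1 - s) = 1 - d"
    using self_adjoint_sqrt[of d UNIV] by auto
  define g where "g = (sqrt N) *\<^sub>R (1 - s) * x"
  have cs: "cstar (1 - s) = 1 - s" using s by (simp add: self_adjoint_def cstar_diff)
  have "cstar g * g = N *\<^sub>R (cstar x * ((1 - s) * (1 - s)) * x)"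
    using N by (simp add: g_def cstar_mult cstar_scaleR cs mult.assoc)
  also have "\<dots> = N *\<^sub>R (cstar x * x) - cstar x * (cstar y * y) * x"
    unfolding s(2) using N by (simp add: d_def algebra_simps)
  also have "cstar x * (cstar y * y) * x = cstar (y * x) * (y * x)"
    by (simp add: cstar_mult mult.assoc)
  also have "\<dots> = a" by (simp add: xy a)
  finally have gg: "cstar g * g = N *\<^sub>R (cstar x * x) - a" .
  obtain r w where r: "self_adjoint r" "is_inv r w" "r * (1 + cstar g * g) * r = 1"
    "\<And>y. y * (cstar g * g) = (cstar g * g) * y \<Longrightarrow> y * r = r * y"
    using inverse_sqrt_one_plus[OF rr, of g] by metis
  have cr: "cstar r = r" using r by (simp add: self_adjoint_def)
  have ax: "a * cstar x = cstar x" using xy(6) a by (metis cstar_mult)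
  have "a * (cstar g * g) = (cstar g * g) * a"
    unfolding gg by (simp add: algebra_simps a mult_eq_assoc[OF ax] ax xy)
  then have ar: "a * r = r * a" by (rule r(4))
  \<comment> \<open>\<open>c\<close> equals \<open>1 + cstar g * g\<close>; outside the corner of
    \<open>a\<close> it is the identity, so its inverse root \<open>r\<close> does nothing
    there.\<close>
  define c where "c = (1 - a) + N *\<^sub>R (cstar x * x)"
  have rcr: "r * c * r = 1" using r(3) unfolding gg c_def by (simp add: algebra_simps)
  have "r * (cstar g * g) = (cstar g * g) * r" using r(4)[of "cstar g * g"] by simp
  then have "r * c = c * r" unfolding gg c_def by (simp add: algebra_simps ar)
  then have rrc: "r * r * c = 1" using rcr by (metis mult.assoc)
  have ac': "c * (1 - a) = 1 - a" unfolding c_def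
    by (simp add: algebra_simps a xy)
  have "(1 - a) * (r * r) = (r * r) * (1 - a)"
    using ar by (simp add: algebra_simps) (metis ar mult.assoc)
  also have "\<dots> = (r * r) * c * (1 - a)" using ac' by (simp add: mult.assoc)
  finally have ra: "(1 - a) * (r * r) = 1 - a" using rrc by simp
  define v where "v = (sqrt N) *\<^sub>R (x * r)"
  have "cstar v * v = r * (N *\<^sub>R (cstar x * x)) * r"
    using N by (simp add: v_def cstar_scaleR cstar_mult cr mult.assoc)
  also have "N *\<^sub>R (cstar x * x) = c - (1 - a)" by (simp add: c_def)
  also have "r * (c - (1 - a)) * r = r * c * r - (1 - a) * (r * r)"
    by (simp add: algebra_simps ar) (metis ar mult.assoc)
  finally have vv: "cstar v * v = a" using rcr ra by simp
  have bv: "b * v = v" using xy by (simp add: v_def flip: mult.assoc)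
  have va: "v * a = v" using xy ar by (simp add: v_def mult.assoc) (metis mult.assoc)
  have cv: "cstar v * b = cstar v" using bv a by (metis cstar_mult)
  have "v * cstar v * x = x * (r * r) * (N *\<^sub>R (cstar x * x))"
    using N by (simp add: v_def cstar_scaleR cstar_mult cr mult.assoc)
  also have "N *\<^sub>R (cstar x * x) = c - (1 - a)" by (simp add: c_def)
  also have "x * (r * r) * (c - (1 - a)) = x * (r * r * c) - x * ((r * r) * (1 - a))"
    by (simp add: algebra_simps)
  also have "\<dots> = x - x * (1 - a)"
    using rrc ra \<open>(1 - a) * (r * r) = (r * r) * (1 - a)\<close> by simp
  finally have "v * cstar v * x = x" by (simp add: algebra_simps xy)
  then have "v * cstar v * b = b" using xy(2) by (metis mult.assoc)
  then have "v * cstar v = b" using cv by (simp add: mult.assoc)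
  then show ?thesis using that vv bv va by blast
qed

section \<open>Separative cancellation from matrices of size one and two\<close>

definition mat2 :: "'a::zero \<Rightarrow> 'a \<Rightarrow> 'a \<Rightarrow> 'a \<Rightarrow> nat \<Rightarrow> nat \<Rightarrow> 'a" where
  "mat2 x y z w = (\<lambda>i j. if i = 0 \<and> j = 0 then x else if i = 0 \<and> j = 1 then y
     else if i = 1 \<and> j = 0 then z else if i = 1 \<and> j = 1 then w else 0)"

lemma in_Mn_mat2: "in_Mn 2 (mat2 x y z w)"
  by (auto simp: in_Mn_def mat2_def)

lemma mmult_mat2:
  "mmult 2 (mat2 x y z w) (mat2 x' y' z' w')
     = mat2 (x * x' + y * z') (x * y' + y * w') (z * x' + w * z') (z * y' + w * w')"
  unfolding mmult_def mat2_def by (intro ext) (auto simp: numeral_2_eq_2)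

lemma madj_mat2: "madj (mat2 x y z w) = mat2 (cstar x) (cstar z) (cstar y) (cstar w)"
  unfolding madj_def mat2_def by (intro ext) auto

lemma madj_madj: "madj (madj V) = V"
  by (simp add: madj_def cstar_cstar)

lemma mvn_equiv_sym:
  assumes "mvn_equiv P Q" shows "mvn_equiv Q P"
proof -
  obtain N V where "in_Mn N V" "mmult N (madj V) V = P" "mmult N V (madj V) = Q"
    using assms by (auto simp: mvn_equiv_def)
  moreover from this have "in_Mn N (madj V)" by (auto simp: in_Mn_def madj_def)
  ultimately show ?thesis unfolding mvn_equiv_def by (metis madj_madj)
qed

lemma mmult_assoc: "mmult n (mmult n A B) C = mmult n A (mmult n B C)"
proof (intro ext)
  fix i j
  have "(\<Sum>k<n. (\<Sum>l<n. A i l * B l k) * C k j) = (\<Sum>k<n. \<Sum>l<n. A i l * B l k * C k j)"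
    by (simp add: sum_distrib_right)
  also have "\<dots> = (\<Sum>l<n. \<Sum>k<n. A i l * B l k * C k j)" by (rule sum.swap)
  also have "\<dots> = (\<Sum>l<n. A i l * (\<Sum>k<n. B l k * C k j))"
    by (simp add: sum_distrib_left mult.assoc)
  finally show "mmult n (mmult n A B) C i j = mmult n A (mmult n B C) i j" by (simp add: mmult_def)
qed

definition mat1 :: "'a::zero \<Rightarrow> nat \<Rightarrow> nat \<Rightarrow> 'a" where
  "mat1 x = mat2 x 0 0 0"

lemma mmult_mat1_entry: "mmult n A (mmult n (mat1 b) C) 0 0 = (if n = 0 then 0 else A 0 0 * b * C 0 0)"
proof (cases n)
  case (Suc m)
  have 1: "mmult n (mat1 b) C i j = (if i = 0 then b * C 0 j else 0)" for i j
    unfolding mmult_def mat1_def mat2_def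
    using Suc by (auto simp: lessThan_Suc_eq_insert_0 intro: sum.neutral)
  then have "mmult n A (mmult n (mat1 b) C) 0 0 = (\<Sum>k<n. if k = 0 then A 0 0 * b * C 0 0 else 0)"
    unfolding mmult_def[of n A] by (intro sum.cong) (auto simp: mult.assoc)
  with Suc show ?thesis by simp
qed (simp add: mmult_def)

lemma mvn_equiv_mat1_imp_alg_equiv:
  assumes eq: "mvn_equiv (mat1 a) (mat1 b)" and "is_proj a" "is_proj b"
  shows "alg_equiv a b"
proof -
  obtain N V where V: "mmult N (madj V) V = mat1 a" "mmult N V (madj V) = mat1 b"
    using eq by (auto simp: mvn_equiv_def)
  have ab: "a * a = a" "b * b = b" using assms by (auto simp: is_proj_def)
  have sq: "mmult N (mat1 x) (mat1 x) 0 0 = (if N = 0 then 0 else x * x)" for x :: 'a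
    unfolding mmult_def mat1_def mat2_def
    by (cases N) (auto simp: lessThan_Suc_eq_insert_0 intro: sum.neutral)
  have "mmult N (madj V) (mmult N (mat1 b) V) = mmult N (mat1 a) (mat1 a)"
    unfolding V[symmetric] by (simp only: mmult_assoc)
  then have 1: "(if N = 0 then 0 else madj V 0 0 * b * V 0 0) = (if N = 0 then 0 else a)"
    by (metis ab(1) mmult_mat1_entry sq)
  have "mmult N V (mmult N (mat1 a) (madj V)) = mmult N (mat1 b) (mat1 b)"
    unfolding V[symmetric] by (simp only: mmult_assoc)
  then have 2: "(if N = 0 then 0 else V 0 0 * a * madj V 0 0) = (if N = 0 then 0 else b)"
    by (metis ab(2) mmult_mat1_entry sq)
  show ?thesis
  proof (cases "N = 0")
    case True
    then have "a = 0" "b = 0"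
      using fun_cong[OF fun_cong[OF V(1)], of 0 0] fun_cong[OF fun_cong[OF V(2)], of 0 0]
      by (simp_all add: mmult_def mat1_def mat2_def)
    then show ?thesis by (auto simp: alg_equiv_def intro: exI[of _ 0])
  next
    case False
    define v where "v = V 0 0"
    have v: "cstar v * b * v = a" "v * a * cstar v = b"
      using 1 2 False by (simp_all add: v_def madj_def)
    have "(a * cstar v * b) * (b * v * a) = a * (cstar v * (b * b) * v) * a" by (simp only: mult.assoc)
    moreover have "(b * v * a) * (a * cstar v * b) = b * (v * (a * a) * cstar v) * b" by (simp only: mult.assoc)
    ultimately show ?thesis unfolding alg_equiv_def using v ab by (metis)
  qed
qed

text \<open>Write \<open>a = c' + d\<close> with \<open>c'\<close> equivalent to \<open>c\<close>
  through \<open>s\<close>. The second \<open>a\<close> lends its part \<open>c'\<close> to the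
  first: a (+) a ~ (a + c) (+) d ~ (b + c) (+) d ~ b (+) a, the middle step being
  \<open>v\<close>.\<close>

lemma mvn_equiv_diag:
  assumes p: "is_proj (a::'a::cstar_algebra)" "is_proj b" "is_proj c"
    and o: "orth c a" "orth c b"
    and s: "s * cstar s = c" "s * a = s"
    and c': "cstar s * s = c'" "a * c' = c'" "c' * a = c'" "s * c' = s"
    and v: "cstar v * v = a + c" "v * cstar v = b + c" "(b + c) * v = v" "v * (a + c) = v"
  shows "mvn_equiv (mat2 a 0 0 a) (mat2 b 0 0 a)" "mvn_equiv (mat2 a 0 0 a) (mat2 a 0 0 b)"
proof -
  define d where "d = a - c'"
  have P: "cstar a = a" "cstar b = b" "cstar c = c" "a * a = a" "b * b = b" "c * c = c"
    "c * a = 0" "a * c = 0" "c * b = 0" "b * c = 0"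
    using p o by (auto simp: is_proj_def orth_def)
  have cc': "cstar c' = c'" using c'(1) by (metis cstar_cstar cstar_mult)
  have cs: "c * s = s" using c'(1,4) s(1) by (metis mult.assoc)
  have sc: "cstar s * c = cstar s" "a * cstar s = cstar s" "c' * cstar s = cstar s"
    using cs s c' P cc' by (metis cstar_mult)+
  have as: "a * s = 0" "b * s = 0" "cstar s * a = 0" "cstar s * b = 0"
    by (metis cs sc(1) P mult.assoc mult_zero_left mult_zero_right)+
  have c'c': "c' * c' = c'" using c' by (metis mult.assoc)
  have d: "d * d = d" "cstar d = d" "s * d = 0" "d * cstar s = 0" "c' + d = a"
    unfolding d_def using P c' c'c' cc' sc s by (simp_all add: algebra_simps cstar_diff)
  \<comment> \<open>The composite of the three equivalences as a matrix: \<open>s\<close> brings the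
    borrowed part in, \<open>cstar s\<close> returns it, and \<open>d\<close> is left fixed.\<close>
  define A B C D where "A = b * v * a" and "B = b * v * s" and "C = cstar s * v * a"
    and "D = cstar s * v * s + d"
  have cA: "cstar A = a * cstar v * b" "cstar B = cstar s * cstar v * b"
    "cstar C = a * cstar v * s" "cstar D = cstar s * cstar v * s + d"
    by (simp_all add: A_def B_def C_def D_def cstar_mult cstar_add cstar_cstar P d mult.assoc)
  have V1: "cstar v * (b + s * cstar s) * v = a + c" using v s by (simp add: mult.assoc)
  have V2: "v * (a + s * cstar s) * cstar v = b + c"
    using v s by (simp flip: mult.assoc)
  have e1: "cstar A * A + cstar C * C = a"
  proof -
    have "cstar A * A + cstar C * C = a * (cstar v * (b + s * cstar s) * v) * a"
      unfolding cA unfolding A_def C_def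
      by (simp add: algebra_simps P mult_eq_assoc[OF P(5)])
    then show ?thesis unfolding V1 by (simp add: algebra_simps P)
  qed
  have e2: "cstar A * B + cstar C * D = 0"
  proof -
    have "cstar A * B + cstar C * D = a * (cstar v * (b + s * cstar s) * v) * s + a * cstar v * (s * d)"
      unfolding cA unfolding B_def D_def
      by (simp add: algebra_simps P mult_eq_assoc[OF P(5)])
    then show ?thesis unfolding V1 using as cs d by (simp add: algebra_simps P)
  qed
  have e3: "cstar B * B + cstar D * D = a"
  proof -
    have "cstar B * B + cstar D * D = cstar s * (cstar v * (b + s * cstar s) * v) * s
        + cstar s * cstar v * (s * d) + (d * cstar s) * v * s + d * d"
      unfolding cA unfolding B_def D_def
      by (simp add: algebra_simps P mult_eq_assoc[OF P(5)])
    then show ?thesis unfolding V1 using as cs d c' sc by (simp add: algebra_simps P)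
  qed
  have f1: "A * cstar A + B * cstar B = b"
  proof -
    have "A * cstar A + B * cstar B = b * (v * (a + s * cstar s) * cstar v) * b"
      unfolding cA unfolding A_def B_def
      by (simp add: algebra_simps P mult_eq_assoc[OF P(4)])
    then show ?thesis unfolding V2 by (simp add: algebra_simps P)
  qed
  have f2: "A * cstar C + B * cstar D = 0"
  proof -
    have "A * cstar C + B * cstar D = b * (v * (a + s * cstar s) * cstar v) * s + b * v * (s * d)"
      unfolding cA unfolding A_def B_def
      by (simp add: algebra_simps P mult_eq_assoc[OF P(4)])
    then show ?thesis unfolding V2 using as cs d by (simp add: algebra_simps P)
  qed
  have f3: "C * cstar C + D * cstar D = a"
  proof -
    have "C * cstar C + D * cstar D = cstar s * (v * (a + s * cstar s) * cstar v) * s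
        + cstar s * v * (s * d) + (d * cstar s) * cstar v * s + d * d"
      unfolding cA unfolding C_def D_def
      by (simp add: algebra_simps P mult_eq_assoc[OF P(4)])
    then show ?thesis unfolding V2 using as cs d c' sc by (simp add: algebra_simps P)
  qed
  have e2': "cstar B * A + cstar D * C = 0"
    using arg_cong[OF e2, of cstar] by (simp add: cstar_add cstar_mult cstar_cstar)
  have f2': "C * cstar A + D * cstar B = 0"
    using arg_cong[OF f2, of cstar] by (simp add: cstar_add cstar_mult cstar_cstar)
  show "mvn_equiv (mat2 a 0 0 a) (mat2 b 0 0 a)"
    unfolding mvn_equiv_def
    by (rule exI[of _ 2], rule exI[of _ "mat2 A B C D"])
       (simp add: in_Mn_mat2 madj_mat2 mmult_mat2 e1 e2 e2' e3 f1 f2 f2' f3)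
  show "mvn_equiv (mat2 a 0 0 a) (mat2 a 0 0 b)"
    unfolding mvn_equiv_def
    \<comment> \<open>Swapping the rows swaps the two summands of the target.\<close>
    by (rule exI[of _ 2], rule exI[of _ "mat2 C D A B"])
       (simp add: in_Mn_mat2 madj_mat2 mmult_mat2 add.commute e1 e2 e2' e3 f1 f2 f2' f3
         e1[unfolded add.commute[of "cstar A * A"]] e2[unfolded add.commute[of "cstar A * B"]]
         e3[unfolded add.commute[of "cstar B * B"]] e2'[unfolded add.commute[of "cstar B * A"]])
qed

text \<open>\<open>mvn_equiv_diag\<close>, used from \<open>a\<close> and from \<open>b\<close>,
  gives a (+) a ~ a (+) b ~ b (+) b, the hypothesis of separativity for matrices of size 1.\<close>

lemma separative_cancel_proj:
  assumes sep: "separative TYPE('a::cstar_algebra)" and rr: "real_rank_zero TYPE('a)"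
    and p: "is_proj (a::'a)" "is_proj b" "is_proj c"
    and o: "orth c a" "orth c b" and l: "lsub c a" "lsub c b"
    and eq: "alg_equiv (a + c) (b + c)"
  shows "alg_equiv a b"
proof -
  have pac: "is_proj (a + c)" "is_proj (b + c)"
    using p o by (simp_all add: is_proj_def orth_def cstar_add algebra_simps)
  obtain v where v: "cstar v * v = a + c" "v * cstar v = b + c" "(b + c) * v = v" "v * (a + c) = v"
    using alg_equiv_proj_polar[OF rr pac eq] .
  have sub: "\<exists>s c'. s * cstar s = c \<and> s * x = s \<and> cstar s * s = c' \<and> x * c' = c' \<and> c' * x = c' \<and> s * c' = s"
    if x: "is_proj x" "lsub c x" for x
  proof -
    obtain c1 where c1: "idem c1" "x * c1 = c1" "c1 * x = c1" "alg_equiv c c1"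
      using lsub_sub_idem[OF x(2) is_proj_idem[OF p(3)] is_proj_idem[OF x(1)]] .
    note r = range_proj[OF rr c1(1)]
    have "alg_equiv c1 (range_proj c1)" unfolding alg_equiv_def using r by metis
    then have "alg_equiv (range_proj c1) c"
      using alg_equiv_trans[OF c1(4)] c1 p r is_proj_idem alg_equiv_sym by blast
    then obtain s where s: "cstar s * s = range_proj c1" "s * cstar s = c" "c * s = s" "s * range_proj c1 = s"
      using alg_equiv_proj_polar[OF rr r(1) p(3)] by blast
    have 1: "x * range_proj c1 = range_proj c1" using r c1 by (metis mult.assoc)
    then have 2: "range_proj c1 * x = range_proj c1" using x r by (metis cstar_mult is_proj_def)
    have "s * x = s" using s 2 by (metis mult.assoc)
    with s 1 2 show ?thesis by blast
  qed
  obtain s c' where s: "s * cstar s = c" "s * a = s" "cstar s * s = c'" "a * c' = c'" "c' * a = c'" "s * c' = s"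
    using sub[OF p(1) l(1)] by blast
  obtain t c'' where t: "t * cstar t = c" "t * b = t" "cstar t * t = c''" "b * c'' = c''" "c'' * b = c''" "t * c'' = t"
    using sub[OF p(2) l(2)] by blast
  have v': "cstar (cstar v) * cstar v = b + c" "cstar v * cstar (cstar v) = a + c"
    "(a + c) * cstar v = cstar v" "cstar v * (b + c) = cstar v"
    using v pac by (simp_all add: cstar_cstar) (metis cstar_mult is_proj_def)+
  have m1: "mvn_equiv (mat2 a 0 0 a) (mat2 a 0 0 b)"
    by (rule mvn_equiv_diag(2)[OF p o s v])
  have "mvn_equiv (mat2 b 0 0 b) (mat2 a 0 0 b)"
    by (rule mvn_equiv_diag(1)[OF p(2) p(1) p(3) o(2) o(1) t v'])
  then have m2: "mvn_equiv (mat2 a 0 0 b) (mat2 b 0 0 b)" by (rule mvn_equiv_sym)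
  have dsum: "dsum 1 (mat1 x) (mat1 y) = mat2 x 0 0 y" for x y :: 'a
    unfolding dsum_def mat1_def mat2_def by (intro ext) auto
  have in1: "in_Mn 1 (mat1 x)" for x :: 'a by (auto simp: in_Mn_def mat1_def mat2_def)
  have pr: "is_proj_Minf (mat1 x)" if "is_proj x" for x :: 'a
  proof -
    have "madj (mat1 x) = mat1 x" using that by (simp add: mat1_def madj_mat2 is_proj_def)
    moreover have "mmult 2 (mat1 x) (mat1 x) = mat1 x"
      using that by (simp add: mat1_def mmult_mat2 is_proj_def)
    moreover have "in_Mn 2 (mat1 x)" by (simp add: mat1_def in_Mn_mat2)
    ultimately show ?thesis unfolding is_proj_Minf_def by blast
  qed
  have "mvn_equiv (mat1 a) (mat1 b)"
    using sep[unfolded separative_def, rule_format, of 1 "mat1 a" "mat1 b"] in1 pr p m1 m2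
    by (simp only: dsum)
  then show ?thesis using mvn_equiv_mat1_imp_alg_equiv p by blast
qed

text \<open>The idempotents are replaced by equivalent projections in such a way that orthogonality
  to \<open>c\<close> survives.\<close>

theorem separative_cancel_of_separative:
  assumes sep: "separative TYPE('a::cstar_algebra)" and rr: "real_rank_zero TYPE('a)"
  shows "separative_cancel TYPE('a)"
  unfolding separative_cancel_def
proof (intro allI impI, elim conjE)
  fix a b c :: 'a
  assume i: "idem a" "idem b" "idem c" and o: "orth c a" "orth c b" and l: "lsub c a" "lsub c b"
    and eq: "alg_equiv (a + c) (b + c)"
  define c' where "c' = range_proj c"
  note rc = range_proj[OF rr i(3), folded c'_def]
  have cc': "alg_equiv c c'" unfolding alg_equiv_def using rc by metis
  have *: "\<exists>x'. is_proj x' \<and> orth c' x' \<and> alg_equiv x x'" if x: "idem x" "orth c x" for x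
  proof -
    \<comment> \<open>Range projections of orthogonal idempotents need not be orthogonal. Cutting
      \<open>x\<close> by \<open>1 - c'\<close> keeps its class and makes its range, hence its range
      projection, orthogonal to \<open>c'\<close>.\<close>
    define x1 where "x1 = (1 - c') * x"
    have "x * c' = x * c * c'" using rc(2) by (simp add: mult.assoc)
    then have xc: "x * c' = 0" using x(2) by (simp add: orth_def)
    have xx: "x * x = x" using x by (simp add: idem_def)
    have 1: "x * x1 = x" "x1 * x = x1"
      by (simp_all add: x1_def algebra_simps xx mult_eq_assoc[OF xc] xc)
    have c'c': "c' * c' = c'" "cstar c' = c'" using rc by (auto simp: is_proj_def)
    have 2: "x1 * x1 = x1" unfolding x1_def by (metis 1(1) mult.assoc x1_def)
    have 3: "c' * x1 = 0" by (simp add: x1_def algebra_simps c'c' mult_eq_assoc[OF c'c'(1)])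
    note r = range_proj[OF rr, of x1, unfolded idem_def, OF 2]
    have "c' * range_proj x1 = 0" using r(2) 3 by (metis mult.assoc mult_zero_left)
    moreover from this have "range_proj x1 * c' = 0"
      using r(1) c'c' by (metis cstar_0 cstar_mult is_proj_def)
    moreover have "alg_equiv x x1" "alg_equiv x1 (range_proj x1)"
      unfolding alg_equiv_def using 1 r by metis+
    then have "alg_equiv x (range_proj x1)"
      using alg_equiv_trans x(1) 2 r(1) is_proj_idem idem_def by blast
    ultimately show ?thesis using r(1) by (auto simp: orth_def)
  qed
  obtain a' where a': "is_proj a'" "orth c' a'" "alg_equiv a a'" using *[OF i(1) o(1)] by blast
  obtain b' where b': "is_proj b'" "orth c' b'" "alg_equiv b b'" using *[OF i(2) o(2)] by blast
  have i': "idem a'" "idem b'" "idem c'" using a' b' rc is_proj_idem by auto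
  have lc: "lsub c' c" using cc' i' alg_equiv_imp_lsub alg_equiv_sym by blast
  have lx: "lsub c' a'" "lsub c' b'"
    using lsub_trans[OF lc lsub_trans[OF l(1) alg_equiv_imp_lsub[OF a'(3) i(1)]]]
      lsub_trans[OF lc lsub_trans[OF l(2) alg_equiv_imp_lsub[OF b'(3) i(2)]]] by auto
  have id: "idem (a + c)" "idem (b + c)" "idem (a' + c')" "idem (b' + c')"
    using idem_add i i' o a' b' orth_sym by blast+
  have A: "alg_equiv (a + c) (a' + c')" and B: "alg_equiv (b + c) (b' + c')"
    using alg_equiv_add cc' a' b' i i' o orth_sym by blast+
  have "alg_equiv (a' + c') (b + c)"
    by (rule alg_equiv_trans[OF alg_equiv_sym[OF A] eq id(3) id(1) id(2)])
  then have "alg_equiv (a' + c') (b' + c')"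
    by (rule alg_equiv_trans[OF _ B id(3) id(2) id(4)])
  then have "alg_equiv a' b'"
    using separative_cancel_proj[OF sep rr a'(1) b'(1) rc(1) a'(2) b'(2) lx] by blast
  then have "alg_equiv a b'" by (rule alg_equiv_trans[OF a'(3) _ i(1) i'(1) i'(2)])
  then show "alg_equiv a b" by (rule alg_equiv_trans[OF _ alg_equiv_sym[OF b'(3)] i(1) i'(2) i(2)])
qed

section \<open>Ideals generated by a projection\<close>

definition two_sided_ideal :: "'a::ring_1 set \<Rightarrow> bool" where
  "two_sided_ideal I \<longleftrightarrow> 0 \<in> I \<and> (\<forall>x\<in>I. \<forall>y\<in>I. x + y \<in> I) \<and> (\<forall>x\<in>I. \<forall>a. a * x \<in> I \<and> x * a \<in> I)"

lemma two_sided_idealD: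
  assumes "two_sided_ideal I"
  shows "0 \<in> I" "x \<in> I \<Longrightarrow> y \<in> I \<Longrightarrow> x + y \<in> I" "x \<in> I \<Longrightarrow> a * x \<in> I" "x \<in> I \<Longrightarrow> x * a \<in> I"
  using assms by (auto simp: two_sided_ideal_def)

lemma two_sided_ideal_diff: "two_sided_ideal I \<Longrightarrow> x \<in> I \<Longrightarrow> y \<in> I \<Longrightarrow> x - y \<in> I"
  using two_sided_idealD(2)[of I x "- 1 * y"] two_sided_idealD(3)[of I y "- 1"] by simp

lemma two_sided_ideal_scaleC: "two_sided_ideal I \<Longrightarrow> x \<in> I \<Longrightarrow> scaleC c (x::'a::cstar_algebra) \<in> I"
  using two_sided_idealD(3)[of I x "scaleC c 1"] by (simp add: mult_scaleC_left)

lemma two_sided_ideal_scaleR: "two_sided_ideal I \<Longrightarrow> x \<in> I \<Longrightarrow> c *\<^sub>R (x::'a::real_normed_algebra_1) \<in> I"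
  using two_sided_idealD(3)[of I x "c *\<^sub>R 1"] by simp

text \<open>The ideal before closure: \<open>decomp_ideal\<close> needs genuinely finite
  sums.\<close>

definition alg_ideal :: "'a::ring_1 \<Rightarrow> 'a set" where
  "alg_ideal p = {\<Sum>i<m. x i * p * y i | (m::nat) x y. True}"

lemma alg_ideal_two_sided: "two_sided_ideal (alg_ideal p)"
  unfolding two_sided_ideal_def
proof (intro conjI ballI allI)
  show "0 \<in> alg_ideal p" unfolding alg_ideal_def by (auto intro!: exI[of _ 0])
next
  fix u v assume "u \<in> alg_ideal p" "v \<in> alg_ideal p"
  then obtain m n x y x' y' where u: "u = (\<Sum>i<(m::nat). x i * p * y i)" and v: "v = (\<Sum>i<(n::nat). x' i * p * y' i)"
    by (auto simp: alg_ideal_def)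
  have "u + (\<Sum>i<n. x' i * p * y' i) = (\<Sum>i<m + n. (if i < m then x i else x' (i - m)) * p * (if i < m then y i else y' (i - m)))"
    by (induction n) (simp_all add: u add.assoc[symmetric])
  then show "u + v \<in> alg_ideal p" unfolding v alg_ideal_def
    by (intro CollectI exI[of _ "m + n"] exI[of _ "\<lambda>i. if i < m then x i else x' (i - m)"]
         exI[of _ "\<lambda>i. if i < m then y i else y' (i - m)"] conjI TrueI)
next
  fix u a assume "u \<in> alg_ideal p"
  then obtain m x y where u: "u = (\<Sum>i<(m::nat). x i * p * y i)" by (auto simp: alg_ideal_def)
  have "a * u = (\<Sum>i<m. (a * x i) * p * y i)"
    unfolding u by (simp add: sum_distrib_left mult.assoc)
  then show "a * u \<in> alg_ideal p" unfolding alg_ideal_def mem_Collect_eq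
    by (intro exI[of _ m] exI[of _ "\<lambda>i. a * x i"] exI[of _ y] conjI TrueI)
  have "u * a = (\<Sum>i<m. x i * p * (y i * a))"
    unfolding u by (simp add: sum_distrib_right mult.assoc)
  then show "u * a \<in> alg_ideal p" unfolding alg_ideal_def mem_Collect_eq
    by (intro exI[of _ m] exI[of _ x] exI[of _ "\<lambda>i. y i * a"] conjI TrueI)
qed

lemma two_sided_ideal_closure:
  fixes J :: "'a::real_normed_algebra_1 set"
  assumes J: "two_sided_ideal J"
  shows "two_sided_ideal (closure J)"
  unfolding two_sided_ideal_def
proof (intro conjI ballI allI)
  show "0 \<in> closure J" using two_sided_idealD(1)[OF J] closure_subset by blast
next
  fix x y assume "x \<in> closure J" "y \<in> closure J"
  then obtain f g where fg: "\<And>n. f n \<in> J" "f \<longlonglongrightarrow> x" "\<And>n. g n \<in> J" "g \<longlonglongrightarrow> y"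
    by (auto simp: closure_sequential)
  then have "\<And>n::nat. f n + g n \<in> J" "(\<lambda>n. f n + g n) \<longlonglongrightarrow> x + y"
    using two_sided_idealD(2)[OF J] by (auto intro: tendsto_add)
  then show "x + y \<in> closure J" unfolding closure_sequential by metis
next
  fix x a assume "x \<in> closure J"
  then obtain f where f: "\<And>n. f n \<in> J" "f \<longlonglongrightarrow> x" by (auto simp: closure_sequential)
  have "\<And>n. a * f n \<in> J" "(\<lambda>n. a * f n) \<longlonglongrightarrow> a * x" "\<And>n. f n * a \<in> J" "(\<lambda>n. f n * a) \<longlonglongrightarrow> x * a"
    using two_sided_idealD(3,4)[OF J f(1)] f(2) by (auto intro: tendsto_intros)
  then show "a * x \<in> closure J" "x * a \<in> closure J" unfolding closure_sequential by metis+
qed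

lemma gen_ideal_eq: "gen_ideal p = closure (alg_ideal p)"
  by (simp add: gen_ideal_def alg_ideal_def)

lemma two_sided_gen_ideal: "two_sided_ideal (gen_ideal p)"
  unfolding gen_ideal_eq by (intro two_sided_ideal_closure alg_ideal_two_sided)

lemma gen_ideal_self: "p \<in> gen_ideal p"
proof -
  have "p \<in> alg_ideal p"
    unfolding alg_ideal_def by (intro CollectI exI[of _ 1] exI[of _ "\<lambda>_. 1"]) simp
  then show ?thesis unfolding gen_ideal_eq using closure_subset by blast
qed

lemma closed_gen_ideal: "closed (gen_ideal p)"
  by (simp add: gen_ideal_eq)

lemma idem_near_ideal:
  fixes e :: "'a::{real_normed_algebra_1, banach}"
  assumes J: "two_sided_ideal J" and e: "idem e" "norm e \<le> 1" and j: "j \<in> J" "norm (e - j) < 1"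
  shows "e \<in> J"
proof -
  have ee: "e * e = e" using e by (simp add: idem_def)
  define d where "d = e * (e - j) * e"
  have "norm d \<le> norm e * norm (e - j) * norm e"
    unfolding d_def by (intro order_trans[OF norm_mult_ineq] mult_right_mono norm_mult_ineq) auto
  also have "\<dots> \<le> 1 * norm (e - j) * 1" using e by (intro mult_mono) auto
  finally have "norm d < 1" using j by simp
  then obtain b where b: "is_inv (1 - d) b" using neumann by blast
  have "e * (1 - d) = e * j * e" by (simp add: d_def algebra_simps ee mult_eq_assoc[OF ee])
  then have "e * (1 - d) * b = e * j * e * b" by simp
  then have "e = e * j * e * b" using b by (simp add: is_inv_def mult.assoc)
  then show ?thesis using two_sided_idealD(3,4)[OF J] j(1) by metis
qed

lemma cstar_mem_gen_ideal:
  assumes p: "is_proj p" and x: "x \<in> gen_ideal p"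
  shows "cstar x \<in> gen_ideal p"
proof -
  have "cstar ` closure (alg_ideal p) \<subseteq> closure (alg_ideal p)"
  proof (rule image_closure_subset)
    show "cstar ` alg_ideal p \<subseteq> closure (alg_ideal p)"
    proof
      fix z assume "z \<in> cstar ` alg_ideal p"
      then obtain m x y where "z = cstar (\<Sum>i<(m::nat). x i * p * y i)" by (auto simp: alg_ideal_def)
      then have "z = (\<Sum>i<m. cstar (y i) * p * cstar (x i))"
        using p by (simp add: cstar_sum cstar_mult is_proj_def mult.assoc)
      then have "z \<in> alg_ideal p" unfolding alg_ideal_def mem_Collect_eq
        by (intro exI[of _ m] exI[of _ "\<lambda>i. cstar (y i)"] exI[of _ "\<lambda>i. cstar (x i)"] conjI TrueI)
      then show "z \<in> closure (alg_ideal p)" using closure_subset by blast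
    qed
  qed (auto intro: continuous_intros)
  then show ?thesis using x by (auto simp: gen_ideal_eq)
qed

section \<open>Cutting a unitary down to a corner\<close>

lemma is_proj_compl: "is_proj p \<Longrightarrow> is_proj (1 - p)"
  by (simp add: is_proj_def cstar_diff algebra_simps)

lemma unitary_norm_le: "cstar u * u = (1::'a::cstar_algebra) \<Longrightarrow> norm u \<le> 1"
  using cstar_identity[of u] by (simp add: power2_eq_1_iff) (metis norm_ge_zero order_refl power2_eq_1_iff neg_0_le_iff_le not_one_le_zero order_trans)

text \<open>\<open>f\<close> is the range projection of \<open>g * e\<close> with
  \<open>g = 1 - p\<close>. As \<open>e * g * e = e * (1 - d)\<close> for the small
  \<open>d = e * p * e\<close>, the inverse \<open>r\<close> of \<open>1 - d\<close> is the only
  correction required.\<close>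

lemma proj_almost_orthogonal_perturb:
  assumes I: "two_sided_ideal I" and e: "is_proj (e::'a::cstar_algebra)" "e \<in> I" and p: "is_proj p"
    and n: "norm (e * p) \<le> \<eta>" "\<eta> \<le> 1/4"
  obtains f where "is_proj f" "f \<in> I" "f * p = 0" "p * f = 0" "norm (f - e) \<le> 3 * \<eta>"
proof -
  have ee: "e * e = e" "cstar e = e" and pp: "p * p = p" "cstar p = p" using e p by (auto simp: is_proj_def)
  have \<eta>: "\<eta> \<ge> 0" using n norm_ge_zero order_trans by blast
  define g where "g = 1 - p"
  have g: "is_proj g" "g * p = 0" "p * g = 0" "g * g = g" "cstar g = g"
    using is_proj_compl[OF p] by (auto simp: g_def algebra_simps pp cstar_diff)
  define d where "d = e * p * e"
  have "d = (e * p) * cstar (e * p)" by (simp add: d_def cstar_mult ee pp mult.assoc mult_eq_assoc[OF pp(1)])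
  then have "norm d \<le> norm (e * p) * norm (e * p)" by (metis norm_mult_ineq norm_cstar)
  also have "\<dots> \<le> \<eta> * \<eta>" using n \<eta> by (intro mult_mono) auto
  finally have nd: "norm d \<le> \<eta> * \<eta>" .
  also have h4: "\<eta> * \<eta> \<le> \<eta> * (1/4)" using n \<eta> by (intro mult_left_mono) auto
  finally have nd': "norm d \<le> \<eta> * (1/4)" .
  then have "norm d < 1" using n by linarith
  then obtain r where r: "is_inv (1 - d) r" "norm (r - 1) \<le> norm d / (1 - norm d)"
    using neumann by blast
  have "norm d \<le> 1/16" using nd' n by linarith
  then have "norm d / (1 - norm d) \<le> norm d / (1/4)" by (intro divide_left_mono) auto
  then have nr: "norm (r - 1) \<le> \<eta>" using r(2) nd' by simp
  have sd: "cstar d = d" by (simp add: d_def cstar_mult ee pp mult.assoc)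
  have sr: "cstar r = r"
    using is_inv_self_adjoint[OF _ r(1)] sd by (simp add: self_adjoint_def cstar_diff)
  have ed: "e * d = d" "d * e = d" by (simp_all add: d_def mult.assoc ee mult_eq_assoc[OF ee(1)])
  then have er: "e * r = r * e" by (intro is_inv_commute[OF r(1)]) (simp add: algebra_simps)
  define f where "f = g * e * r * (e * g)"
  have ege: "e * g * g * e = e * (1 - d)"
    by (simp add: g_def d_def algebra_simps ee pp mult_eq_assoc[OF ee(1)] mult_eq_assoc[OF pp(1)])
  have "f * f = g * e * r * (e * g * g * e) * r * (e * g)" unfolding f_def by (simp only: mult.assoc)
  also have "\<dots> = g * e * r * e * ((1 - d) * r) * (e * g)" unfolding ege by (simp only: mult.assoc)
  also have "\<dots> = g * e * (r * e) * (e * g)" using r(1) by (simp add: is_inv_def mult.assoc)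
  also have "\<dots> = f" unfolding f_def er[symmetric] by (simp add: mult.assoc ee mult_eq_assoc[OF ee(1)])
  finally have ff: "f * f = f" .
  have "cstar f = f" unfolding f_def by (simp add: cstar_mult ee g sr mult.assoc)
  with ff have 1: "is_proj f" by (simp add: is_proj_def)
  have 2: "f \<in> I" unfolding f_def by (intro two_sided_idealD[OF I] e)
  have 3: "f * p = 0" "p * f = 0" unfolding f_def using g
    by (simp_all add: mult.assoc mult_eq_assoc[OF g(3)])
  \<comment> \<open>Each of the three terms is at most \<open>\<eta>\<close> in norm.\<close>
  have "f - e = g * e * (r - 1) * (e * g) - (p * e) * g - e * p"
    unfolding f_def by (simp add: algebra_simps ee mult_eq_assoc[OF ee(1)]) (simp add: g_def algebra_simps)
  moreover have "norm (g * e * (r - 1) * (e * g)) \<le> \<eta>"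
  proof -
    have "norm (g * e) \<le> norm g * norm e" "norm (e * g) \<le> norm e * norm g" by (simp_all only: norm_mult_ineq)
    moreover have "norm g * norm e \<le> 1"
      using norm_proj_le[OF e(1)] norm_proj_le[OF g(1)] by (intro mult_le_one) auto
    ultimately have "norm (g * e) \<le> 1" "norm (e * g) \<le> 1" by (simp_all add: mult.commute)
    then have "norm (g * e) * norm (r - 1) * norm (e * g) \<le> 1 * \<eta> * 1"
      using nr \<eta> by (intro mult_mono) auto
    moreover have "norm (g * e * (r - 1) * (e * g)) \<le> norm (g * e) * norm (r - 1) * norm (e * g)"
      by (intro order_trans[OF norm_mult_ineq] mult_right_mono norm_mult_ineq) auto
    ultimately show ?thesis by simp
  qed
  moreover have "norm (p * e) = norm (e * p)"
    by (metis cstar_mult ee(2) pp(2) norm_cstar)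
  then have "norm ((p * e) * g) \<le> \<eta>"
    using norm_mult_ineq[of "p * e" g] norm_proj_le[OF g(1)] n(1)
      mult_left_le[of "norm g" "norm (p * e)"] by simp
  ultimately have "norm (f - e) \<le> 3 * \<eta>"
    using norm_triangle_ineq4[of "g * e * (r - 1) * (e * g) - (p * e) * g" "e * p"]
      norm_triangle_ineq4[of "g * e * (r - 1) * (e * g)" "(p * e) * g"] n(1) by simp
  with 1 2 3 show ?thesis using that by blast
qed

text \<open>Take the spectral projection \<open>e\<close> of an approximant of \<open>k\<close> for
  values of modulus at least \<open>\<delta>\<close>. It is close to a multiple \<open>y * k\<close>
  of \<open>k\<close>, hence lies in the ideal and is almost orthogonal to \<open>p\<close>; a small
  perturbation makes the orthogonality exact.\<close>

lemma approximate_unit_proj: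
  assumes rr: "real_rank_zero TYPE('a::cstar_algebra)" and I: "two_sided_ideal I"
    and p: "is_proj (p::'a)" and k: "self_adjoint k" "k \<in> I" "k * p = 0" and t: "\<tau> > 0"
  obtains f where "is_proj f" "f \<in> I" "f * p = 0" "p * f = 0" "norm ((1 - f) * k) < \<tau>"
proof -
  define K where "K = norm k"
  have K: "K \<ge> 0" by (simp add: K_def)
  \<comment> \<open>The final error is at most
    \<open>\<delta> + \<delta> * \<eta> + 3 * \<eta> * K\<close>, that is
    \<open>\<tau> / 4 + \<tau> / 16 + 3 * \<tau> / 8\<close>. The approximation is taken up to
    \<open>\<delta> * \<eta>\<close> because \<open>y\<close> can have norm
    \<open>1 / \<delta>\<close>.\<close>
  define \<delta> where "\<delta> = \<tau> / 4"
  define \<eta> where "\<eta> = min (1/4) (\<tau> / (8 * (K + 1)))"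
  have d: "\<delta> > 0" and h: "\<eta> > 0" using t K by (auto simp: \<delta>_def \<eta>_def)
  have h4: "\<eta> \<le> 1/4" unfolding \<eta>_def by (rule min.cobounded1)
  note h = h h4
  have hK: "\<eta> * K \<le> \<tau> / 8"
  proof -
    have "\<eta> * K \<le> \<tau> / (8 * (K + 1)) * K" using K by (intro mult_right_mono) (auto simp: \<eta>_def)
    also have "\<dots> \<le> \<tau> / 8" using K t by (simp add: field_simps)
    finally show ?thesis .
  qed
  obtain S E where SE: "spectral_system S E" "norm (k - fcalc S E (\<lambda>s. s)) < \<delta> * \<eta>"
    using real_rank_zero_approx[OF rr k(1), of "\<delta> * \<eta>"] d h by auto
  note fm = fcalc_mult[OF SE(1)]
  define b where "b = fcalc S E (\<lambda>s. s)"
  define e where "e = fcalc S E (\<lambda>s. if \<bar>s\<bar> \<ge> \<delta> then 1 else 0)"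
  define y where "y = fcalc S E (\<lambda>s. if \<bar>s\<bar> \<ge> \<delta> then 1 / s else 0)"
  have "e * e = e" unfolding e_def fm by (intro fcalc_cong[OF SE(1)]) auto
  moreover have "self_adjoint e" unfolding e_def by (rule self_adjoint_fcalc[OF SE(1)])
  ultimately have e: "is_proj e" by (simp add: is_proj_def self_adjoint_def)
  have yb: "y * b = e" unfolding y_def b_def e_def fm using d by (intro fcalc_cong[OF SE(1)]) auto
  have ny: "norm y \<le> 1 / \<delta>"
    unfolding y_def using d by (intro norm_fcalc_le[OF SE(1)]) (auto simp: field_simps)
  have "(1 - e) * b = fcalc S E (\<lambda>s. s - (if \<bar>s\<bar> \<ge> \<delta> then 1 else 0) * s)"
    by (simp only: left_diff_distrib mult_1_left e_def b_def fm fcalc_diff[OF SE(1)])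
  then have nb: "norm ((1 - e) * b) \<le> \<delta>"
    using d by (simp only:) (intro norm_fcalc_le[OF SE(1)], auto)
  have "norm (y * (b - k)) \<le> (1 / \<delta>) * (\<delta> * \<eta>)"
    using ny SE(2) d h by (intro order_trans[OF norm_mult_ineq] mult_mono) (auto simp: b_def norm_minus_commute)
  then have yk: "norm (e - y * k) \<le> \<eta>" using d by (simp add: algebra_simps yb)
  have eI: "e \<in> I"
  proof (rule idem_near_ideal[OF I is_proj_idem[OF e] norm_proj_le[OF e]])
    show "y * k \<in> I" using two_sided_idealD[OF I] k by blast
    show "norm (e - y * k) < 1" using yk h by linarith
  qed
  have "e * p = (e - y * k) * p" by (simp add: algebra_simps k)
  then have "norm (e * p) \<le> norm (e - y * k) * norm p" by (simp only: norm_mult_ineq)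
  also have "\<dots> \<le> \<eta> * 1" using yk h norm_proj_le[OF p] by (intro mult_mono) auto
  finally have "norm (e * p) \<le> \<eta>" by simp
  then obtain f where f: "is_proj f" "f \<in> I" "f * p = 0" "p * f = 0" "norm (f - e) \<le> 3 * \<eta>"
    using proj_almost_orthogonal_perturb[OF I e eI p _ h(2)] by blast
  have "(1 - f) * k = (1 - e) * b + (1 - e) * (k - b) - (f - e) * k" by (simp add: algebra_simps)
  then have "norm ((1 - f) * k) \<le> norm ((1 - e) * b + (1 - e) * (k - b)) + norm ((f - e) * k)"
    by (simp only: norm_triangle_ineq4)
  also have "\<dots> \<le> norm ((1 - e) * b) + norm ((1 - e) * (k - b)) + norm ((f - e) * k)"
    by (intro add_right_mono norm_triangle_ineq)
  also have "norm ((1 - e) * (k - b)) \<le> 1 * (\<delta> * \<eta>)"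
    using norm_proj_le[OF is_proj_compl[OF e]] SE(2)
    by (intro order_trans[OF norm_mult_ineq] mult_mono) (auto simp: b_def)
  also have "norm ((f - e) * k) \<le> 3 * \<eta> * K"
    unfolding K_def using f(5) by (intro order_trans[OF norm_mult_ineq] mult_right_mono) auto
  finally have "norm ((1 - f) * k) \<le> \<delta> + \<delta> * \<eta> + 3 * (\<eta> * K)" using nb by (simp add: mult.assoc)
  moreover have "\<delta> * \<eta> \<le> \<delta> * (1/4)" using h d by (intro mult_left_mono) auto
  moreover have "\<delta> = \<tau> / 4" by (simp add: \<delta>_def)
  ultimately have "norm ((1 - f) * k) < \<tau>" using hK t by linarith
  with f that show ?thesis by blast
qed

text \<open>The segment from 1 to \<open>m\<close> consists of invertible elements; conjugating
  \<open>q\<close> along it gives the path.\<close>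

lemma path_component_similar:
  fixes q :: "'a::{real_normed_algebra_1, banach}"
  assumes q: "idem q" and m: "norm (m - 1) < 1" and b: "is_inv m b"
  shows "path_component {h. idem h} q (m * q * b)"
proof -
  define g where "g s = 1 + s *\<^sub>R (m - 1)" for s :: real
  have "\<exists>k. is_inv (g s) k" if "s \<in> {0..1}" for s
  proof -
    have "norm (g s - 1) \<le> norm (m - 1)" using that by (simp add: g_def mult_left_le_one_le)
    then show ?thesis using m neumann'[of "g s"] by (metis le_less_trans)
  qed
  then obtain k where k: "\<And>s. s \<in> {0..1} \<Longrightarrow> is_inv (g s) (k s)" by metis
  have cg: "continuous_on {0..1} g" unfolding g_def by (intro continuous_intros)
  have ck: "continuous_on {0..1} k" by (rule continuous_on_inverse_algebra[OF cg k])
  show ?thesis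
    unfolding path_component_def path_def path_image_def pathstart_def pathfinish_def
  proof (intro exI conjI)
    show "continuous_on {0..1} (\<lambda>s. g s * q * k s)" by (intro continuous_intros cg ck)
    show "(\<lambda>s. g s * q * k s) ` {0..1} \<subseteq> {h. idem h}"
    proof clarsimp
      fix s :: real assume "0 \<le> s" "s \<le> 1"
      then have k1: "k s * g s = 1" using k[of s] by (simp add: is_inv_def)
      have "g s * q * k s * (g s * q * k s) = g s * q * (k s * g s) * q * k s" by (simp only: mult.assoc)
      also have "\<dots> = g s * (q * q) * k s" unfolding k1 by (simp add: mult.assoc)
      finally show "idem (g s * q * k s)" using q by (simp add: idem_def)
    qed
    have "k 0 = 1" using k[of 0] by (simp add: is_inv_def g_def)
    then show "g 0 * q * k 0 = q" by (simp add: g_def)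
    have "k 1 = b" using is_inv_unique[OF k[of 1], of b] b by (simp add: g_def)
    then show "g 1 * q * k 1 = m * q * b" by (simp add: g_def)
  qed
qed

text \<open>\<open>u\<close> is close to the invertible \<open>t = e * u * e + f\<close>, which
  commutes with \<open>e\<close>. Hence \<open>q\<close> is connected to
  \<open>p1 = t * p * T\<close>, and \<open>t\<close> conjugates both \<open>p\<close> to
  \<open>p1\<close> and \<open>e - p\<close> to \<open>e - p1\<close> within one corner.\<close>

theorem proj_homotopic_of_unitary:
  assumes sep: "separative TYPE('a::cstar_algebra)" and rr: "real_rank_zero TYPE('a)"
    and p: "is_proj (p::'a)" and u: "cstar u * u = 1" "u * cstar u = 1" "u - 1 \<in> gen_ideal p"
  shows "path_component {h. idem h} p (u * p * cstar u)"
proof -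
  note I = two_sided_gen_ideal[of p]
  have pp: "p * p = p" "cstar p = p" using p by (auto simp: is_proj_def)
  define x where "x = u - 1"
  have ux: "u = 1 + x" by (simp add: x_def)
  have xI: "x \<in> gen_ideal p" using u by (simp add: x_def)
  \<comment> \<open>Only the part of \<open>cstar x * x\<close> under \<open>1 - p\<close> has to be
    captured by \<open>e'\<close>. The tolerance 1/64 is the square of the bound 1/8 wanted for
    \<open>x * f\<close>.\<close>
  define k where "k = (1 - p) * (cstar x * x) * (1 - p)"
  have "self_adjoint k"
    by (simp add: k_def self_adjoint_def cstar_mult cstar_diff cstar_cstar pp mult.assoc)
  moreover have "k \<in> gen_ideal p" unfolding k_def by (intro two_sided_idealD[OF I] xI)
  moreover have kp: "k * p = 0" by (simp add: k_def algebra_simps pp)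
  ultimately obtain e' where e': "is_proj e'" "e' \<in> gen_ideal p" "e' * p = 0" "p * e' = 0"
    "norm ((1 - e') * k) < 1/64"
    using approximate_unit_proj[OF rr I p, of k "1/64"] by auto
  have ee': "e' * e' = e'" "cstar e' = e'" using e' by (auto simp: is_proj_def)
  define e where "e = p + e'"
  define f where "f = 1 - e"
  have e: "is_proj e" "e * p = p" "p * e = p" "e * e = e" "cstar e = e"
    unfolding e_def is_proj_def by (simp_all add: cstar_add algebra_simps pp ee' e')
  have f: "is_proj f" "e * f = 0" "f * e = 0" "f * f = f" "cstar f = f"
    using is_proj_compl[OF e(1)] unfolding f_def by (auto simp: algebra_simps e is_proj_def)
  have eI: "e \<in> gen_ideal p" unfolding e_def by (intro two_sided_idealD(2)[OF I] gen_ideal_self e')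
  have fk: "cstar (x * f) * (x * f) = (1 - e') * k * f"
  proof -
    have 1: "f * (1 - p) = f" "(1 - p) * f = f" by (simp_all add: f_def algebra_simps e pp e_def e' )
    have pk: "p * k = 0" by (simp add: k_def algebra_simps pp mult_eq_assoc[OF pp(1)])
    have "cstar (x * f) * (x * f) = (f * (1 - p)) * (cstar x * x) * ((1 - p) * f)"
      unfolding 1 by (simp add: cstar_mult f mult.assoc)
    also have "\<dots> = f * k * f" by (simp add: k_def mult.assoc)
    also have "f * k = (1 - e') * k" by (simp add: f_def e_def algebra_simps pk)
    finally show ?thesis .
  qed
  have "norm ((1 - e') * k * f) \<le> norm ((1 - e') * k) * 1"
    using norm_proj_le[OF f(1)] by (intro order_trans[OF norm_mult_ineq] mult_left_mono) auto
  then have "(norm (x * f))\<^sup>2 < 1/64" using cstar_identity[of "x * f"] e'(5) unfolding fk by simp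
  also have "(1/64::real) = (1/8)\<^sup>2" by (simp add: power2_eq_square)
  finally have xf: "norm (x * f) < 1/8" by (rule power_less_imp_less_base) simp
  have nu: "norm (cstar u) \<le> 1" using unitary_norm_le[of u] u by simp
  have fx: "norm (f * x) < 1/8"
  proof -
    \<comment> \<open>Unitarity gives \<open>cstar x = - (cstar u * x)\<close>, so the bound for
      \<open>x * f\<close> carries over to \<open>f * x\<close>.\<close>
    have "cstar (f * x) = - (cstar u * (x * f))"
      using u by (simp add: cstar_mult f x_def cstar_diff algebra_simps flip: mult.assoc)
    then have "norm (f * x) = norm (cstar u * (x * f))" by (metis norm_cstar norm_minus_cancel)
    also have "\<dots> \<le> 1 * norm (x * f)"
      using nu by (intro order_trans[OF norm_mult_ineq] mult_right_mono) auto
    finally show ?thesis using xf by simp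
  qed
  define t where "t = e * u * e + f"
  have "u - t = x * f + f * x * e"
    unfolding t_def ux f_def by (simp add: algebra_simps e)
  moreover have "norm (f * x * e) \<le> norm (f * x) * 1"
    using norm_proj_le[OF e(1)] by (intro order_trans[OF norm_mult_ineq] mult_left_mono) auto
  ultimately have ut: "norm (u - t) < 1/4"
    using norm_triangle_ineq[of "x * f" "f * x * e"] xf fx by simp
  \<comment> \<open>\<open>m\<close> is near 1, and \<open>m * q * b = t * p * T\<close> since the
    factors \<open>cstar u * u\<close> cancel.\<close>
  define m where "m = t * cstar u"
  have "m - 1 = - ((u - t) * cstar u)" using u by (simp add: m_def algebra_simps)
  then have "norm (m - 1) = norm ((u - t) * cstar u)" by simp
  also have "\<dots> \<le> norm (u - t) * 1"
    using nu by (intro order_trans[OF norm_mult_ineq] mult_left_mono) auto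
  finally have nm: "norm (m - 1) < 1" using ut by simp
  then obtain b where b: "is_inv m b" using neumann' by blast
  define T where "T = cstar u * b"
  have tT: "t * T = 1" using b by (simp add: T_def m_def is_inv_def mult.assoc)
  have "T * t = cstar u * (b * m) * u" using u by (simp add: T_def m_def mult.assoc)
  then have Tt: "T * t = 1" using b u by (simp add: is_inv_def)
  define q where "q = u * p * cstar u"
  have "q * q = u * p * (cstar u * u) * p * cstar u" unfolding q_def by (simp only: mult.assoc)
  then have iq: "idem q" by (simp add: u q_def idem_def mult.assoc mult_eq_assoc[OF pp(1)])
  define p1 where "p1 = t * p * T"
  have "m * q * b = t * (cstar u * u) * p * T" unfolding m_def q_def T_def by (simp only: mult.assoc)
  then have "m * q * b = p1" by (simp add: u p1_def)
  then have q_p1: "path_component {h. idem h} q p1"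
    using path_component_similar[OF iq nm b] by simp
  have te: "t * e = e * t" unfolding t_def by (simp add: algebra_simps e f mult_eq_assoc[OF e(4)])
  have iT: "is_inv t T" using tT Tt by (simp add: is_inv_def)
  have Te: "e * T = T * e" using is_inv_commute[OF iT] te by metis
  have p1: "idem p1" "e * p1 = p1" "p1 * e = p1"
  proof -
    have "p1 * p1 = t * p * (T * t) * p * T" unfolding p1_def by (simp only: mult.assoc)
    then show "idem p1" by (simp add: Tt p1_def idem_def mult.assoc mult_eq_assoc[OF pp(1)])
    have "e * p1 = (t * e) * p * T" unfolding p1_def te by (simp only: mult.assoc)
    then show "e * p1 = p1" using e by (simp add: p1_def mult.assoc mult_eq_assoc[OF e(2)])
    have "p1 * e = t * p * (e * T)" unfolding p1_def Te by (simp only: mult.assoc)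
    then show "p1 * e = p1" using e by (simp add: p1_def mult.assoc mult_eq_assoc[OF e(3)])
  qed
  have sim: "alg_equiv a (t * a * T)" if "idem a" for a
  proof -
    have "(a * T) * (t * a) = a * (T * t) * a" "(t * a) * (a * T) = t * (a * a) * T" by (simp_all only: mult.assoc)
    then have "(a * T) * (t * a) = a" "(t * a) * (a * T) = t * a * T" by (simp_all only: Tt that[unfolded idem_def] mult_1_right)
    then show ?thesis unfolding alg_equiv_def by blast
  qed
  have "t * (e - p) * T = e - p1"
  proof -
    have "t * e * T = e" using te tT by (simp add: mult.assoc)
    then show ?thesis by (simp add: p1_def algebra_simps)
  qed
  moreover have "idem (e - p)" using idem_diff is_proj_idem e p by blast
  ultimately have ep: "alg_equiv (e - p) (e - p1)" using sim by metis
  \<comment> \<open>Any element of the algebraic ideal at distance below 1 shows that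
    \<open>e\<close> itself is a finite sum, the fullness of \<open>p\<close> in the corner of
    \<open>e\<close>.\<close>
  obtain j where j: "j \<in> alg_ideal p" "norm (e - j) < 1"
    using eI unfolding gen_ideal_eq closure_approachable dist_norm
    by (metis norm_minus_commute zero_less_one)
  have "e \<in> alg_ideal p"
    by (rule idem_near_ideal[OF alg_ideal_two_sided is_proj_idem[OF e(1)] norm_proj_le[OF e(1)] j])
  then obtain n xs ys where "e = (\<Sum>i<(n::nat). xs i * p * ys i)" by (auto simp: alg_ideal_def)
  then have "persp\<^sup>*\<^sup>* p p1"
    using persp_of_equiv[OF exchange_ring_of_real_rank_zero[OF rr] separative_cancel_of_separative[OF sep rr]]
      is_proj_idem[OF e(1)] is_proj_idem[OF p] e p1 sim[OF is_proj_idem[OF p]] ep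
    unfolding p1_def[symmetric] by blast
  then have "path_component {h. idem h} p p1"
    by (rule persp_rtranclp_imp_path_component) (rule is_proj_idem[OF p])
  then show ?thesis using q_p1 path_component_sym path_component_trans unfolding q_def by blast
qed

text \<open>\<open>z = b * a + (1 - b) * (1 - a)\<close> intertwines \<open>a\<close> and
  \<open>b\<close>, and \<open>z - 1\<close> lies in the ideal. Its polar part does the same; the
  root is taken with \<open>K = I\<close>, so the correction stays in the ideal too. From
  \<open>norm w < 1/8\<close> follows \<open>norm d \<le> 2/8 + 1/64 < 1\<close>.\<close>

lemma close_projections_unitary:
  assumes I: "two_sided_ideal I" "closed I" "\<And>x. x \<in> I \<Longrightarrow> cstar x \<in> I"
    and p: "is_proj (a::'a::cstar_algebra)" "is_proj b" and n: "norm (a - b) < 1/16" and a: "a \<in> I"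
  obtains u where "cstar u * u = 1" "u * cstar u = 1" "u - 1 \<in> I" "u * a * cstar u = b" "b \<in> I"
proof -
  have aa: "a * a = a" "cstar a = a" and bb: "b * b = b" "cstar b = b" using p by (auto simp: is_proj_def)
  have bI: "b \<in> I"
    by (rule idem_near_ideal[OF I(1) is_proj_idem[OF p(2)] norm_proj_le[OF p(2)] a])
       (use n in \<open>simp add: norm_minus_commute\<close>)
  define w where "w = b * (a - b) - (1 - b) * (a - b)"
  define z where "z = 1 + w"
  have wI: "w \<in> I" unfolding w_def using I(1) a bI
    by (intro two_sided_ideal_diff two_sided_idealD) auto
  have zz: "z = b * a + (1 - b) * (1 - a)" unfolding z_def w_def by (simp add: algebra_simps aa bb)
  have za: "z * a = b * z" unfolding zz by (simp add: algebra_simps aa bb mult_eq_assoc[OF bb(1)])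
  have "norm (b * (a - b)) \<le> 1 * norm (a - b)" "norm ((1 - b) * (a - b)) \<le> 1 * norm (a - b)"
    using norm_proj_le[OF p(2)] norm_proj_le[OF is_proj_compl[OF p(2)]]
    by (intro order_trans[OF norm_mult_ineq] mult_right_mono; simp)+
  then have nw: "norm w < 1/8"
    using norm_triangle_ineq4[of "b * (a - b)" "(1 - b) * (a - b)"] n by (simp add: w_def)
  define d where "d = 1 - cstar z * z"
  have d': "d = - (w + cstar w + cstar w * w)" by (simp add: d_def z_def cstar_add algebra_simps)
  have dI: "d \<in> I"
  proof -
    have "- 1 * (w + cstar w + cstar w * w) \<in> I"
      using wI I(3)[OF wI] by (intro two_sided_idealD(2,3)[OF I(1)])
    then show ?thesis by (simp add: d')
  qed
  have "norm (cstar w * w) \<le> (1/8) * (1/8)"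
    using norm_mult_ineq[of "cstar w" w] mult_mono[of "norm w" "1/8" "norm w" "1/8"] nw by simp
  then have "norm d < 1"
    using norm_triangle_ineq[of "w + cstar w" "cstar w * w"] norm_triangle_ineq[of w "cstar w"] nw
    unfolding d' by (simp only: norm_minus_cancel norm_cstar)
  moreover have "self_adjoint d"
    unfolding d_def by (intro self_adjoint_diff self_adjoint_cstar_mult) simp
  moreover have "(1/2) *\<^sub>R (d + s * s) \<in> I" if "s \<in> I" for s
    using that dI by (intro two_sided_ideal_scaleR two_sided_idealD(2,3) I(1))
  ultimately obtain s where s: "self_adjoint s" "s \<in> I" "norm s < 1" "(1 - s) * (1 - s) = 1 - d"
    "\<And>c. c * d = d * c \<Longrightarrow> c * s = s * c"
    using self_adjoint_sqrt[of d I] I(2) two_sided_idealD(1)[OF I(1)] by metis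
  obtain v where v: "is_inv (1 - s) v" using neumann s(3) by blast
  have cv: "cstar v = v"
    using is_inv_self_adjoint[OF _ v] s(1) by (simp add: self_adjoint_def cstar_diff)
  have caz: "a * cstar z = cstar z * b" using za by (metis aa(2) bb(2) cstar_mult)
  have "a * (cstar z * z) = (cstar z * z) * a" by (metis caz za mult.assoc)
  then have "a * s = s * a" by (intro s(5)) (simp add: d_def algebra_simps)
  then have "a * (1 - s) = (1 - s) * a" by (simp add: algebra_simps)
  then have av: "a * v = v * a" by (rule is_inv_commute[OF v])
  define u where "u = z * v"
  have "cstar u * u = v * ((1 - s) * (1 - s)) * v"
    unfolding s(4) by (simp add: u_def d_def cstar_mult cv mult.assoc)
  also have "\<dots> = (v * (1 - s)) * ((1 - s) * v)" by (simp only: mult.assoc)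
  finally have uu: "cstar u * u = 1" using v by (simp add: is_inv_def)
  obtain z' where z': "is_inv z z'" using neumann'[of z] nw by (auto simp: z_def)
  have "is_inv u ((1 - s) * z')"
    unfolding u_def using is_inv_mult[OF z', of v "1 - s"] v by (simp add: is_inv_def)
  then have "cstar u = (1 - s) * z'" "u * ((1 - s) * z') = 1"
    using uu by (auto simp: is_inv_def) (metis mult.assoc mult_1_left mult_1_right)
  then have uu': "u * cstar u = 1" by simp
  have "u * a = b * u" unfolding u_def by (metis av za mult.assoc)
  then have uab: "u * a * cstar u = b" using uu' by (simp add: mult.assoc)
  have "v = 1 + s * v" using v by (simp add: is_inv_def algebra_simps)
  then have "u = (1 + w) * (1 + s * v)" by (simp add: u_def z_def)
  then have "u - 1 = w + (s * v + w * (s * v))" by (simp add: algebra_simps)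
  then have "u - 1 \<in> I" using wI s(2) two_sided_idealD[OF I(1)] by metis
  then show ?thesis using that uu uu' uab bI by blast
qed

text \<open>Uniform continuity cuts the path into steps shorter than 1/16, and the unitaries of the
  steps are multiplied.\<close>

lemma homotopic_imp_unitary:
  assumes p: "is_proj p" and h: "proj_homotopic p q"
  shows "\<exists>u. cstar u * u = 1 \<and> u * cstar u = 1 \<and> u - 1 \<in> gen_ideal p \<and> u * p * cstar u = q"
proof -
  note I = two_sided_gen_ideal[of p]
  obtain f :: "real \<Rightarrow> 'a" where f: "continuous_on {0..1} f" "\<And>t. t \<in> {0..1} \<Longrightarrow> is_proj (f t)" "f 0 = p" "f 1 = q"
    using h by (auto simp: proj_homotopic_def)
  have "uniformly_continuous_on {0..1} f" using f(1) by (intro compact_uniformly_continuous) auto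
  then obtain \<delta> where \<delta>: "\<delta> > 0" "\<And>s t. s \<in> {0..1} \<Longrightarrow> t \<in> {0..1} \<Longrightarrow> dist s t < \<delta> \<Longrightarrow> dist (f s) (f t) < 1/16"
    unfolding uniformly_continuous_on_def by (metis dist_commute zero_less_divide_1_iff zero_less_numeral)
  obtain n :: nat where n: "n > 0" "1 / real n < \<delta>"
    using \<delta>(1) by (metis ex_inverse_of_nat_less inverse_eq_divide)
  have "\<exists>u. cstar u * u = 1 \<and> u * cstar u = 1 \<and> u - 1 \<in> gen_ideal p \<and> u * p * cstar u = f (real i / real n)"
    if "i \<le> n" for i
    using that
  proof (induction i)
    case 0
    then show ?case using f(3) two_sided_idealD(1)[OF I] by (intro exI[of _ 1]) simp
  next
    case (Suc i)
    then obtain u where u: "cstar u * u = 1" "u * cstar u = 1" "u - 1 \<in> gen_ideal p"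
      "u * p * cstar u = f (real i / real n)" by auto
    \<comment> \<open>Conjugates of \<open>p\<close> stay in the ideal of \<open>p\<close>, so one
      fixed ideal serves every step.\<close>
    have fI: "f (real i / real n) \<in> gen_ideal p"
      unfolding u(4)[symmetric] by (intro two_sided_idealD[OF I] gen_ideal_self)
    have mem: "real i / real n \<in> {0..1}" "real (Suc i) / real n \<in> {0..1}" using Suc.prems n by auto
    have "dist (real i / real n) (real (Suc i) / real n) = 1 / real n"
      using n by (simp add: dist_real_def field_simps)
    then have "norm (f (real i / real n) - f (real (Suc i) / real n)) < 1/16"
      using \<delta>(2)[OF mem] n by (simp add: dist_norm)
    then obtain v where v: "cstar v * v = 1" "v * cstar v = 1" "v - 1 \<in> gen_ideal p"
      "v * f (real i / real n) * cstar v = f (real (Suc i) / real n)"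
      using close_projections_unitary[OF I closed_gen_ideal cstar_mem_gen_ideal[OF p] f(2)[OF mem(1)] f(2)[OF mem(2)] _ fI]
      by metis
    show ?case
    proof (intro exI conjI)
      have "cstar (v * u) * (v * u) = cstar u * (cstar v * v) * u" by (simp add: cstar_mult mult.assoc)
      then show "cstar (v * u) * (v * u) = 1" using u v by simp
      have "(v * u) * cstar (v * u) = v * (u * cstar u) * cstar v" by (simp add: cstar_mult mult.assoc)
      then show "(v * u) * cstar (v * u) = 1" using u v by simp
      have "v * u - 1 = (v - 1) * u + (u - 1)" by (simp add: algebra_simps)
      then show "v * u - 1 \<in> gen_ideal p" using u v two_sided_idealD[OF I] by metis
      have "(v * u) * p * cstar (v * u) = v * (u * p * cstar u) * cstar v"
        by (simp add: cstar_mult mult.assoc)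
      then show "(v * u) * p * cstar (v * u) = f (real (Suc i) / real n)" using u v by simp
    qed
  qed
  from this[of n] show ?thesis using n f(4) by simp
qed

text \<open>Modulo a proper ideal \<open>u\<close> is the scalar \<open>c\<close>, which must have
  modulus 1; dividing by it changes neither unitarity nor the conjugation. If the ideal contains 1,
  \<open>u\<close> itself will do.\<close>

lemma unitize_unitary_normalize:
  assumes p: "is_proj p" and u: "u \<in> unitize (gen_ideal p)" "cstar u * u = 1" "u * cstar u = 1"
  shows "\<exists>v. cstar v * v = 1 \<and> v * cstar v = 1 \<and> v - 1 \<in> gen_ideal p \<and> v * p * cstar v = u * p * cstar u"
proof -
  note I = two_sided_gen_ideal[of p]
  obtain x c where x: "u = x + scaleC c 1" "x \<in> gen_ideal p" using u by (auto simp: unitize_def)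
  show ?thesis
  proof (cases "1 \<in> gen_ideal p")
    case True
    then have "u - 1 \<in> gen_ideal p" using two_sided_idealD(3)[OF I, of 1 "u - 1"] by simp
    then show ?thesis using u by blast
  next
    case False
    have cx: "cstar x \<in> gen_ideal p" by (rule cstar_mem_gen_ideal[OF p x(2)])
    have "cstar u * u = (cstar x * x + scaleC c (cstar x) + scaleC (cnj c) x) + scaleC (c * cnj c) 1"
      unfolding x(1) by (simp add: cstar_add cstar_scaleC algebra_simps mult_scaleC_left mult_scaleC_right scaleC_scaleC scaleC_add_right)
    then have "1 - scaleC (c * cnj c) 1 = cstar x * x + scaleC c (cstar x) + scaleC (cnj c) x"
      using u by (simp add: algebra_simps)
    moreover have "\<dots> \<in> gen_ideal p"
      using cx x(2) by (intro two_sided_idealD(2,3)[OF I] two_sided_ideal_scaleC[OF I])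
    ultimately have "scaleC (1 - c * cnj c) 1 \<in> gen_ideal p" by (simp add: scaleC_diff_left scaleC_one)
    then have "scaleC (1 / (1 - c * cnj c)) (scaleC (1 - c * cnj c) 1) \<in> gen_ideal p"
      by (rule two_sided_ideal_scaleC[OF I])
    then have c: "c * cnj c = 1" using False by (auto simp: scaleC_scaleC scaleC_one split: if_splits)
    then have c': "cnj c * c = 1" by (simp add: mult.commute)
    define v where "v = scaleC (cnj c) u"
    have "v - 1 = scaleC (cnj c) x"
      by (simp add: v_def x(1) scaleC_add_right scaleC_scaleC c' scaleC_one)
    then have "v - 1 \<in> gen_ideal p" using two_sided_ideal_scaleC[OF I x(2)] by simp
    moreover have "cstar v * v = 1" "v * cstar v = 1" "v * p * cstar v = u * p * cstar u"
      using u c c' by (simp_all add: v_def cstar_scaleC mult_scaleC_left mult_scaleC_right scaleC_scaleC scaleC_one)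
    ultimately show ?thesis by blast
  qed
qed

theorem theorem3p3:
  fixes p q :: "'a::cstar_algebra"
  assumes "separative TYPE('a)"
    and "real_rank_zero TYPE('a)"
    and "is_proj p" and "is_proj q"
  shows "proj_homotopic p q \<longleftrightarrow>
           q \<in> unitize (gen_ideal p) \<and> unitarily_equiv_in (unitize (gen_ideal p)) p q"
proof
  note I = two_sided_gen_ideal[of p]
  assume "proj_homotopic p q"
  then obtain u where u: "cstar u * u = 1" "u * cstar u = 1" "u - 1 \<in> gen_ideal p" "u * p * cstar u = q"
    using homotopic_imp_unitary[OF assms(3)] by blast
  have "q \<in> gen_ideal p" unfolding u(4)[symmetric] by (intro two_sided_idealD[OF I] gen_ideal_self)
  then have "q + scaleC 0 1 \<in> unitize (gen_ideal p)" unfolding unitize_def by blast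
  moreover have "(u - 1) + scaleC 1 1 \<in> unitize (gen_ideal p)" unfolding unitize_def using u(3) by blast
  ultimately show "q \<in> unitize (gen_ideal p) \<and> unitarily_equiv_in (unitize (gen_ideal p)) p q"
    using u by (auto simp: unitarily_equiv_in_def scaleC_one)
next
  assume "q \<in> unitize (gen_ideal p) \<and> unitarily_equiv_in (unitize (gen_ideal p)) p q"
  then obtain u where u: "u \<in> unitize (gen_ideal p)" "cstar u * u = 1" "u * cstar u = 1" "u * p * cstar u = q"
    by (auto simp: unitarily_equiv_in_def)
  then obtain v where "cstar v * v = 1" "v * cstar v = 1" "v - 1 \<in> gen_ideal p" "v * p * cstar v = q"
    using unitize_unitary_normalize[OF assms(3) u(1-3)] by auto
  then have "path_component {h. idem h} p q"
    using proj_homotopic_of_unitary[OF assms(1-3)] by blast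
  then show "proj_homotopic p q"
    by (rule path_component_idem_imp_proj_homotopic[OF assms(2-4)])
qed

end
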